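(* Let $u\in H$. For any $\mathbb{P}$-a.s. positive random variable $F\in\mathrm{Dom}(\nabla)$ such that $D_tF\in\mathrm{Dom}(\nabla)$, $t\in[0,T]$, and $(D_tD_tF)_{t\in[0,T]}\in L^1(\Omega\times[0,T],\mathbb{P}_u\otimes\mu)$, we have $$\mathbb{E}_u\left[\|X+D\log F-u\|^2_{L^2([0,T],d\mu)}\right]=\mathrm{R}(\gamma,\mu,\hat u)-\mathbb{E}_u\left[\|D\log F\|^2_{L^2([0,T],d\mu)}\right]+2\,\mathbb{E}_u\left[\frac{\Delta F}{F}\right].$$
   Context: Let $T>0$ and let $(X_t)_{t\in[0,T]}$ be a real centered Gaussian process with covariance $\gamma(s,t)=\mathbb{E}[X_sX_t]$ on $(\Omega,\mathcal F,\mathbb{P})$, with $\mathcal F$ generated by $X$; let $\mu$ be a finite Borel measure on $[0,T]$. $X$ is represented as an isonormal process $\{X(h):h\in H\}$ on a real separable Hilbert space $H$, i.e. $\mathbb{E}[X(h)X(g)]=\langle h,g\rangle_H$, in one of two ways. (A) (Paley-Wiener) $H$ is the completion of the span of $\chi_t(s)=\min(s,t)$ for $\langle\chi_t,\chi_s\rangle_H=\gamma(s,t)$, with $X(\chi_t)=X_t$; $\langle h,g\rangle=\langle\dot h,\dot g\rangle_{L^2([0,T],dt)}$, $\gamma(s,t)=\int_0^{s\wedge t}K(t,r)K(s,r)dr$ for a deterministic kernel $K$, $(Kh)(t)=\int_0^tK(t,s)\dot h(s)ds$ is differentiable in $t$, $\Gamma=KK^*$ (adjoint for $\langle\cdot,\cdot\rangle$),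 and $\langle h,g\rangle_H=\langle h,\Gamma g\rangle$. (B) (Karhunen-Loève) $\langle h,g\rangle=\langle h,g\rangle_{L^2([0,T],d\mu)}$, $(\Gamma g)(t)=\int_0^Tg(s)\gamma(s,t)\mu(ds)$, $\langle h,g\rangle_H=\langle h,\Gamma g\rangle$, $X(h)=\int_0^TX_sh(s)\mu(ds)$. For deterministic $u\in H$, $\mathbb{P}_u$ is the probability with density $\exp\left(X(\Gamma^{-1}u)-\frac12\|\Gamma^{-1}u\|_H^2\right)$ with respect to $\mathbb{P}$, and $\mathbb{E}_u$ is expectation under $\mathbb{P}_u$. Under $\mathbb{P}_u$, $X^u:=X-u$ (i.e. $X^u_t=X_t-u(t)$, $X^u(g)=X(g)-\langle g,u\rangle$) has the law of $X$ under $\mathbb{P}$. The process $\hat u:=X$ is viewed as an estimator of $u$, with risk $\mathrm{R}(\gamma,\mu,\hat u):=\mathbb{E}_u\left[\int_0^T|X_t-u_t|^2\mu(dt)\right]=\int_0^T\gamma(t,t)\mu(dt)$. Fix a total subset $(h_n)_{n\ge1}$ of $H$. For $F=f_n(X^u(h_1),\dots,X^u(h_n))$ with $f_n$ infinitely differentiable and rapidly decreasing on $\mathbb{R}^n$, $\nabla_tF=\sum_{i=1}^nh_i(t)\,\partial_if_n(X^u(h_1),\dots,X^u(h_n))$. The $H$-valued operator $\nabla$ is closable, with closed domain $\mathrm{Dom}(\nabla)$. For $F\in\mathrm{Dom}(\nabla)$, $D_tF:=(\Gamma\nabla F)(t)$, $t\in[0,T]$, and $D_t\log F=D_tF/F$.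 The Laplacian is $\Delta F=\int_0^TD_tD_tF\,\mu(dt)$.
   Formalization: The identity is stated for ΔF/F integrable under P_u (otherwise the right side can read R−∞+∞), together with an unconditional version in [0,∞] with negative terms moved to the left; u∈H is read as Γ⁻¹u∈H, and in case (B) ∫γ(t,t)μ(dt) is assumed finite. *)

theory Defs
  imports "HOL-Probability.Probability"
begin

section \<open>Gaussian families and isonormal processes\<close>

text \<open>Degenerate Gaussians (almost surely zero) are included.\<close>

definition centered_gaussian :: "'a measure \<Rightarrow> ('a \<Rightarrow> real) \<Rightarrow> bool" where
  "centered_gaussian M Y \<longleftrightarrow> Y \<in> borel_measurable M \<and>
     ((AE \<omega> in M. Y \<omega> = 0) \<or>
      (\<exists>\<sigma>>0. distributed M lborel Y (\<lambda>x. ennreal (normal_density 0 \<sigma> x))))"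

definition centered_gaussian_family ::
  "'a measure \<Rightarrow> 'i set \<Rightarrow> ('i \<Rightarrow> 'a \<Rightarrow> real) \<Rightarrow> bool" where
  "centered_gaussian_family M I Y \<longleftrightarrow>
     (\<forall>J c. finite J \<and> J \<subseteq> I \<longrightarrow> centered_gaussian M (\<lambda>\<omega>. \<Sum>i\<in>J. c i * Y i \<omega>))"

definition covariance :: "'a measure \<Rightarrow> (real \<Rightarrow> 'a \<Rightarrow> real) \<Rightarrow> real \<Rightarrow> real \<Rightarrow> real" where
  "covariance M X s t = (\<integral>\<omega>. X s \<omega> * X t \<omega> \<partial>M)"

definition isonormal :: "'a measure \<Rightarrow> ('h::real_inner \<Rightarrow> 'a \<Rightarrow> real) \<Rightarrow> bool" where
  "isonormal M W \<longleftrightarrow> centered_gaussian_family M UNIV W \<and>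
     (\<forall>h g. (\<integral>\<omega>. W h \<omega> * W g \<omega> \<partial>M) = inner h g)"

text \<open>
  Joint measurability of \<open>(\<omega>, t) \<mapsto> X t \<omega>\<close> is what makes the pathwise integrals against
  \<open>\<mu>\<close> meaningful.
\<close>

definition gaussian_setting ::
  "'a measure \<Rightarrow> real \<Rightarrow> (real \<Rightarrow> 'a \<Rightarrow> real) \<Rightarrow> real measure \<Rightarrow> bool" where
  "gaussian_setting M T X \<mu> \<longleftrightarrow>
     0 < T \<and> prob_space M \<and> centered_gaussian_family M {0..T} X \<and>
     sets M = sigma_sets (space M)
       (\<Union>t\<in>{0..T}. {X t -` B \<inter> space M | B. B \<in> sets borel}) \<and>
     finite_measure \<mu> \<and> sets \<mu> = sets (restrict_space borel {0..T}) \<and>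
     (\<lambda>(\<omega>, t). X t \<omega>) \<in> borel_measurable (M \<Otimes>\<^sub>M \<mu>)"

definition L2_fun :: "'b measure \<Rightarrow> ('b \<Rightarrow> real) set" where
  "L2_fun N = {f \<in> borel_measurable N. integrable N (\<lambda>x. (f x)\<^sup>2)}"

definition L2_norm_sq :: "'b measure \<Rightarrow> ('b \<Rightarrow> real) \<Rightarrow> real" where
  "L2_norm_sq N f = (\<integral>x. (f x)\<^sup>2 \<partial>N)"

section \<open>The Paley-Wiener representation\<close>

text \<open>
  \<open>CM T\<close> consists of the functions on \<open>[0,T]\<close> of the form \<open>h(t) = \<integral>\<^sub>0\<^sup>t h'(s) ds\<close> with \<open>h'\<close> square
  integrable; it is the Hilbert space of the scalar product
  \<open>\<langle>h,g\<rangle> = \<integral>\<^sub>0\<^sup>T h'(s) g'(s) ds\<close>. \<open>CM_deriv T h\<close> is a version of the almost everywhere unique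
  density \<open>h'\<close>.
\<close>

definition leb_upto :: "real \<Rightarrow> real measure" where
  "leb_upto t = restrict_space lborel {0..t}"

definition is_CM_deriv :: "real \<Rightarrow> (real \<Rightarrow> real) \<Rightarrow> (real \<Rightarrow> real) \<Rightarrow> bool" where
  "is_CM_deriv T h h' \<longleftrightarrow> h' \<in> L2_fun (leb_upto T) \<and>
     (\<forall>t\<in>{0..T}. h t = (\<integral>s. h' s \<partial>leb_upto t))"

definition CM :: "real \<Rightarrow> (real \<Rightarrow> real) set" where
  "CM T = {h. \<exists>h'. is_CM_deriv T h h'}"

definition CM_deriv :: "real \<Rightarrow> (real \<Rightarrow> real) \<Rightarrow> real \<Rightarrow> real" where
  "CM_deriv T h = (SOME h'. is_CM_deriv T h h')"

definition CM_inner :: "real \<Rightarrow> (real \<Rightarrow> real) \<Rightarrow> (real \<Rightarrow> real) \<Rightarrow> real" where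
  "CM_inner T h g = (\<integral>s. CM_deriv T h s * CM_deriv T g s \<partial>leb_upto T)"

definition chi :: "real \<Rightarrow> real \<Rightarrow> real" where
  "chi t s = min s t"

definition volterra_op ::
  "real \<Rightarrow> (real \<Rightarrow> real \<Rightarrow> real) \<Rightarrow> (real \<Rightarrow> real) \<Rightarrow> real \<Rightarrow> real" where
  "volterra_op T K h t = (\<integral>s. K t s * CM_deriv T h s \<partial>leb_upto t)"

text \<open>
  The type \<open>'h\<close> is the completed space \<open>H\<close>, and \<open>e t\<close> is the element of \<open>H\<close> given by \<open>chi t\<close>:
  a completion is a complete space together with a scalar-product preserving map whose span is
  dense. Differentiability of \<open>K h\<close> is understood in the sense of \<open>CM T\<close>, which is what is needed
  to form the adjoint of \<open>K\<close>. The operator \<open>\<Gamma>\<close> is \<open>K K\<^sup>*\<close> on the functions \<open>chi s\<close>; on the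
  completion it is fixed by the relation \<open>\<langle>h,g\<rangle>\<^sub>H = \<langle>h,\<Gamma> g\<rangle>\<close>, applied to \<open>h = chi t\<close>.
\<close>

definition paley_wiener ::
  "'a measure \<Rightarrow> real \<Rightarrow> (real \<Rightarrow> 'a \<Rightarrow> real) \<Rightarrow> ('h::real_inner \<Rightarrow> 'a \<Rightarrow> real) \<Rightarrow>
   ('h \<Rightarrow> real \<Rightarrow> real) \<Rightarrow> bool" where
  "paley_wiener M T X W \<Gamma> \<longleftrightarrow> (\<exists>e K Kadj.
     (\<forall>s\<in>{0..T}. \<forall>t\<in>{0..T}. inner (e s) (e t) = covariance M X s t) \<and>
     closure (span (e ` {0..T})) = UNIV \<and>
     (\<forall>t\<in>{0..T}. AE \<omega> in M. W (e t) \<omega> = X t \<omega>) \<and>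
     (\<forall>t\<in>{0..T}. K t \<in> L2_fun (leb_upto t)) \<and>
     (\<forall>s\<in>{0..T}. \<forall>t\<in>{0..T}.
        covariance M X s t = (\<integral>r. K t r * K s r \<partial>leb_upto (min s t))) \<and>
     (\<forall>h\<in>CM T. volterra_op T K h \<in> CM T) \<and>
     (\<forall>g\<in>CM T. Kadj g \<in> CM T \<and>
        (\<forall>h\<in>CM T. CM_inner T (volterra_op T K h) g = CM_inner T h (Kadj g))) \<and>
     (\<forall>s\<in>{0..T}. \<forall>t\<in>{0..T}. \<Gamma> (e s) t = volterra_op T K (Kadj (chi s)) t) \<and>
     (\<forall>g. \<Gamma> g \<in> CM T \<and> (\<forall>t\<in>{0..T}. inner (e t) g = CM_inner T (chi t) (\<Gamma> g))))"

section \<open>The Karhunen-Loeve representation\<close>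

definition cov_op ::
  "'a measure \<Rightarrow> (real \<Rightarrow> 'a \<Rightarrow> real) \<Rightarrow> real measure \<Rightarrow> (real \<Rightarrow> real) \<Rightarrow> real \<Rightarrow> real" where
  "cov_op M X \<mu> g t = (\<integral>s. g s * covariance M X s t \<partial>\<mu>)"

text \<open>
  Here \<open>H\<close> is the completion of \<open>L\<^sup>2(\<mu>)\<close> for \<open>\<langle>h,g\<rangle>\<^sub>H = \<langle>h,\<Gamma> g\<rangle>\<close>, with canonical map \<open>\<iota>\<close>. Integrability
  of the variance makes \<open>X(h) = \<integral> X\<^sub>s h(s) \<mu>(ds)\<close> well defined for \<open>h\<close> in \<open>L\<^sup>2(\<mu>)\<close>. Since
  \<open>\<bar>(\<Gamma> g)(t)\<bar>\<^sup>2 \<le> \<gamma>(t,t) \<parallel>g\<parallel>\<^sub>H\<^sup>2\<close>, the evaluations of \<open>\<Gamma>\<close> extend continuously from \<open>L\<^sup>2(\<mu>)\<close> to \<open>H\<close>,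
  which fixes \<open>\<Gamma> g\<close> at every point \<open>t\<close> and not only \<open>\<mu>\<close>-almost everywhere.
\<close>

definition karhunen_loeve ::
  "'a measure \<Rightarrow> real \<Rightarrow> (real \<Rightarrow> 'a \<Rightarrow> real) \<Rightarrow> real measure \<Rightarrow>
   ('h::real_inner \<Rightarrow> 'a \<Rightarrow> real) \<Rightarrow> ('h \<Rightarrow> real \<Rightarrow> real) \<Rightarrow> bool" where
  "karhunen_loeve M T X \<mu> W \<Gamma> \<longleftrightarrow> (\<exists>\<iota>.
     integrable \<mu> (\<lambda>t. covariance M X t t) \<and>
     (\<forall>h\<in>L2_fun \<mu>. \<forall>g\<in>L2_fun \<mu>. inner (\<iota> h) (\<iota> g) = (\<integral>t. h t * cov_op M X \<mu> g t \<partial>\<mu>)) \<and>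
     closure (\<iota> ` L2_fun \<mu>) = UNIV \<and>
     (\<forall>h\<in>L2_fun \<mu>. AE \<omega> in M. W (\<iota> h) \<omega> = (\<integral>s. X s \<omega> * h s \<partial>\<mu>)) \<and>
     (\<forall>g\<in>L2_fun \<mu>. \<forall>t\<in>{0..T}. \<Gamma> (\<iota> g) t = cov_op M X \<mu> g t) \<and>
     (\<forall>t\<in>{0..T}. bounded_linear (\<lambda>g. \<Gamma> g t)) \<and>
     (\<forall>h\<in>L2_fun \<mu>. \<forall>g. inner (\<iota> h) g = (\<integral>t. h t * \<Gamma> g t \<partial>\<mu>)))"

section \<open>Deterministic drifts\<close>

text \<open>
  In both representations \<open>\<Gamma>\<close> is injective, so \<open>\<Gamma>\<^sup>-\<^sup>1 u\<close> is well defined for the drifts in the range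
  of \<open>\<Gamma>\<close>. For arbitrary \<open>g\<close> in \<open>H\<close> the pairing \<open>\<langle>g,u\<rangle>\<close> is \<open>\<langle>g,\<Gamma>\<^sup>-\<^sup>1 u\<rangle>\<^sub>H\<close>, by
  \<open>\<langle>h,g\<rangle>\<^sub>H = \<langle>h,\<Gamma> g\<rangle>\<close>.
\<close>

definition is_drift :: "real \<Rightarrow> ('h \<Rightarrow> real \<Rightarrow> real) \<Rightarrow> (real \<Rightarrow> real) \<Rightarrow> bool" where
  "is_drift T \<Gamma> u \<longleftrightarrow> (\<exists>v. \<forall>t\<in>{0..T}. \<Gamma> v t = u t)"

definition Gamma_inv :: "real \<Rightarrow> ('h \<Rightarrow> real \<Rightarrow> real) \<Rightarrow> (real \<Rightarrow> real) \<Rightarrow> 'h" where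
  "Gamma_inv T \<Gamma> u = (THE v. \<forall>t\<in>{0..T}. \<Gamma> v t = u t)"

definition drift_measure ::
  "'a measure \<Rightarrow> real \<Rightarrow> ('h::real_inner \<Rightarrow> 'a \<Rightarrow> real) \<Rightarrow> ('h \<Rightarrow> real \<Rightarrow> real) \<Rightarrow>
   (real \<Rightarrow> real) \<Rightarrow> 'a measure" where
  "drift_measure M T W \<Gamma> u = density M
     (\<lambda>\<omega>. ennreal (exp (W (Gamma_inv T \<Gamma> u) \<omega> - (1/2) * (norm (Gamma_inv T \<Gamma> u))\<^sup>2)))"

definition shifted ::
  "real \<Rightarrow> ('h::real_inner \<Rightarrow> 'a \<Rightarrow> real) \<Rightarrow> ('h \<Rightarrow> real \<Rightarrow> real) \<Rightarrow> (real \<Rightarrow> real) \<Rightarrow>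
   'h \<Rightarrow> 'a \<Rightarrow> real" where
  "shifted T W \<Gamma> u g \<omega> = W g \<omega> - inner g (Gamma_inv T \<Gamma> u)"

definition risk :: "'a measure \<Rightarrow> (real \<Rightarrow> 'a \<Rightarrow> real) \<Rightarrow> real measure \<Rightarrow> (real \<Rightarrow> real) \<Rightarrow> real" where
  "risk Pu X \<mu> u = (\<integral>\<omega>. L2_norm_sq \<mu> (\<lambda>t. X t \<omega> - u t) \<partial>Pu)"

section \<open>Gradient and Malliavin derivative\<close>

text \<open>
  A function on \<open>\<real>\<^sup>n\<close> is a function of sequences that depends only on the coordinates below \<open>n\<close>.
  In \<open>schwartz\<close>, existence and boundedness of all iterated partial derivatives force them to be
  Lipschitz, hence continuous, so the function is infinitely differentiable.
\<close>

definition pderiv_at :: "nat \<Rightarrow> ((nat \<Rightarrow> real) \<Rightarrow> real) \<Rightarrow> (nat \<Rightarrow> real) \<Rightarrow> real" where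
  "pderiv_at i f x = deriv (\<lambda>y. f (x(i := y))) (x i)"

definition schwartz :: "nat \<Rightarrow> ((nat \<Rightarrow> real) \<Rightarrow> real) \<Rightarrow> bool" where
  "schwartz n f \<longleftrightarrow>
     (\<forall>x y. (\<forall>i<n. x i = y i) \<longrightarrow> f x = f y) \<and>
     (\<forall>is. set is \<subseteq> {..<n} \<longrightarrow>
        (\<forall>x. \<forall>i<n. (\<lambda>y. foldr pderiv_at is f (x(i := y))) differentiable at (x i)) \<and>
        (\<forall>k::nat. \<exists>C. \<forall>x. (1 + (\<Sum>i<n. \<bar>x i\<bar>)) ^ k * \<bar>foldr pderiv_at is f x\<bar> \<le> C))"

text \<open>
  \<open>cylindrical Y h F G\<close>: \<open>F = f(Y(h\<^sub>1),\<dots>,Y(h\<^sub>n))\<close> and \<open>G = \<nabla>F\<close>. Indices start at zero. For the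
  gradient of the shifted process take \<open>Y = X\<^sup>u\<close>.
\<close>

definition cylindrical ::
  "('h::real_inner \<Rightarrow> 'a \<Rightarrow> real) \<Rightarrow> (nat \<Rightarrow> 'h) \<Rightarrow> ('a \<Rightarrow> real) \<Rightarrow> ('a \<Rightarrow> 'h) \<Rightarrow> bool" where
  "cylindrical Y h F G \<longleftrightarrow> (\<exists>n\<ge>1. \<exists>f. schwartz n f \<and>
     F = (\<lambda>\<omega>. f (\<lambda>i. Y (h i) \<omega>)) \<and>
     G = (\<lambda>\<omega>. \<Sum>i<n. pderiv_at i f (\<lambda>j. Y (h j) \<omega>) *\<^sub>R h i))"

text \<open>
  The graph of the closure of \<open>\<nabla>\<close> as an operator from \<open>L\<^sup>2(P)\<close> to \<open>L\<^sup>2(P; H)\<close>. Gradients are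
  unique up to null sets.
\<close>

definition is_nabla ::
  "'a measure \<Rightarrow> ('h::{real_inner, banach, second_countable_topology} \<Rightarrow> 'a \<Rightarrow> real) \<Rightarrow>
   (nat \<Rightarrow> 'h) \<Rightarrow> ('a \<Rightarrow> real) \<Rightarrow> ('a \<Rightarrow> 'h) \<Rightarrow> bool" where
  "is_nabla P Y h F G \<longleftrightarrow> F \<in> borel_measurable P \<and> G \<in> borel_measurable P \<and>
     (\<exists>Fk Gk. (\<forall>k::nat. cylindrical Y h (Fk k) (Gk k)) \<and>
        (\<lambda>k. \<integral>\<^sup>+\<omega>. ennreal ((Fk k \<omega> - F \<omega>)\<^sup>2) \<partial>P) \<longlonglongrightarrow> 0 \<and>
        (\<lambda>k. \<integral>\<^sup>+\<omega>. ennreal ((norm (Gk k \<omega> - G \<omega>))\<^sup>2) \<partial>P) \<longlonglongrightarrow> 0)"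

definition Dom_nabla ::
  "'a measure \<Rightarrow> ('h::{real_inner, banach, second_countable_topology} \<Rightarrow> 'a \<Rightarrow> real) \<Rightarrow>
   (nat \<Rightarrow> 'h) \<Rightarrow> ('a \<Rightarrow> real) set" where
  "Dom_nabla P Y h = {F. \<exists>G. is_nabla P Y h F G}"

definition nabla ::
  "'a measure \<Rightarrow> ('h::{real_inner, banach, second_countable_topology} \<Rightarrow> 'a \<Rightarrow> real) \<Rightarrow>
   (nat \<Rightarrow> 'h) \<Rightarrow> ('a \<Rightarrow> real) \<Rightarrow> 'a \<Rightarrow> 'h" where
  "nabla P Y h F = (SOME G. is_nabla P Y h F G)"

definition mderiv ::
  "'a measure \<Rightarrow> ('h::{real_inner, banach, second_countable_topology} \<Rightarrow> 'a \<Rightarrow> real) \<Rightarrow>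
   (nat \<Rightarrow> 'h) \<Rightarrow> ('h \<Rightarrow> real \<Rightarrow> real) \<Rightarrow> ('a \<Rightarrow> real) \<Rightarrow> real \<Rightarrow> 'a \<Rightarrow> real" where
  "mderiv P Y h \<Gamma> F t \<omega> = \<Gamma> (nabla P Y h F \<omega>) t"

definition mderiv_log ::
  "'a measure \<Rightarrow> ('h::{real_inner, banach, second_countable_topology} \<Rightarrow> 'a \<Rightarrow> real) \<Rightarrow>
   (nat \<Rightarrow> 'h) \<Rightarrow> ('h \<Rightarrow> real \<Rightarrow> real) \<Rightarrow> ('a \<Rightarrow> real) \<Rightarrow> real \<Rightarrow> 'a \<Rightarrow> real" where
  "mderiv_log P Y h \<Gamma> F t \<omega> = mderiv P Y h \<Gamma> F t \<omega> / F \<omega>"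

text \<open>
  For each \<open>t\<close> the variable \<open>D\<^sub>t D\<^sub>t F\<close> is determined only up to a null set, which may depend on
  \<open>t\<close>. The predicate says that \<open>DD\<close> is a version of \<open>(D\<^sub>t D\<^sub>t F)\<^sub>t\<close> in \<open>L\<^sup>1(P \<otimes> \<mu>)\<close>.
\<close>

definition is_second_mderiv ::
  "'a measure \<Rightarrow> ('h::{real_inner, banach, second_countable_topology} \<Rightarrow> 'a \<Rightarrow> real) \<Rightarrow>
   (nat \<Rightarrow> 'h) \<Rightarrow> ('h \<Rightarrow> real \<Rightarrow> real) \<Rightarrow> real measure \<Rightarrow> ('a \<Rightarrow> real) \<Rightarrow>
   (real \<Rightarrow> 'a \<Rightarrow> real) \<Rightarrow> bool" where
  "is_second_mderiv P Y h \<Gamma> \<mu> F DD \<longleftrightarrow>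
     integrable (P \<Otimes>\<^sub>M \<mu>) (\<lambda>(\<omega>, t). DD t \<omega>) \<and>
     (AE t in \<mu>. AE \<omega> in P. DD t \<omega> = mderiv P Y h \<Gamma> (mderiv P Y h \<Gamma> F t) t \<omega>)"

definition laplacian :: "real measure \<Rightarrow> (real \<Rightarrow> 'a \<Rightarrow> real) \<Rightarrow> 'a \<Rightarrow> real" where
  "laplacian \<mu> DD \<omega> = (\<integral>t. DD t \<omega> \<partial>\<mu>)"

end

theory Submission
  imports Defs
begin

text \<open>
  Formally the identity is an expanded square: the cross term
  \<open>2 E\<^sub>u \<integral> (X\<^sub>t - u\<^sub>t) D\<^sub>t F / F d\<mu>\<close> equals \<open>2 E\<^sub>u[\<Delta>F / F] - 2 E\<^sub>u \<parallel>D log F\<parallel>\<^sup>2\<close>, by Gaussian integration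
  by parts applied, for each fixed \<open>t\<close>, to the product of \<open>D\<^sub>t F\<close> and \<open>1 / F\<close>. Three points carry the
  proof.

  \<^item> Under \<open>P\<^sub>u\<close> the process \<open>X\<^sup>u\<close> is again isonormal (\<open>isonormal_tilted\<close>), and both representations
    provide vectors \<open>e\<^sub>t\<close> in \<open>H\<close> with \<open>(\<Gamma> g)(t) = \<langle>e\<^sub>t, g\<rangle>\<close> for all \<open>g\<close> and \<open>X\<^sub>t = X(e\<^sub>t)\<close> almost surely,
    for \<open>\<mu>\<close>-almost every \<open>t\<close> (\<open>evaluation_vectors\<close>). Hence \<open>X\<^sub>t - u\<^sub>t = X\<^sup>u(e\<^sub>t)\<close> and \<open>D\<^sub>t F = \<langle>e\<^sub>t, \<nabla>F\<rangle>\<close>. In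
    the Paley-Wiener case \<open>e\<^sub>t\<close> is the class of \<open>chi t\<close>. In the Karhunen-Loeve case \<open>e\<^sub>t\<close> comes from the
    Riesz theorem, and \<open>X\<^sub>t = X(e\<^sub>t)\<close> holds because both sides, as processes in \<open>(\<omega>, t)\<close>, have the same
    integrals over all rectangles.

  \<^item> Integration by parts for \<open>G \<psi>(F)\<close> with \<open>F\<close> and \<open>G\<close> in the domain of \<open>\<nabla>\<close> and \<open>\<psi>\<close> of class \<open>C\<^sup>1\<close> with
    bounded value and derivative (\<open>ibp_is_nabla\<close>). For cylindrical variables the direction of
    differentiation is split off: a Gaussian sequence is an independent sum of its component along
    a unit vector \<open>e\<close> and a remainder (\<open>distr_split_unit\<close>), so that Stein's identity in one
    variable applies. The general case follows by dominated convergence along a fast subsequence.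

  \<^item> As \<open>1 / F\<close> is unbounded, it is replaced by \<open>1 / (F + \<epsilon>)\<close>, whose derivative in \<open>F\<close> is minus its
    square. With \<open>a = X - u\<close> and \<open>b\<^sub>\<epsilon> = D F / (F + \<epsilon>)\<close> this gives
    \<open>\<parallel>a + b\<^sub>\<epsilon>\<parallel>\<^sup>2 + \<parallel>b\<^sub>\<epsilon>\<parallel>\<^sup>2 = \<parallel>a\<parallel>\<^sup>2 + 2 E\<^sub>u[\<Delta>F / (F + \<epsilon>)]\<close>. As \<open>\<epsilon>\<close> decreases to \<open>0\<close>, the square of \<open>b\<^sub>\<epsilon>\<close> and the
    positive and negative parts of the last integrand increase. If \<open>\<parallel>b\<^sub>0\<parallel>\<close> is finite, the first term
    converges by domination; otherwise both sides of the limit identity are infinite. This proves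
    the identity in \<open>[0,\<infinity>]\<close> (\<open>quadratic_identity_limit\<close>), and the real one by subtraction.
\<close>

section \<open>Fourier uniqueness for laws of sequences\<close>

text \<open>Levy's uniqueness theorem, after normalizing both measures by their common mass.\<close>

lemma distr_real_eqI_fourier:
  fixes X1 :: "'a \<Rightarrow> real" and X2 :: "'b \<Rightarrow> real"
  assumes fin: "finite_measure N1" "finite_measure N2"
    and [measurable]: "X1 \<in> borel_measurable N1" "X2 \<in> borel_measurable N2"
    and eq: "\<And>\<phi> \<theta>. (\<integral>w. cos (\<phi> + \<theta> * X1 w) \<partial>N1) = (\<integral>w. cos (\<phi> + \<theta> * X2 w) \<partial>N2)"
  shows "distr N1 borel X1 = distr N2 borel X2"
proof -
  interpret N1: finite_measure N1 by fact
  interpret N2: finite_measure N2 by fact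
  \<comment> \<open>Phase and frequency \<open>0\<close> compare the total masses.\<close>
  have mass: "measure N1 (space N1) = measure N2 (space N2)" using eq[of 0 0] by simp
  define m where "m = measure N1 (space N1)"
  have m2: "m = measure N2 (space N2)" using mass m_def by simp
  have em: "emeasure N1 (space N1) = ennreal m" "emeasure N2 (space N2) = ennreal m"
    using N1.emeasure_eq_measure N2.emeasure_eq_measure m_def m2 by auto
  show ?thesis
  proof (cases "m = 0")
    case True
    have z: "emeasure N1 A = 0" for A
      using em(1) True emeasure_space[of N1 A] by simp
    have z2: "emeasure N2 A = 0" for A
      using em(2) True emeasure_space[of N2 A] by simp
    show ?thesis by (rule measure_eqI) (auto simp: emeasure_distr z z2)
  next
    case False
    then have mp: "m > 0" using m_def measure_nonneg[of N1 "space N1"] by linarith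
    define D1 where "D1 = distr (density N1 (\<lambda>_. ennreal (1/m))) borel X1"
    define D2 where "D2 = distr (density N2 (\<lambda>_. ennreal (1/m))) borel X2"
    have rd: "real_distribution (distr (density N (\<lambda>_. ennreal (1/m))) borel X)"
      if "emeasure N (space N) = ennreal m" "X \<in> borel_measurable N" for N :: "'x measure" and X
    proof -
      have "prob_space (density N (\<lambda>_. ennreal (1/m)))"
        by (rule prob_spaceI) (use that mp in \<open>simp add: emeasure_density ennreal_mult[symmetric]\<close>)
      then have "prob_space (distr (density N (\<lambda>_. ennreal (1/m))) borel X)"
        by (rule prob_space.prob_space_distr) (use that in simp)
      then show ?thesis by (simp add: real_distribution_def real_distribution_axioms_def)
    qed
    have ii: "integrable N (\<lambda>x. iexp (t * X x))"
      if "finite_measure N" "X \<in> borel_measurable N" for N :: "'x measure" and X t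
      by (rule finite_measure.integrable_const_bound[OF that(1), where B = 1]) (use that in auto)
    note i1 = ii[OF fin(1) assms(3)] and i2 = ii[OF fin(2) assms(4)]
    have "char D1 t = char D2 t" for t
    proof -
      have "(\<integral>x. iexp (t * X1 x) \<partial>N1) = (\<integral>x. iexp (t * X2 x) \<partial>N2)"
      proof (rule complex_eqI)
        show "Re (\<integral>x. iexp (t * X1 x) \<partial>N1) = Re (\<integral>x. iexp (t * X2 x) \<partial>N2)"
          using eq[of 0 t] integral_Re[OF i1[of t]] integral_Re[OF i2[of t]]
          by (simp add: Re_exp)
        show "Im (\<integral>x. iexp (t * X1 x) \<partial>N1) = Im (\<integral>x. iexp (t * X2 x) \<partial>N2)"
          using eq[of "- (pi / 2)" t] integral_Im[OF i1[of t]] integral_Im[OF i2[of t]]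
          by (simp add: Im_exp cos_diff)
      qed
      then show ?thesis unfolding char_def D1_def D2_def
        using mp by (simp add: integral_distr integral_density)
    qed
    then have D: "D1 = D2" unfolding D1_def D2_def by (intro Levy_uniqueness rd em) auto
    show ?thesis
    proof (rule measure_eqI)
      fix A assume "A \<in> sets (distr N1 borel X1)"
      then have [measurable]: "A \<in> sets borel" by simp
      have "emeasure D1 A = ennreal (1/m) * emeasure N1 (X1 -` A \<inter> space N1)"
        unfolding D1_def by (simp add: emeasure_distr emeasure_density nn_integral_cmult)
      moreover have "emeasure D2 A = ennreal (1/m) * emeasure N2 (X2 -` A \<inter> space N2)"
        unfolding D2_def by (simp add: emeasure_distr emeasure_density nn_integral_cmult)
      ultimately have "ennreal (1/m) * emeasure N1 (X1 -` A \<inter> space N1)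
          = ennreal (1/m) * emeasure N2 (X2 -` A \<inter> space N2)" using D by simp
      then have "emeasure N1 (X1 -` A \<inter> space N1) = emeasure N2 (X2 -` A \<inter> space N2)"
        using mp by (simp add: ennreal_mult_cancel_left)
      then show "emeasure (distr N1 borel X1) A = emeasure (distr N2 borel X2) A"
        by (simp add: emeasure_distr)
    qed simp
  qed
qed

text \<open>
  A signed weight \<open>w\<close> bounded by \<open>1\<close> is the difference of the weights \<open>1 + w\<close> and \<open>1\<close>, both of which give
  finite measures.
\<close>

lemma signed_weight_density:
  fixes w :: "'a \<Rightarrow> real"
  assumes "finite_measure N" and [measurable]: "w \<in> borel_measurable N" and w: "\<And>x. \<bar>w x\<bar> \<le> 1"
  defines "D \<equiv> density N (\<lambda>x. ennreal (1 + w x))"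
  shows "finite_measure D"
    and "f \<in> borel_measurable N \<Longrightarrow> (\<And>x. \<bar>f x\<bar> \<le> 1) \<Longrightarrow> (\<integral>x. f x \<partial>D) = (\<integral>x. f x \<partial>N) + (\<integral>x. f x * w x \<partial>N)"
proof -
  interpret finite_measure N by fact
  have p: "0 \<le> 1 + w x" for x using w[of x] by auto
  have I[simp]: "integrable N f" if "f \<in> borel_measurable N" and "\<And>x. \<bar>f x\<bar> \<le> 1" for f :: "_ \<Rightarrow> real"
    by (rule integrable_const_bound[where B = 1]) (use that in auto)
  show "finite_measure D" unfolding D_def
    by (intro finite_measureI) (use p in \<open>auto simp: emeasure_density nn_integral_eq_integral w cong: nn_integral_cong\<close>)
  assume [measurable]: "f \<in> borel_measurable N" and b: "\<And>x. \<bar>f x\<bar> \<le> 1"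
  have "\<bar>f x * w x\<bar> \<le> 1" for x using mult_mono[OF b w] by (simp add: abs_mult)
  then show "(\<integral>x. f x \<partial>D) = (\<integral>x. f x \<partial>N) + (\<integral>x. f x * w x \<partial>N)"
    unfolding D_def by (subst integral_density) (use p b in \<open>auto simp: algebra_simps\<close>)
qed

text \<open>Trigonometric weights will carry the remaining coordinates of a sequence.\<close>

lemma weighted_integral_eqI_fourier:
  fixes X1 w1 :: "'a \<Rightarrow> real" and X2 w2 :: "'b \<Rightarrow> real"
  assumes fin: "finite_measure N1" "finite_measure N2"
    and [measurable]: "X1 \<in> borel_measurable N1" "X2 \<in> borel_measurable N2"
      "w1 \<in> borel_measurable N1" "w2 \<in> borel_measurable N2"
    and w1: "\<And>w. \<bar>w1 w\<bar> \<le> 1" and w2: "\<And>w. \<bar>w2 w\<bar> \<le> 1"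
    and eq: "\<And>\<phi> \<theta>. (\<integral>w. cos (\<phi> + \<theta> * X1 w) \<partial>N1) = (\<integral>w. cos (\<phi> + \<theta> * X2 w) \<partial>N2)"
    and eqw: "\<And>\<phi> \<theta>. (\<integral>w. cos (\<phi> + \<theta> * X1 w) * w1 w \<partial>N1) = (\<integral>w. cos (\<phi> + \<theta> * X2 w) * w2 w \<partial>N2)"
    and A[measurable]: "A \<in> sets borel"
  shows "(\<integral>w. indicator A (X1 w) * w1 w \<partial>N1) = (\<integral>w. indicator A (X2 w) * w2 w \<partial>N2)"
proof -
  define D1 D2 where "D1 = density N1 (\<lambda>x. ennreal (1 + w1 x))" and "D2 = density N2 (\<lambda>x. ennreal (1 + w2 x))"
  note f1 = signed_weight_density(1)[OF fin(1) assms(5) w1, folded D1_def]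
    and f2 = signed_weight_density(1)[OF fin(2) assms(6) w2, folded D2_def]
    and int1 = signed_weight_density(2)[OF fin(1) assms(5) w1, folded D1_def]
    and int2 = signed_weight_density(2)[OF fin(2) assms(6) w2, folded D2_def]
  have m1: "X1 \<in> borel_measurable D1" and m2: "X2 \<in> borel_measurable D2" by (simp_all add: D1_def D2_def)
  have "distr D1 borel X1 = distr D2 borel X2"
    by (rule distr_real_eqI_fourier[OF f1 f2 m1 m2]) (simp add: int1 int2 eq eqw)
  then have "(\<integral>x. indicator A x \<partial>distr D1 borel X1) = (\<integral>x. indicator A x \<partial>distr D2 borel X2 :: real)" by simp
  then have a: "(\<integral>x. indicator A (X1 x) \<partial>D1) = (\<integral>x. indicator A (X2 x) \<partial>D2 :: real)"
    by (subst (asm) (1 2) integral_distr) (use m1 m2 in auto)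
  have "distr N1 borel X1 = distr N2 borel X2"
    by (rule distr_real_eqI_fourier[OF fin]) (simp_all add: eq)
  then have "(\<integral>x. indicator A x \<partial>distr N1 borel X1) = (\<integral>x. indicator A x \<partial>distr N2 borel X2 :: real)" by simp
  then have b: "(\<integral>x. indicator A (X1 x) \<partial>N1) = (\<integral>x. indicator A (X2 x) \<partial>N2 :: real)"
    by (subst (asm) (1 2) integral_distr) auto
  show ?thesis using a b int1[of "\<lambda>x. indicator A (X1 x)"] int2[of "\<lambda>x. indicator A (X2 x)"] by simp
qed

text \<open>
  Induction on the number of coordinates: restricting both measures to the event that the last
  coordinate lies in a Borel set preserves the hypothesis for the other coordinates. That is the
  one-dimensional statement with the cosine of a combination of the others as weight, since the
  product of two cosines is a sum of two cosines. The phase \<open>\<phi>\<close> includes the sine.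
\<close>

lemma measure_coordinates_eqI_fourier:
  fixes X1 :: "nat \<Rightarrow> 'a \<Rightarrow> real" and X2 :: "nat \<Rightarrow> 'b \<Rightarrow> real"
  assumes "finite_measure N1" "finite_measure N2"
    and "\<And>i. X1 i \<in> borel_measurable N1" "\<And>i. X2 i \<in> borel_measurable N2"
    and "\<And>\<phi> c. (\<integral>w. cos (\<phi> + (\<Sum>i<n. c i * X1 i w)) \<partial>N1) = (\<integral>w. cos (\<phi> + (\<Sum>i<n. c i * X2 i w)) \<partial>N2)"
    and "\<And>i. A i \<in> sets borel"
  shows "measure N1 {w \<in> space N1. \<forall>i<n. X1 i w \<in> A i} = measure N2 {w \<in> space N2. \<forall>i<n. X2 i w \<in> A i}"
  using assms
proof (induction n arbitrary: N1 N2)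
  case 0
  from this(5)[of 0] show ?case by simp
next
  case (Suc n)
  note [measurable] = Suc.prems(3,4,6)
  interpret N1: finite_measure N1 by fact
  interpret N2: finite_measure N2 by fact
  have I1[simp]: "integrable N1 f" if [measurable]: "f \<in> borel_measurable N1" and "\<And>x. \<bar>f x\<bar> \<le> 1" for f :: "_ \<Rightarrow> real"
    by (rule N1.integrable_const_bound[where B = 1]) (use that in auto)
  have I2[simp]: "integrable N2 f" if [measurable]: "f \<in> borel_measurable N2" and "\<And>x. \<bar>f x\<bar> \<le> 1" for f :: "_ \<Rightarrow> real"
    by (rule N2.integrable_const_bound[where B = 1]) (use that in auto)
  have upd: "(\<Sum>i<Suc n. (c(n := \<theta>)) i * X i) = (\<Sum>i<n. c i * X i) + \<theta> * X n" for c :: "nat \<Rightarrow> real" and \<theta> :: real and X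
  proof -
    have "(\<Sum>i<n. (c(n := \<theta>)) i * X i) = (\<Sum>i<n. c i * X i)" by (rule sum.cong) auto
    then show ?thesis by simp
  qed
  note C = Suc.prems(5)[of \<phi> "c(n := \<theta>)" for \<phi> c \<theta>, unfolded upd]
  have C': "(\<integral>w. cos (\<phi> + ((\<Sum>i<n. c i * X1 i w) - \<theta> * X1 n w)) \<partial>N1)
      = (\<integral>w. cos (\<phi> + ((\<Sum>i<n. c i * X2 i w) - \<theta> * X2 n w)) \<partial>N2)" for \<phi> c \<theta>
    using C[of \<phi> c "- \<theta>"] by simp
  have trig: "cos (\<psi> + a) * cos (\<phi> + b) = (cos ((\<phi> + \<psi>) + (b + a)) + cos ((\<phi> - \<psi>) + (b - a))) / 2" for a b \<phi> \<psi> :: real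
    by (subst mult.commute, subst cos_times_cos) (simp add: algebra_simps)
  have c0: "(\<integral>w. cos (\<phi> + \<theta> * X1 n w) \<partial>N1) = (\<integral>w. cos (\<phi> + \<theta> * X2 n w) \<partial>N2)" for \<phi> \<theta>
    using C[of \<phi> "\<lambda>_. 0" \<theta>] by simp
  define D1 where "D1 = density N1 (\<lambda>x. indicator (A n) (X1 n x))"
  define D2 where "D2 = density N2 (\<lambda>x. indicator (A n) (X2 n x))"
  have w: "(\<integral>w. indicator (A n) (X1 n w) * cos (\<phi> + (\<Sum>i<n. c i * X1 i w)) \<partial>N1)
      = (\<integral>w. indicator (A n) (X2 n w) * cos (\<phi> + (\<Sum>i<n. c i * X2 i w)) \<partial>N2)" for \<phi> c
    by (rule weighted_integral_eqI_fourier[OF Suc.prems(1,2)]) (simp_all add: trig c0 C C')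
  have "emeasure D1 (space D1) \<le> emeasure N1 (space N1)"
    unfolding D1_def by (subst emeasure_density)
      (auto simp flip: nn_integral_indicator intro!: nn_integral_mono split: split_indicator)
  moreover have "emeasure D2 (space D2) \<le> emeasure N2 (space N2)"
    unfolding D2_def by (subst emeasure_density)
      (auto simp flip: nn_integral_indicator intro!: nn_integral_mono split: split_indicator)
  ultimately have fin: "finite_measure D1" "finite_measure D2"
    using N1.finite_emeasure_space N2.finite_emeasure_space
    by (auto intro!: finite_measureI simp: top_unique)
  have "measure D1 {w \<in> space D1. \<forall>i<n. X1 i w \<in> A i} = measure D2 {w \<in> space D2. \<forall>i<n. X2 i w \<in> A i}"
  proof (rule Suc.IH[OF fin])
    show "(\<integral>w. cos (\<phi> + (\<Sum>i<n. c i * X1 i w)) \<partial>D1) = (\<integral>w. cos (\<phi> + (\<Sum>i<n. c i * X2 i w)) \<partial>D2)" for \<phi> c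
      using w[of \<phi> c] unfolding D1_def D2_def by (simp add: integral_density ennreal_indicator[symmetric])
  qed (auto simp: D1_def D2_def)
  moreover have "measure D1 {w \<in> space D1. \<forall>i<n. X1 i w \<in> A i} = measure N1 {w \<in> space N1. \<forall>i<Suc n. X1 i w \<in> A i}"
    unfolding D1_def measure_def
    by (subst emeasure_density)
       (auto simp: less_Suc_eq simp flip: nn_integral_indicator intro!: arg_cong[where f = enn2real] nn_integral_cong split: split_indicator)
  moreover have "measure D2 {w \<in> space D2. \<forall>i<n. X2 i w \<in> A i} = measure N2 {w \<in> space N2. \<forall>i<Suc n. X2 i w \<in> A i}"
    unfolding D2_def measure_def
    by (subst emeasure_density)
       (auto simp: less_Suc_eq simp flip: nn_integral_indicator intro!: arg_cong[where f = enn2real] nn_integral_cong split: split_indicator)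
  ultimately show ?case by simp
qed

text \<open>
  The underlying spaces may differ. This allows the comparison of a Gaussian sequence with a
  sequence built from it on a larger product space.
\<close>

lemma distr_sequence_eqI_fourier:
  fixes X1 :: "nat \<Rightarrow> 'a \<Rightarrow> real" and X2 :: "nat \<Rightarrow> 'b \<Rightarrow> real"
  assumes fin: "finite_measure N1" "finite_measure N2"
    and [measurable]: "\<And>i. X1 i \<in> borel_measurable N1" "\<And>i. X2 i \<in> borel_measurable N2"
    and eq: "\<And>\<phi> n c. (\<integral>w. cos (\<phi> + (\<Sum>i<n. c i * X1 i w)) \<partial>N1) = (\<integral>w. cos (\<phi> + (\<Sum>i<n. c i * X2 i w)) \<partial>N2)"
  shows "distr N1 borel (\<lambda>w i. X1 i w) = distr N2 borel (\<lambda>w i. X2 i w)"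
proof -
  interpret N1: finite_measure N1 by fact
  interpret N2: finite_measure N2 by fact
  have [measurable]: "(\<lambda>w i. X1 i w) \<in> borel_measurable N1" "(\<lambda>w i. X2 i w) \<in> borel_measurable N2"
    by (auto intro!: measurable_coordinatewise_then_product)
  show ?thesis
  proof (rule measure_eqI_PiM_infinite[where I = UNIV and M = "\<lambda>_. borel"])
    show "finite_measure (distr N1 borel (\<lambda>w i. X1 i w))" by (rule N1.finite_measure_distr) simp
    fix A and J :: "nat set"
    assume J: "finite J" "J \<subseteq> UNIV" and A: "\<And>i. i \<in> J \<Longrightarrow> A i \<in> sets (borel :: real measure)"
    obtain n where n: "J \<subseteq> {..<n}" using J(1) finite_nat_iff_bounded by blast
    define A' where "A' i = (if i \<in> J then A i else UNIV)" for i
    have [measurable]: "A' i \<in> sets borel" for i using A by (simp add: A'_def)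
    have emb: "prod_emb UNIV (\<lambda>_. borel) J (Pi\<^sub>E J A) = {x. \<forall>i<n. x i \<in> A' i}"
      using n by (auto simp: prod_emb_def A'_def PiE_def Pi_def restrict_def extensional_def)
    have [measurable]: "{x. \<forall>i<n. x i \<in> A' i} \<in> sets (borel :: (nat \<Rightarrow> real) measure)"
    proof -
      have "{x \<in> space (Pi\<^sub>M UNIV (\<lambda>_. borel)). \<forall>i<n. x i \<in> A' i} \<in> sets (Pi\<^sub>M UNIV (\<lambda>_::nat. borel :: real measure))"
        by measurable
      then show ?thesis by (simp add: space_PiM sets_PiM_equal_borel)
    qed
    have "measure N1 {w \<in> space N1. \<forall>i<n. X1 i w \<in> A' i} = measure N2 {w \<in> space N2. \<forall>i<n. X2 i w \<in> A' i}"
      by (rule measure_coordinates_eqI_fourier[OF fin _ _ eq]) auto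
    then show "emeasure (distr N1 borel (\<lambda>w i. X1 i w)) (prod_emb UNIV (\<lambda>_. borel) J (Pi\<^sub>E J A)) =
      emeasure (distr N2 borel (\<lambda>w i. X2 i w)) (prod_emb UNIV (\<lambda>_. borel) J (Pi\<^sub>E J A))"
      unfolding emb by (simp add: emeasure_distr N1.emeasure_eq_measure N2.emeasure_eq_measure vimage_def Int_def conj_commute)
  qed (auto simp: sets_PiM_equal_borel)
qed

section \<open>Isonormal processes\<close>

lemma abs_mult_le_squares: "\<bar>a * b\<bar> \<le> a\<^sup>2 + b\<^sup>2" for a b :: real
proof -
  have "2 * (\<bar>a\<bar> * \<bar>b\<bar>) \<le> a\<^sup>2 + b\<^sup>2" using sum_squares_bound[of "\<bar>a\<bar>" "\<bar>b\<bar>"] by simp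
  moreover have "0 \<le> \<bar>a\<bar> * \<bar>b\<bar>" by simp
  ultimately show ?thesis unfolding abs_mult by linarith
qed

lemma integrable_mult_square_integrable:
  fixes f g :: "'a \<Rightarrow> real"
  assumes [measurable]: "f \<in> borel_measurable M" "g \<in> borel_measurable M"
    and "integrable M (\<lambda>x. (f x)\<^sup>2)" "integrable M (\<lambda>x. (g x)\<^sup>2)"
  shows "integrable M (\<lambda>x. f x * g x)"
proof (rule Bochner_Integration.integrable_bound)
  show "integrable M (\<lambda>x. (f x)\<^sup>2 + (g x)\<^sup>2)" using assms by simp
  show "AE x in M. norm (f x * g x) \<le> norm ((f x)\<^sup>2 + (g x)\<^sup>2)" by (simp add: abs_mult_le_squares)
qed simp

lemma integral_std_normal_cos:
  "(\<integral>x. cos (\<phi> + t * x) \<partial>std_normal_distribution) = cos \<phi> * exp (- t\<^sup>2 / 2)"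
proof -
  let ?S = std_normal_distribution
  interpret real_distribution std_normal_distribution by (rule real_dist_normal_dist)
  have i: "integrable ?S (\<lambda>x. iexp (t * x))"
    by (rule integrable_const_bound[where B = 1]) auto
  have b: "integrable ?S (\<lambda>x. cos (t * x))" "integrable ?S (\<lambda>x. sin (t * x))"
    by (rule integrable_const_bound[where B = 1], auto)+
  have "(\<integral>x. iexp (t * x) \<partial>?S) = complex_of_real (exp (- t\<^sup>2 / 2))"
    using char_std_normal_distribution unfolding char_def by (metis (no_types, lifting))
  then have "(\<integral>x. cos (t * x) \<partial>?S) = exp (- t\<^sup>2 / 2)"
    "(\<integral>x. sin (t * x) \<partial>?S) = 0"
    using integral_Re[OF i] integral_Im[OF i] by (simp_all add: Re_exp Im_exp)
  then show ?thesis using b by (simp add: cos_add)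
qed

lemma centered_gaussian_cases:
  assumes "prob_space M" "centered_gaussian M Z"
  obtains (zero) "AE w in M. Z w = 0"
    | (normal) \<sigma> where "\<sigma> > 0" "distr M borel (\<lambda>w. Z w / \<sigma>) = std_normal_distribution"
proof -
  interpret prob_space M by fact
  consider "AE w in M. Z w = 0" | \<sigma> where "\<sigma> > 0" "distributed M lborel Z (\<lambda>x. ennreal (normal_density 0 \<sigma> x))"
    using assms(2) unfolding centered_gaussian_def by blast
  then show ?thesis
  proof cases
    case 1 then show ?thesis by (rule zero)
  next
    case (2 \<sigma>)
    have "distributed M lborel (\<lambda>w. (Z w - 0) / \<sigma>) (\<lambda>x. ennreal (std_normal_density x))"
      using normal_standard_normal_convert[OF 2(1), of Z 0] 2(2) by blast
    then have "distr M lborel (\<lambda>w. Z w / \<sigma>) = std_normal_distribution"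
      by (simp add: distributed_def)
    moreover have "distr M lborel (\<lambda>w. Z w / \<sigma>) = distr M borel (\<lambda>w. Z w / \<sigma>)"
      by (rule distr_cong) auto
    ultimately show ?thesis using normal[OF 2(1)] by simp
  qed
qed

lemma centered_gaussian_square_integrable:
  assumes "prob_space M" "centered_gaussian M Z"
  shows "integrable M (\<lambda>w. (Z w)\<^sup>2)"
proof -
  have [measurable]: "Z \<in> borel_measurable M" using assms(2) by (simp add: centered_gaussian_def)
  show ?thesis using assms
  proof (cases rule: centered_gaussian_cases)
    case zero
    then have "AE w in M. (Z w)\<^sup>2 = 0" by auto
    then show ?thesis by (subst integrable_cong_AE[where g = "\<lambda>_. 0"]) auto
  next
    case (normal \<sigma>)
    have "integrable (distr M borel (\<lambda>w. Z w / \<sigma>)) (\<lambda>x. x\<^sup>2)"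
      unfolding normal(2) by (rule integrable_std_normal_distribution_moment)
    then have "integrable M (\<lambda>w. (Z w / \<sigma>)\<^sup>2)" by (subst (asm) integrable_distr_eq) auto
    then have "integrable M (\<lambda>w. \<sigma>\<^sup>2 * (Z w / \<sigma>)\<^sup>2)" by simp
    then show ?thesis using normal(1) by (simp add: power_divide)
  qed
qed

lemma centered_gaussian_fourier:
  assumes "prob_space M" "centered_gaussian M Z"
  shows "(\<integral>w. cos (\<phi> + Z w) \<partial>M) = cos \<phi> * exp (- (\<integral>w. (Z w)\<^sup>2 \<partial>M) / 2)"
proof -
  let ?S = std_normal_distribution
  interpret prob_space M by fact
  have [measurable]: "Z \<in> borel_measurable M" using assms(2) by (simp add: centered_gaussian_def)
  show ?thesis using assms
  proof (cases rule: centered_gaussian_cases)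
    case zero
    have "(\<integral>w. cos (\<phi> + Z w) \<partial>M) = (\<integral>w. cos \<phi> \<partial>M)" using zero by (intro integral_cong_AE) auto
    moreover have "(\<integral>w. (Z w)\<^sup>2 \<partial>M) = (\<integral>w. 0 \<partial>M)" using zero by (intro integral_cong_AE) auto
    ultimately show ?thesis by (simp add: prob_space)
  next
    case (normal \<sigma>)
    have tr: "(\<integral>w. f (Z w) \<partial>M) = (\<integral>x. f (\<sigma> * x) \<partial>?S)"
      if "f \<in> borel_measurable borel" for f :: "real \<Rightarrow> real"
      unfolding normal(2)[symmetric] using normal(1) that by (subst integral_distr) auto
    have "(\<integral>w. (Z w)\<^sup>2 \<partial>M) = (\<integral>x. (\<sigma> * x)\<^sup>2 \<partial>?S)" by (rule tr) simp
    also have "\<dots> = \<sigma>\<^sup>2 * (\<integral>x. x\<^sup>2 \<partial>?S)" by (simp add: power_mult_distrib)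
    also have "(\<integral>x. x\<^sup>2 \<partial>?S) = 1"
      using std_normal_distribution_even_moments(1)[of 1] by (simp add: fact_numeral)
    finally show ?thesis using tr[of "\<lambda>x. cos (\<phi> + x)"] by (simp add: integral_std_normal_cos)
  qed
qed

locale isonormal_process = prob_space P for P :: "'a measure" +
  fixes Y :: "'h::real_inner \<Rightarrow> 'a \<Rightarrow> real"
  assumes iso: "isonormal P Y"
begin

lemma gaussian: "centered_gaussian P (Y g)"
proof -
  have "centered_gaussian_family P UNIV Y" using iso by (simp add: isonormal_def)
  from this[unfolded centered_gaussian_family_def, rule_format, of "{g}" "\<lambda>_. 1"]
  show ?thesis by simp
qed

lemma measurable_Y[measurable]: "Y g \<in> borel_measurable P"
  using gaussian by (simp add: centered_gaussian_def)

lemma integrable_Y_square[simp]: "integrable P (\<lambda>w. (Y g w)\<^sup>2)"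
  by (rule centered_gaussian_square_integrable[OF prob_space_axioms gaussian])

lemma integrable_Y_mult[simp]: "integrable P (\<lambda>w. Y g w * Y h w)"
  by (rule integrable_mult_square_integrable) auto

lemma expectation_Y_mult: "(\<integral>w. Y g w * Y h w \<partial>P) = inner g h"
  using iso by (simp add: isonormal_def)

lemma expectation_Y_square: "(\<integral>w. (Y g w)\<^sup>2 \<partial>P) = (norm g)\<^sup>2"
  using expectation_Y_mult[of g g] by (simp add: power2_eq_square dot_square_norm[unfolded power2_eq_square])

lemma expectation_cos: "(\<integral>w. cos (\<phi> + Y g w) \<partial>P) = cos \<phi> * exp (- (norm g)\<^sup>2 / 2)"
  using centered_gaussian_fourier[OF prob_space_axioms gaussian[of g]] by (simp add: expectation_Y_square)

text \<open>
  Linearity is not part of the definition. It follows from the covariance, since the second moment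
  of the difference vanishes.
\<close>

lemma Y_add_scaleR: "AE w in P. Y (a + c *\<^sub>R b) w = Y a w + c * Y b w"
proof -
  let ?U = "Y (a + c *\<^sub>R b)"
  have sq: "(?U w - (Y a w + c * Y b w))\<^sup>2
     = ?U w * ?U w + Y a w * Y a w + c\<^sup>2 * (Y b w * Y b w) - 2 * (?U w * Y a w)
       - 2 * c * (?U w * Y b w) + 2 * c * (Y a w * Y b w)" for w
    by (simp add: power2_eq_square algebra_simps)
  have i: "integrable P (\<lambda>w. (?U w - (Y a w + c * Y b w))\<^sup>2)" unfolding sq by simp
  have "(\<integral>w. (?U w - (Y a w + c * Y b w))\<^sup>2 \<partial>P) = 0"
    unfolding sq by (simp add: expectation_Y_mult inner_add_left inner_add_right inner_commute algebra_simps power2_eq_square)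
  then have "AE w in P. (?U w - (Y a w + c * Y b w))\<^sup>2 = 0"
    using integral_nonneg_eq_0_iff_AE[OF i] by simp
  then show ?thesis by eventually_elim simp
qed

lemma Y_zero: "AE w in P. Y 0 w = 0"
  using Y_add_scaleR[of 0 "-1" 0] Y_add_scaleR[of 0 0 0] by eventually_elim auto

lemma Y_sum:
  assumes "finite I"
  shows "AE w in P. (\<Sum>i\<in>I. c i * Y (g i) w) = Y (\<Sum>i\<in>I. c i *\<^sub>R g i) w"
  using assms
proof (induction I)
  case empty
  then show ?case using Y_zero by auto
next
  case (insert j I)
  from insert(3) Y_add_scaleR[of "\<Sum>i\<in>I. c i *\<^sub>R g i" "c j" "g j"] show ?case
    by eventually_elim (simp add: insert(1,2) algebra_simps)
qed

lemma measurable_sequence[measurable]: "(\<lambda>w i. Y (g i) w) \<in> borel_measurable P" for g :: "nat \<Rightarrow> 'h"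
  by (rule measurable_coordinatewise_then_product) simp

text \<open>
  The part of the sequence along \<open>e\<close> with \<open>Y e\<close> replaced by a real variable \<open>y\<close>, which will be an independent
  standard normal variable.
\<close>

definition split_along :: "'h \<Rightarrow> (nat \<Rightarrow> 'h) \<Rightarrow> real \<times> 'a \<Rightarrow> nat \<Rightarrow> real" where
  "split_along e g = (\<lambda>(y, w) i. inner (g i) e * y + (Y (g i) w - inner (g i) e * Y e w))"

lemma measurable_split_along[measurable]:
  "split_along e g \<in> borel_measurable (std_normal_distribution \<Otimes>\<^sub>M P)"
  by (rule measurable_coordinatewise_then_product) (simp add: split_along_def split_beta)

text \<open>
  The component of a Gaussian sequence along a unit vector may be replaced by an independent
  standard normal variable. Both sides have the same Fourier transform: with \<open>x = \<Sum>\<^sub>i c\<^sub>i g\<^sub>i\<close> and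
  \<open>\<alpha> = \<langle>x, e\<rangle>\<close>, the exponent satisfies \<open>\<parallel>x\<parallel>\<^sup>2 = \<alpha>\<^sup>2 + \<parallel>x - \<alpha> e\<parallel>\<^sup>2\<close>.
\<close>

lemma distr_split_unit:
  assumes e: "norm e = 1"
  shows "distr P borel (\<lambda>w i. Y (g i) w) = distr (std_normal_distribution \<Otimes>\<^sub>M P) borel (split_along e g)"
proof -
  let ?S = std_normal_distribution and ?SP = "std_normal_distribution \<Otimes>\<^sub>M P"
  interpret S: real_distribution std_normal_distribution by (rule real_dist_normal_dist)
  interpret SP: pair_prob_space std_normal_distribution P ..
  have fin1: "finite_measure P" and fin2: "finite_measure ?SP" by unfold_locales
  define V where "V i p = split_along e g p i" for i and p :: "real \<times> 'a"
  have Vm[measurable]: "V i \<in> borel_measurable ?SP" for i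
    unfolding V_def split_along_def split_beta by measurable
  have main: "(\<integral>w. cos (\<phi> + (\<Sum>i<n. c i * Y (g i) w)) \<partial>P)
      = (\<integral>p. cos (\<phi> + (\<Sum>i<n. c i * V i p)) \<partial>?SP)" for \<phi> n c
  proof -
    define x where "x = (\<Sum>i<n. c i *\<^sub>R g i)"
    define \<alpha> where "\<alpha> = inner x e"
    define R where "R w = (\<Sum>i<n. c i * Y (g i) w) - \<alpha> * Y e w" for w
    have [measurable]: "R \<in> borel_measurable P" unfolding R_def by measurable
    have al: "\<alpha> = (\<Sum>i<n. c i * inner (g i) e)" by (simp add: \<alpha>_def x_def inner_sum_left)
    have eq: "(\<Sum>i<n. c i * V i p) = \<alpha> * fst p + R (snd p)" for p
      by (simp add: V_def split_along_def split_beta R_def al sum_distrib_left sum_distrib_right sum.distrib sum_subtractf algebra_simps)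
    have lin: "AE w in P. (\<Sum>i<n. c i * Y (g i) w) = Y x w" unfolding x_def by (rule Y_sum) simp
    have R: "AE w in P. R w = Y (x + (-\<alpha>) *\<^sub>R e) w"
      using lin Y_add_scaleR[of x "-\<alpha>" e] by eventually_elim (simp add: R_def)
    have cR: "(\<integral>w. cos (\<beta> + R w) \<partial>P) = cos \<beta> * exp (- (norm (x - \<alpha> *\<^sub>R e))\<^sup>2 / 2)" for \<beta>
      using R expectation_cos[of \<beta> "x - \<alpha> *\<^sub>R e"]
      by (subst integral_cong_AE[where g = "\<lambda>w. cos (\<beta> + Y (x + (-\<alpha>) *\<^sub>R e) w)"]) auto
    have nrm: "(norm x)\<^sup>2 = \<alpha>\<^sup>2 + (norm (x - \<alpha> *\<^sub>R e))\<^sup>2"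
      using e unfolding power2_norm_eq_inner norm_eq_1
      by (simp add: \<alpha>_def inner_diff_left inner_diff_right inner_commute power2_eq_square)
    have i: "integrable ?SP (\<lambda>p. cos ((\<phi> + \<alpha> * fst p) + R (snd p)))"
      by (rule SP.P.integrable_const_bound[where B = 1]) auto
    have "(\<integral>p. cos (\<phi> + (\<Sum>i<n. c i * V i p)) \<partial>?SP)
        = (\<integral>y. (\<integral>w. cos ((\<phi> + \<alpha> * y) + R w) \<partial>P) \<partial>?S)"
      using SP.integral_fst'[OF i] by (simp add: eq add.assoc)
    also have "\<dots> = cos \<phi> * exp (- (norm x)\<^sup>2 / 2)"
      by (simp add: cR integral_std_normal_cos nrm diff_divide_distrib flip: exp_add)
    also have "\<dots> = (\<integral>w. cos (\<phi> + Y x w) \<partial>P)" by (simp add: expectation_cos)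
    also have "\<dots> = (\<integral>w. cos (\<phi> + (\<Sum>i<n. c i * Y (g i) w)) \<partial>P)" using lin by (intro integral_cong_AE) auto
    finally show ?thesis ..
  qed
  show ?thesis
    using distr_sequence_eqI_fourier[OF fin1 fin2 measurable_Y Vm main]
    by (simp add: V_def[abs_def])
qed

end

section \<open>Exponential change of measure\<close>

lemma centered_gaussian_distr_eq:
  assumes "distr Q borel U = distr P borel V" and [measurable]: "U \<in> borel_measurable Q" "V \<in> borel_measurable P"
    and "centered_gaussian P V"
  shows "centered_gaussian Q U"
proof -
  have lb: "distr N lborel Z = distr N borel Z" for N :: "'z measure" and Z :: "'z \<Rightarrow> real"
    by (rule distr_cong) auto
  from assms(4) consider "AE w in P. V w = 0"
    | \<sigma> where "\<sigma> > 0" "distributed P lborel V (\<lambda>x. ennreal (normal_density 0 \<sigma> x))"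
    unfolding centered_gaussian_def by blast
  then show ?thesis
  proof cases
    case 1
    have "AE x in distr P borel V. x = 0" using 1 by (subst AE_distr_iff) auto
    then have "AE x in distr Q borel U. x = 0" unfolding assms(1)[symmetric] .
    then have "AE w in Q. U w = 0" by (subst (asm) AE_distr_iff) auto
    then show ?thesis by (simp add: centered_gaussian_def)
  next
    case (2 \<sigma>)
    then have "distributed Q lborel U (\<lambda>x. ennreal (normal_density 0 \<sigma> x))"
      using assms(1) unfolding distributed_def lb by simp
    then show ?thesis using 2(1) by (auto simp: centered_gaussian_def)
  qed
qed

text \<open>The Cameron-Martin formula in one dimension.\<close>

lemma nn_integral_std_normal_shift:
  fixes f :: "real \<Rightarrow> ennreal"
  assumes [measurable]: "f \<in> borel_measurable borel"
  shows "(\<integral>\<^sup>+y. ennreal (exp (r * y - r\<^sup>2 / 2)) * f (y - r) \<partial>std_normal_distribution)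
    = (\<integral>\<^sup>+y. f y \<partial>std_normal_distribution)"
proof -
  have d: "std_normal_density y * exp (r * y - r\<^sup>2 / 2) = std_normal_density (y - r)" for y
    unfolding std_normal_density_def
    by (simp add: flip: exp_add) (simp add: power2_eq_square field_simps)
  have "(\<integral>\<^sup>+y. ennreal (exp (r * y - r\<^sup>2 / 2)) * f (y - r) \<partial>std_normal_distribution)
     = (\<integral>\<^sup>+y. ennreal (std_normal_density (y - r)) * f (y - r) \<partial>lborel)"
    by (subst nn_integral_density) (auto simp flip: mult.assoc ennreal_mult d)
  also have "\<dots> = (\<integral>\<^sup>+y. ennreal (std_normal_density y) * f y \<partial>lborel)"
    using nn_integral_real_affine[of "\<lambda>y. ennreal (std_normal_density y) * f y" 1 "-r"] by simp
  also have "\<dots> = (\<integral>\<^sup>+y. f y \<partial>std_normal_distribution)" by (subst nn_integral_density) auto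
  finally show ?thesis .
qed

context isonormal_process
begin

text \<open>
  After splitting along \<open>v / \<parallel>v\<parallel>\<close> the density depends only on the standard normal component, where
  it acts as a shift by \<open>\<parallel>v\<parallel>\<close>. On \<open>Y g\<close> this shift is exactly \<open>\<langle>g, v\<rangle>\<close>.
\<close>

lemma distr_tilted:
  defines "Q v \<equiv> density P (\<lambda>w. ennreal (exp (Y v w - (1/2) * (norm v)\<^sup>2)))"
  shows "distr (Q v) borel (\<lambda>w. Y g w - inner g v) = distr P borel (Y g)"
proof (cases "v = 0")
  case True
  have "Q 0 = density P (\<lambda>w. ennreal 1)"
    unfolding Q_def by (rule density_cong) (use Y_zero in auto)
  then have "Q 0 = P" by (simp add: density_1)
  then show ?thesis using True by simp
next
  case False
  let ?S = std_normal_distribution and ?SP = "std_normal_distribution \<Otimes>\<^sub>M P"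
  define r where "r = norm v"
  define e where "e = (1 / r) *\<^sub>R v"
  define \<alpha> where "\<alpha> = inner g e"
  have r: "r > 0" using False by (simp add: r_def)
  have e1: "norm e = 1" using r by (simp add: e_def r_def)
  have v: "v = 0 + r *\<^sub>R e" using r by (simp add: e_def)
  have gv: "inner g v = \<alpha> * r" by (subst v) (simp add: \<alpha>_def)
  have Yv: "AE w in P. Y v w = r * Y e w"
    using Y_add_scaleR[of 0 r e] Y_zero unfolding v[symmetric] by eventually_elim simp
  define gs :: "nat \<Rightarrow> 'h" where "gs i = (if i = 0 then e else g)" for i
  interpret S: real_distribution std_normal_distribution by (rule real_dist_normal_dist)
  interpret SP: pair_prob_space std_normal_distribution P ..
  have split: "(\<integral>\<^sup>+w. \<Psi> (\<lambda>i. Y (gs i) w) \<partial>P) = (\<integral>\<^sup>+w. \<integral>\<^sup>+y. \<Psi> (split_along e gs (y, w)) \<partial>?S \<partial>P)"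
    if [measurable]: "\<Psi> \<in> borel_measurable borel" for \<Psi> :: "(nat \<Rightarrow> real) \<Rightarrow> ennreal"
  proof -
    have "(\<integral>\<^sup>+w. \<Psi> (\<lambda>i. Y (gs i) w) \<partial>P) = (\<integral>\<^sup>+x. \<Psi> x \<partial>distr P borel (\<lambda>w i. Y (gs i) w))"
      by (subst nn_integral_distr) auto
    also have "\<dots> = (\<integral>\<^sup>+p. \<Psi> (split_along e gs p) \<partial>?SP)"
      unfolding distr_split_unit[OF e1] by (subst nn_integral_distr) auto
    also have "\<dots> = (\<integral>\<^sup>+w. \<integral>\<^sup>+y. \<Psi> (split_along e gs (y, w)) \<partial>?S \<partial>P)"
      by (subst SP.nn_integral_snd[symmetric]) auto
    finally show ?thesis .
  qed
  have [measurable]: "(\<lambda>x::nat \<Rightarrow> real. x i) \<in> borel_measurable borel" for i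
    by (intro borel_measurable_continuous_onI continuous_on_product_coordinates)
  show ?thesis
  proof (rule measure_eqI)
    fix A assume "A \<in> sets (distr (Q v) borel (\<lambda>w. Y g w - inner g v))"
    then have [measurable]: "A \<in> sets borel" by simp
    have ee: "inner e e = 1" using e1 by (simp add: norm_eq_1)
    have "emeasure (distr (Q v) borel (\<lambda>w. Y g w - inner g v)) A
      = (\<integral>\<^sup>+w. indicator A (Y g w - inner g v) \<partial>Q v)"
      by (subst nn_integral_indicator[symmetric])
         (auto simp: Q_def nn_integral_distr simp del: nn_integral_indicator)
    also have "\<dots> = (\<integral>\<^sup>+w. ennreal (exp (Y v w - (1/2) * (norm v)\<^sup>2)) * indicator A (Y g w - inner g v) \<partial>P)"
      unfolding Q_def by (subst nn_integral_density) auto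
    also have "\<dots> = (\<integral>\<^sup>+w. ennreal (exp (r * Y e w - r\<^sup>2 / 2)) * indicator A (Y g w - \<alpha> * r) \<partial>P)"
      using Yv by (intro nn_integral_cong_AE) (auto simp: r_def gv)
    also have "\<dots> = (\<integral>\<^sup>+w. \<integral>\<^sup>+y. ennreal (exp (r * y - r\<^sup>2 / 2)) * indicator A (\<alpha> * y + (Y g w - \<alpha> * Y e w) - \<alpha> * r) \<partial>?S \<partial>P)"
      using split[of "\<lambda>x. ennreal (exp (r * x 0 - r\<^sup>2 / 2)) * indicator A (x 1 - \<alpha> * r)"]
      by (simp add: split_along_def gs_def ee \<alpha>_def)
    also have "\<dots> = (\<integral>\<^sup>+w. \<integral>\<^sup>+y. ennreal (exp (r * y - r\<^sup>2 / 2)) * indicator A (\<alpha> * (y - r) + (Y g w - \<alpha> * Y e w)) \<partial>?S \<partial>P)"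
      by (simp add: algebra_simps)
    also have "\<dots> = (\<integral>\<^sup>+w. \<integral>\<^sup>+y. indicator A (\<alpha> * y + (Y g w - \<alpha> * Y e w)) \<partial>?S \<partial>P)"
      by (subst nn_integral_std_normal_shift[where f = "\<lambda>y. indicator A (\<alpha> * y + (Y g w - \<alpha> * Y e w))" for w]) simp_all
    also have "\<dots> = (\<integral>\<^sup>+w. indicator A (Y g w) \<partial>P)"
      using split[of "\<lambda>x. indicator A (x 1)"] by (simp add: split_along_def gs_def \<alpha>_def)
    also have "\<dots> = emeasure (distr P borel (Y g)) A"
      by (subst nn_integral_indicator[symmetric])
         (auto simp: nn_integral_distr simp del: nn_integral_indicator)
    finally show "emeasure (distr (Q v) borel (\<lambda>w. Y g w - inner g v)) A = emeasure (distr P borel (Y g)) A" .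
  qed simp
qed

text \<open>
  Linear combinations reduce to a single vector, so the one-dimensional laws determine that the
  family is Gaussian, and covariances follow from variances by polarization.
\<close>

lemma isonormal_tilted:
  "isonormal_process (density P (\<lambda>w. ennreal (exp (Y v w - (1/2) * (norm v)\<^sup>2)))) (\<lambda>g w. Y g w - inner g v)"
proof -
  define Q where "Q = density P (\<lambda>w. ennreal (exp (Y v w - (1/2) * (norm v)\<^sup>2)))"
  define Z where "Z g w = Y g w - inner g v" for g w
  have law: "distr Q borel (Z g) = distr P borel (Y g)" for g
    using distr_tilted[of v g] by (simp add: Q_def Z_def[abs_def])
  have [measurable]: "Z g \<in> borel_measurable P" "Z g \<in> borel_measurable Q" for g
    by (simp_all add: Z_def[abs_def] Q_def)
  have AEQ: "AE w in Q. R w" if "AE w in P. R w" for R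
    unfolding Q_def by (subst AE_density) (use that in auto)
  have pQ: "prob_space Q"
  proof (rule prob_spaceI)
    have "emeasure (distr Q borel (Z 0)) UNIV = emeasure (distr P borel (Y 0)) UNIV" by (simp only: law)
    then show "emeasure Q (space Q) = 1" by (simp add: emeasure_distr emeasure_space_1)
  qed
  have Zsum: "AE w in Q. (\<Sum>i\<in>I. c i * Z (f i) w) = Z (\<Sum>i\<in>I. c i *\<^sub>R f i) w" if "finite I" for c f and I :: "'b set"
    by (rule AEQ) (use Y_sum[OF that, of c f] in \<open>eventually_elim, auto simp: Z_def algebra_simps sum_subtractf inner_sum_left\<close>)
  have g: "centered_gaussian_family Q UNIV Z"
    unfolding centered_gaussian_family_def
  proof (intro allI impI)
    fix J :: "'h set" and c assume "finite J \<and> J \<subseteq> UNIV"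
    then have AE: "AE w in Q. (\<Sum>i\<in>J. c i * Z i w) = Z (\<Sum>i\<in>J. c i *\<^sub>R i) w" using Zsum[of J c "\<lambda>x. x"] by simp
    have "distr Q borel (\<lambda>w. \<Sum>i\<in>J. c i * Z i w) = distr Q borel (Z (\<Sum>i\<in>J. c i *\<^sub>R i))"
      by (rule distr_cong_AE) (use AE in auto)
    then show "centered_gaussian Q (\<lambda>w. \<Sum>i\<in>J. c i * Z i w)"
      unfolding law by (rule centered_gaussian_distr_eq) (auto intro: gaussian)
  qed
  have sq: "integrable Q (\<lambda>w. (Z g w)\<^sup>2)" "(\<integral>w. (Z g w)\<^sup>2 \<partial>Q) = (norm g)\<^sup>2" for g
  proof -
    have "integrable (distr P borel (Y g)) (\<lambda>x. x\<^sup>2)" by (subst integrable_distr_eq) auto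
    then show "integrable Q (\<lambda>w. (Z g w)\<^sup>2)" unfolding law[symmetric] by (subst (asm) integrable_distr_eq) auto
    have "(\<integral>x. x\<^sup>2 \<partial>distr P borel (Y g)) = (norm g)\<^sup>2" by (subst integral_distr) (auto simp: expectation_Y_square)
    then show "(\<integral>w. (Z g w)\<^sup>2 \<partial>Q) = (norm g)\<^sup>2" unfolding law[symmetric] by (subst (asm) integral_distr) auto
  qed
  have "(\<integral>w. Z h w * Z g w \<partial>Q) = inner h g" for h g
  proof -
    have "AE w in Q. Z h w + Z g w = Z (h + g) w"
      by (rule AEQ) (use Y_add_scaleR[of h 1 g] in \<open>auto simp: Z_def algebra_simps\<close>)
    then have "AE w in Q. Z h w * Z g w = ((Z (h + g) w)\<^sup>2 - (Z h w)\<^sup>2 - (Z g w)\<^sup>2) / 2"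
    proof eventually_elim
      case (elim w)
      show ?case unfolding elim[symmetric] by (simp add: power2_eq_square algebra_simps)
    qed
    then have "(\<integral>w. Z h w * Z g w \<partial>Q) = (\<integral>w. ((Z (h + g) w)\<^sup>2 - (Z h w)\<^sup>2 - (Z g w)\<^sup>2) / 2 \<partial>Q)"
      by (intro integral_cong_AE) auto
    also have "\<dots> = ((norm (h + g))\<^sup>2 - (norm h)\<^sup>2 - (norm g)\<^sup>2) / 2" by (simp add: sq)
    also have "\<dots> = inner h g" by (simp add: power2_norm_eq_inner inner_add_left inner_add_right inner_commute)
    finally show ?thesis .
  qed
  with g have "isonormal Q Z" by (simp add: isonormal_def)
  then show ?thesis using pQ unfolding Q_def Z_def[abs_def]
    by (simp add: isonormal_process_def isonormal_process_axioms_def)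
qed

end

section \<open>Stein's identity and rapidly decreasing functions\<close>

lemma std_normal_density_tendsto_0:
  "(std_normal_density \<longlongrightarrow> 0) at_top" "(std_normal_density \<longlongrightarrow> 0) at_bot"
proof -
  have t: "((\<lambda>x::real. exp (- (x\<^sup>2) / 2)) \<longlongrightarrow> 0) at_top"
  proof (rule filterlim_compose[OF exp_at_bot])
    have "filterlim (\<lambda>x::real. (1/2) * x\<^sup>2) at_top at_top"
      by (intro filterlim_tendsto_pos_mult_at_top[OF tendsto_const] filterlim_pow_at_top filterlim_ident) auto
    then have "filterlim (\<lambda>x::real. - ((1/2) * x\<^sup>2)) at_bot at_top" by (simp add: filterlim_uminus_at_bot)
    then show "filterlim (\<lambda>x::real. - (x\<^sup>2) / 2) at_bot at_top" by simp
  qed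
  have "((\<lambda>x. 1 / sqrt (2 * pi) * exp (- (x\<^sup>2) / 2)) \<longlongrightarrow> 1 / sqrt (2 * pi) * 0) at_top"
    by (intro tendsto_mult tendsto_const t)
  then show 1: "(std_normal_density \<longlongrightarrow> 0) at_top" by (simp add: std_normal_density_def[abs_def])
  then show "(std_normal_density \<longlongrightarrow> 0) at_bot"
    unfolding at_bot_mirror filterlim_filtermap by (simp add: std_normal_density_def[abs_def])
qed

text \<open>The fundamental theorem of calculus for the product of \<open>p\<close> with the normal density.\<close>

lemma stein_std_normal:
  fixes p p' :: "real \<Rightarrow> real"
  assumes der: "\<And>y. (p has_real_derivative p' y) (at y)"
    and cont: "continuous_on UNIV p'"
    and bp: "\<And>y. \<bar>p y\<bar> \<le> C" and bp': "\<And>y. \<bar>p' y\<bar> \<le> C"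
  shows "(\<integral>y. y * p y \<partial>std_normal_distribution) = (\<integral>y. p' y \<partial>std_normal_distribution)"
proof -
  let ?S = std_normal_distribution
  interpret S: real_distribution std_normal_distribution by (rule real_dist_normal_dist)
  have cp: "continuous_on UNIV p" using der by (intro DERIV_continuous_on) auto
  have [measurable]: "p \<in> borel_measurable borel" "p' \<in> borel_measurable borel"
    using cp cont by (auto intro: borel_measurable_continuous_onI)
  have i1: "integrable ?S p'" by (rule S.integrable_const_bound[where B = C]) (use bp' in auto)
  have i2: "integrable ?S (\<lambda>y. y * p y)"
  proof (rule Bochner_Integration.integrable_bound)
    show "integrable ?S (\<lambda>y. C * \<bar>y\<bar>)"
      using integrable_std_normal_distribution_moment[of 1] by simp
    show "AE y in ?S. norm (y * p y) \<le> norm (C * \<bar>y\<bar>)"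
    proof (rule AE_I2)
      fix y
      have "\<bar>y\<bar> * \<bar>p y\<bar> \<le> \<bar>y\<bar> * C" by (intro mult_left_mono bp) auto
      moreover have "0 \<le> C" using bp[of 0] by linarith
      ultimately show "norm (y * p y) \<le> norm (C * \<bar>y\<bar>)" by (simp add: abs_mult mult.commute)
    qed
  qed simp
  let ?\<phi> = std_normal_density
  define f where "f y = ?\<phi> y * (p' y - y * p y)" for y
  have dphi: "(?\<phi> has_real_derivative - y * ?\<phi> y) (at y)" for y
  proof -
    have "((\<lambda>y. c * exp (- y\<^sup>2 / 2)) has_real_derivative - y * (c * exp (- y\<^sup>2 / 2))) (at y)" for c :: real
      by (auto intro!: derivative_eq_intros)
    then show ?thesis unfolding std_normal_density_def .
  qed
  have d: "((\<lambda>y. ?\<phi> y * p y) has_real_derivative f y) (at y)" for y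
    by (rule DERIV_cong[OF DERIV_mult[OF dphi der]]) (simp add: f_def algebra_simps)
  have cphi: "continuous_on UNIV ?\<phi>" using dphi by (intro DERIV_continuous_on) auto
  have cf: "continuous_on UNIV f" unfolding f_def by (intro continuous_intros cphi cont cp)
  have "integrable ?S (\<lambda>y. p' y - y * p y)" using i1 i2 by simp
  then have fi: "integrable lborel f" by (subst (asm) integrable_density) (auto simp: f_def[abs_def])
  have lim0: "((\<lambda>y. ?\<phi> y * p y) \<longlongrightarrow> 0) G" if "(?\<phi> \<longlongrightarrow> 0) G" for G
    by (rule Lim_null_comparison[where g = "\<lambda>y. ?\<phi> y * C"])
       (use bp tendsto_mult_left_zero[OF that] in \<open>auto intro!: always_eventually mult_left_mono simp: abs_mult\<close>)
  have "(LBINT x=-\<infinity>..\<infinity>. f x) = 0 - 0"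
  proof (rule interval_integral_FTC_integrable)
    show "((\<lambda>y. ?\<phi> y * p y) has_vector_derivative f x) (at x)" for x
      using d by (simp add: has_real_derivative_iff_has_vector_derivative)
    show "isCont f x" for x using cf by (simp add: continuous_on_eq_continuous_at)
    show "set_integrable lborel (einterval (- \<infinity>) \<infinity>) f" using fi by (simp add: set_integrable_def)
    show "(((\<lambda>y. ?\<phi> y * p y) \<circ> real_of_ereal) \<longlongrightarrow> 0) (at_right (- \<infinity>))"
      using lim0[OF std_normal_density_tendsto_0(2)] by (simp add: ereal_tendsto_simps)
    show "(((\<lambda>y. ?\<phi> y * p y) \<circ> real_of_ereal) \<longlongrightarrow> 0) (at_left \<infinity>)"
      using lim0[OF std_normal_density_tendsto_0(1)] by (simp add: ereal_tendsto_simps)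
  qed simp
  then have "(\<integral>x. f x \<partial>lborel) = 0"
    by (simp add: interval_lebesgue_integral_def set_lebesgue_integral_def)
  then have "(\<integral>y. p' y - y * p y \<partial>?S) = 0"
    by (subst integral_density) (auto simp: f_def)
  then show ?thesis using i1 i2 by simp
qed

lemma mvt_between:
  fixes g g' :: "real \<Rightarrow> real"
  assumes "\<And>y. (g has_real_derivative g' y) (at y)"
  shows "\<exists>z. \<bar>z - a\<bar> \<le> \<bar>b - a\<bar> \<and> g b - g a = (b - a) * g' z"
proof (cases a b rule: linorder_cases)
  case less
  from MVT2[OF less, of g g'] assms obtain z where "a < z" "z < b" "g b - g a = (b - a) * g' z" by blast
  then show ?thesis by (intro exI[of _ z]) auto
next
  case greater
  from MVT2[OF greater, of g g'] assms obtain z where "b < z" "z < a" "g a - g b = (a - b) * g' z" by blast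
  then show ?thesis by (intro exI[of _ z]) (auto simp: algebra_simps)
qed auto

lemma schwartz_depends:
  assumes "schwartz n f" "\<And>i. i < n \<Longrightarrow> x i = y i"
  shows "f x = f y"
  using assms unfolding schwartz_def by blast

lemma schwartz_iter:
  assumes "schwartz n f" "set is \<subseteq> {..<n}"
  shows "i < n \<Longrightarrow> (\<lambda>y. foldr pderiv_at is f (x(i := y))) differentiable at (x i)"
    and "\<exists>C. \<forall>x. (1 + (\<Sum>i<n. \<bar>x i\<bar>)) ^ k * \<bar>foldr pderiv_at is f x\<bar> \<le> C"
  using assms unfolding schwartz_def by blast+

lemma schwartz_pderiv:
  assumes f: "schwartz n f" and i: "i < n"
  shows "schwartz n (pderiv_at i f)"
  unfolding schwartz_def
proof (intro conjI allI impI)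
  fix x y :: "nat \<Rightarrow> real" assume xy: "\<forall>i<n. x i = y i"
  have "f (x(i := z)) = f (y(i := z))" for z
    by (rule schwartz_depends[OF f]) (use xy in auto)
  then show "pderiv_at i f x = pderiv_at i f y" using xy i by (simp add: pderiv_at_def)
next
  fix js x j assume js: "set js \<subseteq> {..<n}" and j: "j < n"
  show "(\<lambda>y. foldr pderiv_at js (pderiv_at i f) (x(j := y))) differentiable at (x j)"
    using schwartz_iter(1)[OF f, of "js @ [i]" j x] js i j by simp
next
  fix js and k :: nat assume js: "set js \<subseteq> {..<n}"
  show "\<exists>C. \<forall>x. (1 + (\<Sum>i<n. \<bar>x i\<bar>)) ^ k * \<bar>foldr pderiv_at js (pderiv_at i f) x\<bar> \<le> C"
    using schwartz_iter(2)[OF f, of "js @ [i]" k] js i by simp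
qed

lemma schwartz_bounded:
  assumes "schwartz n f" shows "\<exists>C\<ge>0. \<forall>x. \<bar>f x\<bar> \<le> C"
proof -
  obtain C where C: "\<And>x. \<bar>f x\<bar> \<le> C" using schwartz_iter(2)[OF assms, of "[]" 0] by auto
  moreover have "0 \<le> C" using C[of "\<lambda>_. 0"] by linarith
  ultimately show ?thesis by blast
qed

lemma schwartz_has_pderiv:
  assumes "schwartz n f" "i < n"
  shows "((\<lambda>y. f (x(i := y))) has_real_derivative pderiv_at i f (x(i := y))) (at y)"
proof -
  have "(\<lambda>z. f (x(i := z))) differentiable at y"
    using schwartz_iter(1)[OF assms(1), of "[]" i "x(i := y)"] assms(2) by simp
  then show ?thesis by (simp add: pderiv_at_def DERIV_deriv_iff_real_differentiable)
qed

text \<open>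
  The definition of \<open>schwartz\<close> provides only partial derivatives. Changing one coordinate at a time,
  the mean value theorem in each step compares two arbitrary points.
\<close>

lemma schwartz_telescope:
  assumes f: "schwartz n f"
  shows "\<exists>\<zeta>. (\<forall>k<n. \<forall>i<n. \<bar>\<zeta> k i - x i\<bar> \<le> \<bar>y i - x i\<bar>) \<and>
     f y - f x = (\<Sum>k<n. (y k - x k) * pderiv_at k f (\<zeta> k))"
proof -
  \<comment> \<open>The intermediate points have the first \<open>k\<close> coordinates of \<open>y\<close> and the others of \<open>x\<close>.\<close>
  define m where "m k = (\<lambda>i. if i < k then y i else x i)" for k :: nat
  have "\<exists>z. \<bar>z - x k\<bar> \<le> \<bar>y k - x k\<bar> \<and> f (m (Suc k)) - f (m k) = (y k - x k) * pderiv_at k f ((m k)(k := z))"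
    if "k < n" for k
  proof -
    have "m (Suc k) = (m k)(k := y k)" "m k = (m k)(k := x k)" by (auto simp: m_def fun_eq_iff less_Suc_eq)
    then show ?thesis
      using mvt_between[OF schwartz_has_pderiv[OF f that, of "m k"], of "x k" "y k"] by simp
  qed
  then obtain z where z: "\<And>k. k < n \<Longrightarrow> \<bar>z k - x k\<bar> \<le> \<bar>y k - x k\<bar>"
    "\<And>k. k < n \<Longrightarrow> f (m (Suc k)) - f (m k) = (y k - x k) * pderiv_at k f ((m k)(k := z k))" by metis
  have "f y = f (m n)" by (rule schwartz_depends[OF f]) (simp add: m_def)
  moreover have "f x = f (m 0)" by (simp add: m_def)
  moreover have "f (m n) - f (m 0) = (\<Sum>k<n. f (m (Suc k)) - f (m k))" by (rule sum_lessThan_telescope[symmetric])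
  ultimately have "f y - f x = (\<Sum>k<n. (y k - x k) * pderiv_at k f ((m k)(k := z k)))" by (simp add: z(2))
  moreover have "\<forall>k<n. \<forall>i<n. \<bar>((m k)(k := z k)) i - x i\<bar> \<le> \<bar>y i - x i\<bar>"
    using z(1) by (auto simp: m_def)
  ultimately show ?thesis by (intro exI[of _ "\<lambda>k. (m k)(k := z k)"]) auto
qed

lemma schwartz_pderiv_bounded:
  assumes f: "schwartz n f"
  shows "\<exists>C\<ge>0. \<forall>i<n. \<forall>x. \<bar>pderiv_at i f x\<bar> \<le> C"
proof -
  have "\<exists>C\<ge>0. \<forall>x. \<bar>pderiv_at i f x\<bar> \<le> C" if "i < n" for i
    by (rule schwartz_bounded[OF schwartz_pderiv[OF f that]])
  then obtain C where C: "\<And>i. i < n \<Longrightarrow> 0 \<le> C i" "\<And>i x. i < n \<Longrightarrow> \<bar>pderiv_at i f x\<bar> \<le> C i" by metis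
  have "\<bar>pderiv_at i f x\<bar> \<le> (\<Sum>j<n. C j)" if "i < n" for i x
    using C(2)[OF that, of x] member_le_sum[of i "{..<n}" C] that C(1) by fastforce
  then show ?thesis using sum_nonneg[of "{..<n}" C] C(1) by (intro exI[of _ "\<Sum>j<n. C j"]) auto
qed

lemma schwartz_lipschitz:
  assumes f: "schwartz n f"
  shows "\<exists>C\<ge>0. \<forall>x y. \<bar>f y - f x\<bar> \<le> C * (\<Sum>i<n. \<bar>y i - x i\<bar>)"
proof -
  obtain C where C: "C \<ge> 0" "\<And>i x. i < n \<Longrightarrow> \<bar>pderiv_at i f x\<bar> \<le> C"
    using schwartz_pderiv_bounded[OF f] by blast
  have "\<bar>f y - f x\<bar> \<le> C * (\<Sum>i<n. \<bar>y i - x i\<bar>)" for x y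
  proof -
    obtain \<zeta> where "f y - f x = (\<Sum>k<n. (y k - x k) * pderiv_at k f (\<zeta> k))"
      using schwartz_telescope[OF f] by blast
    then have "\<bar>f y - f x\<bar> \<le> (\<Sum>k<n. \<bar>(y k - x k) * pderiv_at k f (\<zeta> k)\<bar>)" by simp
    also have "\<dots> \<le> (\<Sum>k<n. C * \<bar>y k - x k\<bar>)"
      by (rule sum_mono) (use C(2) in \<open>auto simp: abs_mult mult.commute intro!: mult_right_mono\<close>)
    finally show ?thesis by (simp add: sum_distrib_left)
  qed
  then show ?thesis using C(1) by blast
qed

lemma schwartz_continuous:
  assumes f: "schwartz n f"
  shows "continuous_on UNIV f"
proof -
  obtain C where C: "\<And>x y. \<bar>f y - f x\<bar> \<le> C * (\<Sum>i<n. \<bar>y i - x i\<bar>)"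
    using schwartz_lipschitz[OF f] by blast
  have coord: "((\<lambda>y::nat \<Rightarrow> real. y i) \<longlongrightarrow> x i) (at x)" for i x
    using continuous_on_product_coordinates[of i] unfolding continuous_on_def by blast
  have "(f \<longlongrightarrow> f x) (at x)" for x
  proof -
    have "((\<lambda>y. C * (\<Sum>i<n. \<bar>y i - x i\<bar>)) \<longlongrightarrow> C * (\<Sum>i<n. \<bar>x i - x i\<bar>)) (at x)"
      by (intro tendsto_mult tendsto_const tendsto_sum tendsto_rabs tendsto_diff coord)
    then have "((\<lambda>y. C * (\<Sum>i<n. \<bar>y i - x i\<bar>)) \<longlongrightarrow> 0) (at x)" by simp
    then have "((\<lambda>y. f y - f x) \<longlongrightarrow> 0) (at x)"
      by (rule Lim_null_comparison[rotated]) (use C in auto)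
    then show ?thesis by (simp add: LIM_zero_iff)
  qed
  then show ?thesis by (simp add: continuous_on_def)
qed

lemma schwartz_measurable:
  "schwartz n f \<Longrightarrow> f \<in> borel_measurable borel"
  by (intro borel_measurable_continuous_onI schwartz_continuous)

lemma has_real_derivative_quadratic:
  fixes g :: "real \<Rightarrow> real"
  assumes "\<And>s. \<bar>g (t + s) - g t - s * D\<bar> \<le> K * s\<^sup>2"
  shows "(g has_real_derivative D) (at t)"
proof -
  have "((\<lambda>s. (g (t + s) - g t) / s - D) \<longlongrightarrow> 0) (at 0)"
  proof (rule Lim_null_comparison)
    show "\<forall>\<^sub>F s in at 0. norm ((g (t + s) - g t) / s - D) \<le> K * \<bar>s\<bar>"
      unfolding eventually_at_filter
    proof (intro always_eventually allI impI)
      fix s :: real assume s: "s \<noteq> 0"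
      have "(g (t + s) - g t) / s - D = (g (t + s) - g t - s * D) / s" using s by (simp add: field_simps)
      then have "norm ((g (t + s) - g t) / s - D) = \<bar>g (t + s) - g t - s * D\<bar> / \<bar>s\<bar>" by (simp add: abs_divide)
      also have "\<dots> \<le> K * s\<^sup>2 / \<bar>s\<bar>" by (intro divide_right_mono assms) simp
      also have "\<dots> = K * \<bar>s\<bar>" using s by (simp add: power2_eq_square abs_if)
      finally show "norm ((g (t + s) - g t) / s - D) \<le> K * \<bar>s\<bar>" .
    qed
    have "((\<lambda>s. K * \<bar>s\<bar>) \<longlongrightarrow> K * \<bar>0::real\<bar>) (at 0)" by (intro tendsto_intros)
    then show "((\<lambda>s. K * \<bar>s\<bar>) \<longlongrightarrow> 0) (at (0::real))" by simp
  qed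
  then show ?thesis by (simp add: DERIV_def LIM_zero_iff)
qed

text \<open>
  As the partial derivatives are themselves Lipschitz, the telescoping sum differs from its
  linearization by a quadratic error.
\<close>

lemma schwartz_line_derivative:
  assumes f: "schwartz n f"
  shows "((\<lambda>t. f (\<lambda>i. a i * t + z i)) has_real_derivative
     (\<Sum>k<n. a k * pderiv_at k f (\<lambda>i. a i * t + z i))) (at t)"
proof -
  have "\<exists>C\<ge>0. \<forall>x y. \<bar>pderiv_at k f y - pderiv_at k f x\<bar> \<le> C * (\<Sum>i<n. \<bar>y i - x i\<bar>)" if "k < n" for k
    by (rule schwartz_lipschitz[OF schwartz_pderiv[OF f that]])
  then obtain C where C: "\<And>k. k < n \<Longrightarrow> C k \<ge> 0"
    "\<And>k x y. k < n \<Longrightarrow> \<bar>pderiv_at k f y - pderiv_at k f x\<bar> \<le> C k * (\<Sum>i<n. \<bar>y i - x i\<bar>)" by metis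
  define A where "A = (\<Sum>i<n. \<bar>a i\<bar>)"
  show ?thesis
  proof (rule has_real_derivative_quadratic[where K = "\<Sum>k<n. \<bar>a k\<bar> * (C k * A)"])
    fix s
    define x y where "x i = a i * t + z i" and "y i = a i * (t + s) + z i" for i
    have yx: "y i - x i = a i * s" for i by (simp add: x_def y_def algebra_simps)
    obtain \<zeta> where \<zeta>: "\<And>k i. k < n \<Longrightarrow> i < n \<Longrightarrow> \<bar>\<zeta> k i - x i\<bar> \<le> \<bar>y i - x i\<bar>"
      "f y - f x = (\<Sum>k<n. (y k - x k) * pderiv_at k f (\<zeta> k))"
      using schwartz_telescope[OF f] by blast
    have "f y - f x - s * (\<Sum>k<n. a k * pderiv_at k f x) = (\<Sum>k<n. a k * s * (pderiv_at k f (\<zeta> k) - pderiv_at k f x))"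
      unfolding \<zeta>(2) yx by (simp add: sum_distrib_left right_diff_distrib sum_subtractf mult_ac)
    then have "\<bar>f y - f x - s * (\<Sum>k<n. a k * pderiv_at k f x)\<bar> \<le> (\<Sum>k<n. \<bar>a k * s * (pderiv_at k f (\<zeta> k) - pderiv_at k f x)\<bar>)"
      by simp
    also have "\<dots> \<le> (\<Sum>k<n. \<bar>a k\<bar> * \<bar>s\<bar> * (C k * (A * \<bar>s\<bar>)))"
    proof (rule sum_mono)
      fix k assume "k \<in> {..<n}" then have k: "k < n" by simp
      have "(\<Sum>i<n. \<bar>\<zeta> k i - x i\<bar>) \<le> (\<Sum>i<n. \<bar>a i\<bar> * \<bar>s\<bar>)"
        by (rule sum_mono) (use \<zeta>(1)[OF k] in \<open>auto simp: yx abs_mult\<close>)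
      then have "(\<Sum>i<n. \<bar>\<zeta> k i - x i\<bar>) \<le> A * \<bar>s\<bar>" by (simp add: A_def sum_distrib_right)
      then have "\<bar>pderiv_at k f (\<zeta> k) - pderiv_at k f x\<bar> \<le> C k * (A * \<bar>s\<bar>)"
        using C(2)[OF k, of "\<zeta> k" x] C(1)[OF k] by (meson mult_left_mono order_trans)
      then show "\<bar>a k * s * (pderiv_at k f (\<zeta> k) - pderiv_at k f x)\<bar> \<le> \<bar>a k\<bar> * \<bar>s\<bar> * (C k * (A * \<bar>s\<bar>))"
        by (simp add: abs_mult mult_left_mono)
    qed
    also have "\<dots> = (\<Sum>k<n. \<bar>a k\<bar> * (C k * A)) * (\<bar>s\<bar> * \<bar>s\<bar>)"
      unfolding sum_distrib_right by (simp add: mult_ac del: abs_mult_self_eq)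
    also have "\<bar>s\<bar> * \<bar>s\<bar> = s\<^sup>2" by (simp add: power2_eq_square)
    finally show "\<bar>f (\<lambda>i. a i * (t + s) + z i) - f (\<lambda>i. a i * t + z i) - s * (\<Sum>k<n. a k * pderiv_at k f (\<lambda>i. a i * t + z i))\<bar>
        \<le> (\<Sum>k<n. \<bar>a k\<bar> * (C k * A)) * s\<^sup>2"
      unfolding x_def[abs_def] y_def[abs_def] .
  qed
qed

section \<open>Integration by parts on the domain of the gradient\<close>

text \<open>The sum of the sequence is integrable; it dominates every term and forces convergence.\<close>

lemma geometric_L1_dominated:
  fixes d :: "nat \<Rightarrow> 'a \<Rightarrow> real"
  assumes [measurable]: "\<And>k. d k \<in> borel_measurable M" and nn: "\<And>k w. 0 \<le> d k w"
    and r: "\<And>k. (\<integral>\<^sup>+w. ennreal (d k w) \<partial>M) \<le> ennreal ((1/2) ^ k)"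
  obtains S :: "'a \<Rightarrow> real" where "integrable M S"
    "AE w in M. (\<lambda>k. d k w) \<longlonglongrightarrow> 0" "AE w in M. \<forall>k. d k w \<le> S w"
proof -
  define S where "S w = (\<Sum>k. ennreal (d k w))" for w
  have [measurable]: "S \<in> borel_measurable M" unfolding S_def[abs_def] by measurable
  have "(\<integral>\<^sup>+w. S w \<partial>M) = (\<Sum>k. \<integral>\<^sup>+w. ennreal (d k w) \<partial>M)"
    unfolding S_def by (rule nn_integral_suminf) simp
  also have "\<dots> \<le> (\<Sum>k. ennreal ((1/2) ^ k))" by (intro suminf_le r) auto
  also have "\<dots> = ennreal 2"
    by (rule suminf_ennreal_eq) (use geometric_sums[of "1/2 :: real"] in auto)
  finally have S: "(\<integral>\<^sup>+w. S w \<partial>M) < \<infinity>" by (simp add: order_le_less_trans)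
  then have fin: "AE w in M. S w \<noteq> \<infinity>" by (intro nn_integral_PInf_AE) auto
  have eS: "AE w in M. ennreal (enn2real (S w)) = S w" using fin by eventually_elim (simp add: less_top)
  show ?thesis
  proof
    have "(\<integral>\<^sup>+w. ennreal (enn2real (S w)) \<partial>M) = (\<integral>\<^sup>+w. S w \<partial>M)" using eS by (rule nn_integral_cong_AE)
    then show "integrable M (\<lambda>w. enn2real (S w))" using S by (intro integrableI_nonneg) auto
    show "AE w in M. (\<lambda>k. d k w) \<longlonglongrightarrow> 0"
      using fin
    proof eventually_elim
      case (elim w)
      then have "summable (\<lambda>k. d k w)" unfolding S_def
        by (intro summable_suminf_not_top nn) (simp add: infinity_ennreal_def)
      then show ?case by (rule summable_LIMSEQ_zero)
    qed
    show "AE w in M. \<forall>k. d k w \<le> enn2real (S w)"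
      using eS
    proof eventually_elim
      case (elim w)
      show ?case
      proof
        fix k
        have "ennreal (d k w) = (\<Sum>i\<in>{k}. ennreal (d i w))" by simp
        also have "\<dots> \<le> S w" unfolding S_def by (rule sum_le_suminf) auto
        finally have "ennreal (d k w) \<le> ennreal (enn2real (S w))" unfolding elim .
        then show "d k w \<le> enn2real (S w)" by (simp add: ennreal_le_iff)
      qed
    qed
  qed
qed

text \<open>
  Convergence in \<open>L\<^sup>1\<close> gives, along a selection of indices, almost sure convergence together with an
  integrable majorant. It is applied below to the sum of all squared distances in an approximation,
  so that dominated convergence is available for products of two \<open>L\<^sup>2\<close>-convergent sequences.
\<close>

lemma rapid_subsequence:
  fixes d :: "nat \<Rightarrow> 'a \<Rightarrow> real"
  assumes m: "\<And>k. d k \<in> borel_measurable M" and nn: "\<And>k w. 0 \<le> d k w"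
    and lim: "(\<lambda>k. \<integral>\<^sup>+w. ennreal (d k w) \<partial>M) \<longlonglongrightarrow> 0"
  obtains r :: "nat \<Rightarrow> nat" and S :: "'a \<Rightarrow> real" where "integrable M S"
    "AE w in M. (\<lambda>k. d (r k) w) \<longlonglongrightarrow> 0" "AE w in M. \<forall>k. d (r k) w \<le> S w"
proof -
  have "\<forall>k. \<exists>j. (\<integral>\<^sup>+w. ennreal (d j w) \<partial>M) \<le> ennreal ((1/2) ^ k)"
  proof
    fix k :: nat
    have "\<forall>\<^sub>F j in sequentially. (\<integral>\<^sup>+w. ennreal (d j w) \<partial>M) < ennreal ((1/2) ^ k)"
      by (rule order_tendstoD(2)[OF lim]) simp
    then obtain j where "(\<integral>\<^sup>+w. ennreal (d j w) \<partial>M) < ennreal ((1/2) ^ k)"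
      unfolding eventually_sequentially by blast
    then show "\<exists>j. (\<integral>\<^sup>+w. ennreal (d j w) \<partial>M) \<le> ennreal ((1/2) ^ k)" by (intro exI[of _ j] less_imp_le)
  qed
  from choice[OF this] obtain r where r: "\<And>k. (\<integral>\<^sup>+w. ennreal (d (r k) w) \<partial>M) \<le> ennreal ((1/2) ^ k)" by blast
  from geometric_L1_dominated[of "\<lambda>k. d (r k)", OF m nn r] that show thesis by blast
qed

lemma square_norm_add_le:
  fixes x y :: "'b::real_normed_vector"
  shows "(norm (x + y))\<^sup>2 \<le> 2 * (norm x)\<^sup>2 + 2 * (norm y)\<^sup>2"
proof -
  have "(norm (x + y))\<^sup>2 \<le> (norm x + norm y)\<^sup>2" by (intro power_mono norm_triangle_ineq) simp
  also have "\<dots> \<le> 2 * (norm x)\<^sup>2 + 2 * (norm y)\<^sup>2"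
    using sum_squares_bound[of "norm x" "norm y"] by (simp add: power2_sum)
  finally show ?thesis .
qed

lemma tendsto_of_square_bound:
  fixes x :: "nat \<Rightarrow> 'b::real_normed_vector"
  assumes "d \<longlonglongrightarrow> (0::real)" "\<And>k. (norm (x k - y))\<^sup>2 \<le> d k"
  shows "x \<longlonglongrightarrow> y"
proof -
  have "(\<lambda>k. sqrt (d k)) \<longlonglongrightarrow> sqrt 0" by (intro tendsto_real_sqrt assms)
  then have l: "(\<lambda>k. sqrt (d k)) \<longlonglongrightarrow> 0" by simp
  have "(\<lambda>k. x k - y) \<longlonglongrightarrow> 0"
    by (rule Lim_null_comparison[OF _ l]) (use assms(2) in \<open>auto intro!: always_eventually real_le_rsqrt\<close>)
  then show ?thesis by (simp add: LIM_zero_iff)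
qed

context isonormal_process
begin

text \<open>
  After \<open>distr_split_unit\<close>, applied to the sequence consisting of \<open>e\<close> followed by the \<open>h\<^sub>i\<close>, the
  expectation is an integral over lines in the direction \<open>(\<langle>h\<^sub>i, e\<rangle>)\<^sub>i\<close>, and Stein's identity holds on
  each line.
\<close>

lemma ibp_schwartz_unit:
  fixes h :: "nat \<Rightarrow> 'h"
  assumes e: "norm e = 1" and f: "schwartz n f" and g: "schwartz m g"
    and \<psi>: "\<And>x. (\<psi> has_real_derivative \<psi>' x) (at x)" "continuous_on UNIV \<psi>'"
    and C: "\<And>x. \<bar>\<psi> x\<bar> \<le> C" "\<And>x. \<bar>\<psi>' x\<bar> \<le> C"
  defines "x \<equiv> (\<lambda>w i. Y (h i) w)"
  shows "(\<integral>w. Y e w * (g (x w) * \<psi> (f (x w))) \<partial>P)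
    = (\<integral>w. (\<Sum>k<m. inner (h k) e * pderiv_at k g (x w)) * \<psi> (f (x w))
         + g (x w) * (\<psi>' (f (x w)) * (\<Sum>k<n. inner (h k) e * pderiv_at k f (x w))) \<partial>P)"
proof -
  let ?S = std_normal_distribution and ?SP = "std_normal_distribution \<Otimes>\<^sub>M P"
  interpret S: real_distribution std_normal_distribution by (rule real_dist_normal_dist)
  interpret SP: pair_prob_space std_normal_distribution P ..
  have cont\<psi>: "continuous_on UNIV \<psi>" using \<psi>(1) by (intro DERIV_continuous_on) auto
  note [measurable] = schwartz_measurable[OF f] schwartz_measurable[OF g]
    borel_measurable_continuous_onI[OF cont\<psi>] borel_measurable_continuous_onI[OF \<psi>(2)]
  define Dg where "Dg y = (\<Sum>k<m. inner (h k) e * pderiv_at k g y)" for y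
  define Df where "Df y = (\<Sum>k<n. inner (h k) e * pderiv_at k f y)" for y
  have cDg: "continuous_on UNIV Dg" unfolding Dg_def
    by (intro continuous_intros schwartz_continuous[OF schwartz_pderiv[OF g]]) auto
  have cDf: "continuous_on UNIV Df" unfolding Df_def
    by (intro continuous_intros schwartz_continuous[OF schwartz_pderiv[OF f]]) auto
  have [measurable]: "Dg \<in> borel_measurable borel" "Df \<in> borel_measurable borel"
    using cDg cDf by (auto intro: borel_measurable_continuous_onI)
  have bD: "\<exists>K\<ge>0. \<forall>y. \<bar>\<Sum>k<j. inner (h k) e * pderiv_at k p y\<bar> \<le> K" if p: "schwartz j p" for p j
  proof -
    obtain K where K: "K \<ge> 0" "\<And>i x. i < j \<Longrightarrow> \<bar>pderiv_at i p x\<bar> \<le> K"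
      using schwartz_pderiv_bounded[OF p] by blast
    have "\<bar>\<Sum>k<j. inner (h k) e * pderiv_at k p y\<bar> \<le> (\<Sum>k<j. \<bar>inner (h k) e\<bar> * K)" for y
      by (rule order_trans[OF sum_abs]) (auto intro!: sum_mono mult_left_mono K simp: abs_mult)
    then show ?thesis using K(1) by (intro exI[of _ "\<Sum>k<j. \<bar>inner (h k) e\<bar> * K"]) (auto intro!: sum_nonneg)
  qed
  obtain Kf Kg Lf Lg where K: "0 \<le> Kf" "0 \<le> Kg" "0 \<le> Lf" "0 \<le> Lg"
      "\<And>y. \<bar>f y\<bar> \<le> Kf" "\<And>y. \<bar>g y\<bar> \<le> Kg" "\<And>y. \<bar>Df y\<bar> \<le> Lf" "\<And>y. \<bar>Dg y\<bar> \<le> Lg"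
  proof -
    obtain Kf where 1: "0 \<le> Kf" "\<And>y. \<bar>f y\<bar> \<le> Kf" using schwartz_bounded[OF f] by blast
    obtain Kg where 2: "0 \<le> Kg" "\<And>y. \<bar>g y\<bar> \<le> Kg" using schwartz_bounded[OF g] by blast
    obtain Lf where 3: "0 \<le> Lf" "\<And>y. \<bar>Df y\<bar> \<le> Lf" using bD[OF f] unfolding Df_def by blast
    obtain Lg where 4: "0 \<le> Lg" "\<And>y. \<bar>Dg y\<bar> \<le> Lg" using bD[OF g] unfolding Dg_def by blast
    show thesis by (rule that[OF 1(1) 2(1) 3(1) 4(1) 1(2) 2(2) 3(2) 4(2)])
  qed
  have C0: "0 \<le> C" using C(1)[of 0] by linarith
  define \<Phi> where "\<Phi> y = g y * \<psi> (f y)" for y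
  define \<Phi>' where "\<Phi>' y = Dg y * \<psi> (f y) + g y * (\<psi>' (f y) * Df y)" for y
  define B where "B = Kg * C + (Lg * C + Kg * (C * Lf))"
  have b1: "\<bar>\<Phi> y\<bar> \<le> B" for y
  proof -
    have "\<bar>\<Phi> y\<bar> \<le> Kg * C" unfolding \<Phi>_def abs_mult by (intro mult_mono K C) auto
    then show ?thesis using K C0 by (simp add: B_def add_increasing2)
  qed
  have b2: "\<bar>\<Phi>' y\<bar> \<le> B" for y
  proof -
    have "\<bar>\<Phi>' y\<bar> \<le> \<bar>Dg y * \<psi> (f y)\<bar> + \<bar>g y * (\<psi>' (f y) * Df y)\<bar>" unfolding \<Phi>'_def by (rule abs_triangle_ineq)
    also have "\<dots> \<le> Lg * C + Kg * (C * Lf)"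
      unfolding abs_mult by (intro add_mono mult_mono K C) (auto simp: K C0)
    finally show ?thesis using K C0 by (simp add: B_def add_increasing)
  qed
  have [measurable]: "\<Phi> \<in> borel_measurable borel" "\<Phi>' \<in> borel_measurable borel"
    unfolding \<Phi>_def[abs_def] \<Phi>'_def[abs_def] by measurable
  define gs where "gs i = (case i of 0 \<Rightarrow> e | Suc j \<Rightarrow> h j)" for i
  define tl where "tl y i = y (Suc i)" for y :: "nat \<Rightarrow> real" and i
  have crd[measurable]: "(\<lambda>y::nat \<Rightarrow> real. y i) \<in> borel_measurable borel" for i
    by (intro borel_measurable_continuous_onI continuous_on_product_coordinates)
  have [measurable]: "tl \<in> borel_measurable borel"
    by (rule measurable_coordinatewise_then_product) (simp add: tl_def)
  define seq where "seq w i = Y (gs i) w" for w i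
  define spl where "spl = split_along e gs"
  have [measurable]: "seq \<in> borel_measurable P" "spl \<in> borel_measurable ?SP" by (simp_all add: seq_def[abs_def] spl_def)
  have law: "distr P borel seq = distr ?SP borel spl"
    unfolding seq_def[abs_def] spl_def by (rule distr_split_unit[OF e])
  have seq: "seq w 0 = Y e w" "tl (seq w) = x w" for w by (auto simp: seq_def gs_def tl_def x_def)
  have split: "integrable ?SP (\<lambda>p. \<Psi> (spl p))"
      "(\<integral>w. \<Psi> (seq w) \<partial>P) = (\<integral>w. \<integral>y. \<Psi> (spl (y, w)) \<partial>?S \<partial>P)"
    if [measurable]: "\<Psi> \<in> borel_measurable borel" and i: "integrable P (\<lambda>w. \<Psi> (seq w))" for \<Psi> :: "(nat \<Rightarrow> real) \<Rightarrow> real"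
  proof -
    have "integrable (distr P borel seq) \<Psi>" using i by (subst integrable_distr_eq) auto
    then show i2: "integrable ?SP (\<lambda>p. \<Psi> (spl p))"
      unfolding law by (subst (asm) integrable_distr_eq) auto
    have "(\<integral>w. \<Psi> (seq w) \<partial>P) = (\<integral>y. \<Psi> y \<partial>distr P borel seq)" by (subst integral_distr) auto
    also have "\<dots> = (\<integral>p. \<Psi> (spl p) \<partial>?SP)" unfolding law by (subst integral_distr) auto
    also have "\<dots> = (\<integral>w. \<integral>y. \<Psi> (spl (y, w)) \<partial>?S \<partial>P)"
      using SP.integral_snd[of "\<lambda>y w. \<Psi> (spl (y, w))"] i2 by (simp add: split_beta')
    finally show "(\<integral>w. \<Psi> (seq w) \<partial>P) = (\<integral>w. \<integral>y. \<Psi> (spl (y, w)) \<partial>?S \<partial>P)" .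
  qed
  have ee: "inner e e = 1" using e by (simp add: norm_eq_1)
  have i1: "integrable P (\<lambda>w. Y e w * \<Phi> (x w))"
  proof (rule Bochner_Integration.integrable_bound)
    show "integrable P (\<lambda>w. B * ((Y e w)\<^sup>2 + 1))" by simp
    show "AE w in P. norm (Y e w * \<Phi> (x w)) \<le> norm (B * ((Y e w)\<^sup>2 + 1))"
    proof (rule AE_I2)
      fix w
      have B0: "0 \<le> B" using b1[of "x w"] by linarith
      have "2 * \<bar>Y e w\<bar> \<le> (Y e w)\<^sup>2 + 1" using sum_squares_bound[of "\<bar>Y e w\<bar>" 1] by simp
      then have y: "\<bar>Y e w\<bar> \<le> (Y e w)\<^sup>2 + 1" by linarith
      have "\<bar>Y e w\<bar> * \<bar>\<Phi> (x w)\<bar> \<le> ((Y e w)\<^sup>2 + 1) * B" by (intro mult_mono y b1) auto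
      then show "norm (Y e w * \<Phi> (x w)) \<le> norm (B * ((Y e w)\<^sup>2 + 1))"
        using B0 by (simp add: abs_mult mult.commute)
    qed
    have "(\<lambda>w. Y e w * \<Phi> (tl (seq w))) \<in> borel_measurable P" by measurable
    then show "(\<lambda>w. Y e w * \<Phi> (x w)) \<in> borel_measurable P" by (simp add: seq)
  qed
  have i2: "integrable P (\<lambda>w. \<Phi>' (tl (seq w)))"
    by (rule integrable_const_bound[where B = B]) (use b2 in auto)
  have "(\<integral>w. Y e w * \<Phi> (x w) \<partial>P) = (\<integral>w. (seq w 0) * \<Phi> (tl (seq w)) \<partial>P)" by (simp add: seq)
  also have "\<dots> = (\<integral>w. \<integral>y. spl (y, w) 0 * \<Phi> (tl (spl (y, w))) \<partial>?S \<partial>P)"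
    by (rule split(2)[of "\<lambda>y. y 0 * \<Phi> (tl y)"]) (use i1 in \<open>simp_all add: seq\<close>)
  also have "\<dots> = (\<integral>w. \<integral>y. \<Phi>' (tl (spl (y, w))) \<partial>?S \<partial>P)"
  proof (rule Bochner_Integration.integral_cong[OF refl])
    fix w
    define a where "a i = inner (h i) e" for i
    define z where "z i = Y (h i) w - inner (h i) e * Y e w" for i
    define l where "l t = (\<lambda>i. a i * t + z i)" for t
    have sl: "spl (y, w) 0 = y" "tl (spl (y, w)) = l y" for y
      by (auto simp: spl_def split_along_def gs_def ee tl_def l_def a_def z_def)
    have df: "((\<lambda>t. f (l t)) has_real_derivative Df (l t)) (at t)" for t
      using schwartz_line_derivative[OF f, of a z t] by (simp add: l_def Df_def a_def)
    have dg: "((\<lambda>t. g (l t)) has_real_derivative Dg (l t)) (at t)" for t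
      using schwartz_line_derivative[OF g, of a z t] by (simp add: l_def Dg_def a_def)
    have cl: "continuous_on UNIV l"
      unfolding l_def by (intro continuous_on_coordinatewise_then_product continuous_intros)
    have "(\<integral>y. y * \<Phi> (l y) \<partial>?S) = (\<integral>y. \<Phi>' (l y) \<partial>?S)"
    proof (rule stein_std_normal[where C = B])
      show "((\<lambda>y. \<Phi> (l y)) has_real_derivative \<Phi>' (l y)) (at y)" for y
        unfolding \<Phi>_def \<Phi>'_def
        by (rule DERIV_cong[OF DERIV_mult[OF dg DERIV_chain2[OF \<psi>(1) df]]]) (simp add: algebra_simps)
      have "continuous_on UNIV \<Phi>'" unfolding \<Phi>'_def
        by (intro continuous_intros cDg cDf schwartz_continuous[OF f] schwartz_continuous[OF g]
            continuous_on_compose2[OF cont\<psi>] continuous_on_compose2[OF \<psi>(2)]) auto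
      then show "continuous_on UNIV (\<lambda>y. \<Phi>' (l y))"
        by (rule continuous_on_compose2[OF _ cl]) auto
    qed (use b1 b2 in auto)
    then show "(\<integral>y. spl (y, w) 0 * \<Phi> (tl (spl (y, w))) \<partial>?S)
        = (\<integral>y. \<Phi>' (tl (spl (y, w))) \<partial>?S)" by (simp add: sl)
  qed
  also have "\<dots> = (\<integral>w. \<Phi>' (tl (seq w)) \<partial>P)"
    by (rule split(2)[of "\<lambda>y. \<Phi>' (tl y)", symmetric]) (use i2 in simp_all)
  finally show ?thesis by (simp add: seq \<Phi>_def \<Phi>'_def Dg_def Df_def)
qed

end

text \<open>Gradients are measurable with values in a separable Hilbert space.\<close>

locale isonormal_hilbert = isonormal_process P Y
  for P :: "'a measure" and Y :: "'h::{real_inner, banach, second_countable_topology} \<Rightarrow> 'a \<Rightarrow> real"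
begin

lemma cylindrical_measurable_bounded:
  assumes "cylindrical Y h F A"
  shows "F \<in> borel_measurable P" "A \<in> borel_measurable P" "\<exists>C. \<forall>w. \<bar>F w\<bar> \<le> C" "\<exists>C. \<forall>w. norm (A w) \<le> C"
proof -
  obtain n f where f: "schwartz n f" and F: "F = (\<lambda>w. f (\<lambda>i. Y (h i) w))"
    and A: "A = (\<lambda>w. \<Sum>i<n. pderiv_at i f (\<lambda>j. Y (h j) w) *\<^sub>R h i)"
    using assms unfolding cylindrical_def by blast
  note x = measurable_sequence[of h]
  show "F \<in> borel_measurable P" unfolding F by (rule measurable_compose[OF x schwartz_measurable[OF f]])
  show "A \<in> borel_measurable P" unfolding A
    by (intro borel_measurable_sum borel_measurable_scaleR borel_measurable_const
        measurable_compose[OF x schwartz_measurable[OF schwartz_pderiv[OF f]]]) simp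
  show "\<exists>C. \<forall>w. \<bar>F w\<bar> \<le> C" unfolding F using schwartz_bounded[OF f] by blast
  obtain K where K: "\<And>i x. i < n \<Longrightarrow> \<bar>pderiv_at i f x\<bar> \<le> K" using schwartz_pderiv_bounded[OF f] by blast
  have "norm (A w) \<le> (\<Sum>i<n. K * norm (h i))" for w
    unfolding A by (rule sum_norm_le) (auto intro!: mult_right_mono K)
  then show "\<exists>C. \<forall>w. norm (A w) \<le> C" by blast
qed

lemma square_integrable_of_approximation:
  fixes U :: "'a \<Rightarrow> 'b::{real_normed_vector, second_countable_topology}"
  assumes [measurable]: "U \<in> borel_measurable P" "\<And>k. Uk k \<in> borel_measurable P"
    and b: "\<And>k. \<exists>C. \<forall>w. norm (Uk k w) \<le> C"
    and lim: "(\<lambda>k. \<integral>\<^sup>+w. ennreal ((norm (Uk k w - U w))\<^sup>2) \<partial>P) \<longlonglongrightarrow> 0"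
  shows "integrable P (\<lambda>w. (norm (U w))\<^sup>2)"
proof -
  have "\<forall>\<^sub>F k in sequentially. (\<integral>\<^sup>+w. ennreal ((norm (Uk k w - U w))\<^sup>2) \<partial>P) < 1"
    by (rule order_tendstoD(2)[OF lim]) simp
  then obtain k where k: "(\<integral>\<^sup>+w. ennreal ((norm (Uk k w - U w))\<^sup>2) \<partial>P) < 1"
    unfolding eventually_sequentially by blast
  obtain C where C: "\<And>w. norm (Uk k w) \<le> C" using b by blast
  have i: "integrable P (\<lambda>w. (norm (Uk k w - U w))\<^sup>2)"
    by (rule integrableI_nonneg) (use k in \<open>auto intro: order_less_trans\<close>)
  show ?thesis
  proof (rule Bochner_Integration.integrable_bound)
    show "integrable P (\<lambda>w. 2 * (norm (Uk k w - U w))\<^sup>2 + 2 * C\<^sup>2)" using i by simp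
    have "(norm (U w))\<^sup>2 \<le> 2 * (norm (Uk k w - U w))\<^sup>2 + 2 * C\<^sup>2" for w
    proof -
      have "(norm (U w))\<^sup>2 \<le> 2 * (norm (U w - Uk k w))\<^sup>2 + 2 * (norm (Uk k w))\<^sup>2"
        using square_norm_add_le[of "U w - Uk k w" "Uk k w"] by simp
      moreover have "(norm (Uk k w))\<^sup>2 \<le> C\<^sup>2" by (intro power_mono C) simp
      ultimately show ?thesis by (simp add: norm_minus_commute)
    qed
    then show "AE w in P. norm ((norm (U w))\<^sup>2) \<le> norm (2 * (norm (Uk k w - U w))\<^sup>2 + 2 * C\<^sup>2)" by simp
  qed simp
qed

lemma is_nabla_square_integrable:
  assumes "is_nabla P Y h F A"
  shows "F \<in> borel_measurable P" "A \<in> borel_measurable P"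
    "integrable P (\<lambda>w. (F w)\<^sup>2)" "integrable P (\<lambda>w. (norm (A w))\<^sup>2)"
proof -
  show [measurable]: "F \<in> borel_measurable P" "A \<in> borel_measurable P"
    using assms by (auto simp: is_nabla_def)
  obtain Fk Ak where cyl: "\<And>k::nat. cylindrical Y h (Fk k) (Ak k)"
    and lF: "(\<lambda>k. \<integral>\<^sup>+w. ennreal ((Fk k w - F w)\<^sup>2) \<partial>P) \<longlonglongrightarrow> 0"
    and lA: "(\<lambda>k. \<integral>\<^sup>+w. ennreal ((norm (Ak k w - A w))\<^sup>2) \<partial>P) \<longlonglongrightarrow> 0"
    using assms unfolding is_nabla_def by blast
  note c = cylindrical_measurable_bounded[OF cyl]
  show "integrable P (\<lambda>w. (F w)\<^sup>2)"
    using square_integrable_of_approximation[of F Fk] c lF by simp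
  show "integrable P (\<lambda>w. (norm (A w))\<^sup>2)"
    by (rule square_integrable_of_approximation[of A Ak]) (use c lA in auto)
qed

text \<open>By linearity of both sides in \<open>e\<close>, unit vectors suffice.\<close>

lemma ibp_cylindrical:
  assumes F: "cylindrical Y h F A" and G: "cylindrical Y h G B"
    and \<psi>: "\<And>x. (\<psi> has_real_derivative \<psi>' x) (at x)" "continuous_on UNIV \<psi>'"
    and C: "\<And>x. \<bar>\<psi> x\<bar> \<le> C" "\<And>x. \<bar>\<psi>' x\<bar> \<le> C"
  shows "(\<integral>w. Y e w * (G w * \<psi> (F w)) \<partial>P)
    = (\<integral>w. inner (B w) e * \<psi> (F w) + G w * (\<psi>' (F w) * inner (A w) e) \<partial>P)"
proof -
  have c\<psi>: "continuous_on UNIV \<psi>" using \<psi>(1) by (intro DERIV_continuous_on) auto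
  note [measurable] = cylindrical_measurable_bounded(1,2)[OF F] cylindrical_measurable_bounded(1,2)[OF G]
    borel_measurable_continuous_onI[OF c\<psi>]
  show ?thesis
  proof (cases "e = 0")
    case True
    have "(\<integral>w. Y 0 w * (G w * \<psi> (F w)) \<partial>P) = (\<integral>w. 0 \<partial>P)"
      by (rule integral_cong_AE) (use Y_zero in auto)
    then show ?thesis using True by simp
  next
    case False
    define r where "r = norm e"
    define e1 where "e1 = (1 / r) *\<^sub>R e"
    have r: "r > 0" using False by (simp add: r_def)
    have e1: "norm e1 = 1" using r by (simp add: e1_def r_def)
    have e: "e = 0 + r *\<^sub>R e1" using r by (simp add: e1_def)
    have Ye: "AE w in P. Y e w = r * Y e1 w"
      using Y_add_scaleR[of 0 r e1] Y_zero unfolding e[symmetric] by eventually_elim simp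
    obtain n f where f: "schwartz n f" and F: "F = (\<lambda>w. f (\<lambda>i. Y (h i) w))"
      and A: "A = (\<lambda>w. \<Sum>i<n. pderiv_at i f (\<lambda>j. Y (h j) w) *\<^sub>R h i)"
      using F unfolding cylindrical_def by blast
    obtain m g where g: "schwartz m g" and G: "G = (\<lambda>w. g (\<lambda>i. Y (h i) w))"
      and B: "B = (\<lambda>w. \<Sum>i<m. pderiv_at i g (\<lambda>j. Y (h j) w) *\<^sub>R h i)"
      using G unfolding cylindrical_def by blast
    have i: "inner (A w) e = r * (\<Sum>k<n. inner (h k) e1 * pderiv_at k f (\<lambda>j. Y (h j) w))"
      "inner (B w) e = r * (\<Sum>k<m. inner (h k) e1 * pderiv_at k g (\<lambda>j. Y (h j) w))" for w
      unfolding A B e[simplified] by (simp_all add: inner_sum_left sum_distrib_left mult_ac)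
    have "(\<integral>w. Y e w * (G w * \<psi> (F w)) \<partial>P) = (\<integral>w. r * (Y e1 w * (G w * \<psi> (F w))) \<partial>P)"
      by (rule integral_cong_AE) (use Ye in auto)
    also have "\<dots> = r * (\<integral>w. Y e1 w * (G w * \<psi> (F w)) \<partial>P)" by simp
    also have "\<dots> = (\<integral>w. inner (B w) e * \<psi> (F w) + G w * (\<psi>' (F w) * inner (A w) e) \<partial>P)"
      unfolding i unfolding F G ibp_schwartz_unit[OF e1 f g \<psi> C] integral_mult_right_zero[symmetric]
      by (simp add: algebra_simps)
    finally show ?thesis .
  qed
qed

text \<open>
  The function \<open>\<psi>\<close> stays inside the statement because \<open>\<psi>(F)\<close> times \<open>G\<close> need not belong to the domain of
  the gradient: \<open>G\<close> may be unbounded, and then its product with \<open>\<nabla>F\<close> is only integrable.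
\<close>

theorem ibp_is_nabla:
  assumes F: "is_nabla P Y h F A" and G: "is_nabla P Y h G B"
    and \<psi>: "\<And>x. (\<psi> has_real_derivative \<psi>' x) (at x)" "continuous_on UNIV \<psi>'"
    and C: "\<And>x. \<bar>\<psi> x\<bar> \<le> C" "\<And>x. \<bar>\<psi>' x\<bar> \<le> C"
  shows "integrable P (\<lambda>w. Y e w * (G w * \<psi> (F w)))"
    and "integrable P (\<lambda>w. inner (B w) e * \<psi> (F w))"
    and "integrable P (\<lambda>w. G w * (\<psi>' (F w) * inner (A w) e))"
    and "(\<integral>w. Y e w * (G w * \<psi> (F w)) \<partial>P)
      = (\<integral>w. inner (B w) e * \<psi> (F w) \<partial>P) + (\<integral>w. G w * (\<psi>' (F w) * inner (A w) e) \<partial>P)"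
proof -
  have c\<psi>: "continuous_on UNIV \<psi>" using \<psi>(1) by (intro DERIV_continuous_on) auto
  note [measurable] = is_nabla_square_integrable(1,2)[OF F] is_nabla_square_integrable(1,2)[OF G]
    borel_measurable_continuous_onI[OF c\<psi>] borel_measurable_continuous_onI[OF \<psi>(2)]
  note sq[simp] = is_nabla_square_integrable(3,4)[OF F] is_nabla_square_integrable(3,4)[OF G]
  have C0: "0 \<le> C" using C(1)[of 0] by linarith
  note ab = abs_mult_le_squares
  \<comment> \<open>One majorant serves all three terms.\<close>
  define q0 where "q0 y g a b = y\<^sup>2 + g\<^sup>2 + (norm e)\<^sup>2 * (norm a)\<^sup>2 + (norm b)\<^sup>2 + (norm e)\<^sup>2"
    for y g :: real and a b :: 'h
  define q where "q y g a b = C * q0 y g a b" for y g a b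
  have q_le: "z * p \<le> q y g a b" if "0 \<le> p" "p \<le> C" "z \<le> q0 y g a b"
    for z p y g :: real and a b :: 'h
    using mult_mono[OF that(3,2) _ that(1)] unfolding q_def q0_def by (simp add: mult.commute)
  have nn: "0 \<le> y\<^sup>2" "0 \<le> (norm e)\<^sup>2 * (norm a)\<^sup>2" "0 \<le> (norm a)\<^sup>2" for y :: real and a :: 'h by simp_all
  have b1: "\<bar>y * (g * p)\<bar> \<le> q y g a b" if "\<bar>p\<bar> \<le> C" for y g p a b
  proof -
    have "\<bar>y * g\<bar> \<le> q0 y g a b"
      using ab[of y g] nn(2)[of a] nn(3)[of b] nn(3)[of e] unfolding q0_def by linarith
    from q_le[OF abs_ge_zero that this] show ?thesis by (simp add: abs_mult mult.assoc)
  qed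
  have b2: "\<bar>inner b e * p\<bar> \<le> q y g a b" if "\<bar>p\<bar> \<le> C" for y g p a b
  proof -
    have "\<bar>inner b e\<bar> \<le> q0 y g a b"
      using Cauchy_Schwarz_ineq2[of b e] ab[of "norm b" "norm e"] nn(1)[of y] nn(1)[of g] nn(2)[of a]
        abs_ge_self[of "norm b * norm e"] unfolding q0_def by linarith
    from q_le[OF abs_ge_zero that this] show ?thesis by (simp add: abs_mult)
  qed
  have b3: "\<bar>g * (p * inner a e)\<bar> \<le> q y g a b" if "\<bar>p\<bar> \<le> C" for y g p a b
  proof -
    have "(inner a e)\<^sup>2 \<le> (norm e)\<^sup>2 * (norm a)\<^sup>2"
      using Cauchy_Schwarz_ineq[of a e] by (simp add: power2_norm_eq_inner mult.commute)
    then have "\<bar>g * inner a e\<bar> \<le> q0 y g a b"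
      using ab[of g "inner a e"] nn(1)[of y] nn(3)[of b] nn(3)[of e] unfolding q0_def by linarith
    from q_le[OF abs_ge_zero that this] show ?thesis by (simp add: abs_mult mult_ac)
  qed
  have int: "integrable P f" if [measurable]: "f \<in> borel_measurable P" "g \<in> borel_measurable P"
      and sq[simp]: "integrable P (\<lambda>w. (g w)\<^sup>2)" "integrable P (\<lambda>w. (norm (a w))\<^sup>2)" "integrable P (\<lambda>w. (norm (b w))\<^sup>2)"
      and le: "\<And>w. \<bar>f w\<bar> \<le> q (Y e w) (g w) (a w) (b w)" for f g a b
  proof (rule Bochner_Integration.integrable_bound)
    show "integrable P (\<lambda>w. q (Y e w) (g w) (a w) (b w))" unfolding q_def q0_def by simp
    show "AE w in P. norm (f w) \<le> norm (q (Y e w) (g w) (a w) (b w))"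
      using le by (intro AE_I2) (simp add: order_trans[OF _ abs_ge_self])
  qed simp
  obtain Fk Ak where cF: "\<And>k::nat. cylindrical Y h (Fk k) (Ak k)"
    and lF: "(\<lambda>k. \<integral>\<^sup>+w. ennreal ((Fk k w - F w)\<^sup>2) \<partial>P) \<longlonglongrightarrow> 0"
    and lA: "(\<lambda>k. \<integral>\<^sup>+w. ennreal ((norm (Ak k w - A w))\<^sup>2) \<partial>P) \<longlonglongrightarrow> 0"
    using F unfolding is_nabla_def by blast
  obtain Gk Bk where cG: "\<And>k::nat. cylindrical Y h (Gk k) (Bk k)"
    and lG: "(\<lambda>k. \<integral>\<^sup>+w. ennreal ((Gk k w - G w)\<^sup>2) \<partial>P) \<longlonglongrightarrow> 0"
    and lB: "(\<lambda>k. \<integral>\<^sup>+w. ennreal ((norm (Bk k w - B w))\<^sup>2) \<partial>P) \<longlonglongrightarrow> 0"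
    using G unfolding is_nabla_def by blast
  note [measurable] = cylindrical_measurable_bounded(1,2)[OF cF] cylindrical_measurable_bounded(1,2)[OF cG]
  \<comment> \<open>One sequence controls all four approximation errors, so that a single selection of indices works.\<close>
  define d where "d k w = (Fk k w - F w)\<^sup>2 + (norm (Ak k w - A w))\<^sup>2
     + ((Gk k w - G w)\<^sup>2 + (norm (Bk k w - B w))\<^sup>2)" for k w
  have "(\<lambda>k. (\<integral>\<^sup>+w. ennreal ((Fk k w - F w)\<^sup>2) \<partial>P) + (\<integral>\<^sup>+w. ennreal ((norm (Ak k w - A w))\<^sup>2) \<partial>P)
     + ((\<integral>\<^sup>+w. ennreal ((Gk k w - G w)\<^sup>2) \<partial>P) + (\<integral>\<^sup>+w. ennreal ((norm (Bk k w - B w))\<^sup>2) \<partial>P)))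
     \<longlonglongrightarrow> 0 + 0 + (0 + 0)"
    by (intro tendsto_add lF lA lG lB)
  then have "(\<lambda>k. \<integral>\<^sup>+w. ennreal (d k w) \<partial>P) \<longlonglongrightarrow> 0"
    by (simp add: d_def nn_integral_add)
  then obtain r S where iS[simp]: "integrable P S" and d0: "AE w in P. (\<lambda>k. d (r k) w) \<longlonglongrightarrow> 0"
    and dS: "AE w in P. \<forall>k. d (r k) w \<le> S w"
    by (rule rapid_subsequence[rotated 2]) (auto simp: d_def)
  have d: "(Fk k w - F w)\<^sup>2 \<le> d k w" "(norm (Ak k w - A w))\<^sup>2 \<le> d k w"
    "(Gk k w - G w)\<^sup>2 \<le> d k w" "(norm (Bk k w - B w))\<^sup>2 \<le> d k w" for k w
    by (simp_all add: d_def)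
  have conv: "AE w in P. (\<lambda>k. Fk (r k) w) \<longlonglongrightarrow> F w \<and> (\<lambda>k. Ak (r k) w) \<longlonglongrightarrow> A w
      \<and> (\<lambda>k. Gk (r k) w) \<longlonglongrightarrow> G w \<and> (\<lambda>k. Bk (r k) w) \<longlonglongrightarrow> B w"
    using d0 by eventually_elim (intro conjI; rule tendsto_of_square_bound, assumption, simp add: d)
  have dom: "AE w in P. \<forall>k. (Gk (r k) w)\<^sup>2 \<le> 2 * S w + 2 * (G w)\<^sup>2
     \<and> (norm (Ak (r k) w))\<^sup>2 \<le> 2 * S w + 2 * (norm (A w))\<^sup>2
     \<and> (norm (Bk (r k) w))\<^sup>2 \<le> 2 * S w + 2 * (norm (B w))\<^sup>2"
    using dS
  proof eventually_elim
    case (elim w)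
    have tri: "(norm x)\<^sup>2 \<le> 2 * S w + 2 * (norm y)\<^sup>2" if "(norm (x - y))\<^sup>2 \<le> d (r k) w" for x y :: "'x::real_normed_vector" and k
      using square_norm_add_le[of "x - y" y] that elim[rule_format, of k] by simp
    show ?case
      using tri[OF d(2)] tri[OF d(4)] tri[of "Gk (r k) w" "G w" k for k] d(3) by simp
  qed
  have lim\<psi>: "(\<lambda>k. p (Fk (r k) w)) \<longlonglongrightarrow> p (F w)"
    if "continuous_on UNIV p" "(\<lambda>k. Fk (r k) w) \<longlonglongrightarrow> F w" for p :: "real \<Rightarrow> real" and w
    using that by (intro continuous_on_tendsto_compose[OF that]) auto
  show "integrable P (\<lambda>w. Y e w * (G w * \<psi> (F w)))"
    by (rule int[OF _ _ sq(3,2,4)]) (use b1[OF C(1)] in auto)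
  show "integrable P (\<lambda>w. inner (B w) e * \<psi> (F w))"
    by (rule int[OF _ _ sq(3,2,4)]) (use b2[OF C(1)] in auto)
  show "integrable P (\<lambda>w. G w * (\<psi>' (F w) * inner (A w) e))"
    by (rule int[OF _ _ sq(3,2,4)]) (use b3[OF C(2)] in auto)
  have L: "(\<lambda>k. \<integral>w. f k w \<partial>P) \<longlonglongrightarrow> (\<integral>w. f0 w \<partial>P)"
    if [measurable]: "f0 \<in> borel_measurable P" "\<And>k. f k \<in> borel_measurable P"
      and lim: "AE w in P. (\<lambda>k. f k w) \<longlonglongrightarrow> f0 w"
      and le: "\<And>k w. \<bar>f k w\<bar> \<le> q (Y e w) (Gk (r k) w) (Ak (r k) w) (Bk (r k) w)" for f f0
  proof (rule integral_dominated_convergence[OF _ _ _ lim])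
    let ?w = "\<lambda>w. C * ((Y e w)\<^sup>2 + (2 * S w + 2 * (G w)\<^sup>2) + (norm e)\<^sup>2 * (2 * S w + 2 * (norm (A w))\<^sup>2)
      + (2 * S w + 2 * (norm (B w))\<^sup>2) + (norm e)\<^sup>2)"
    show "integrable P ?w" by simp
    show "AE w in P. norm (f k w) \<le> ?w w" for k
      using dom
    proof eventually_elim
      case (elim w)
      have "norm (f k w) \<le> q (Y e w) (Gk (r k) w) (Ak (r k) w) (Bk (r k) w)" using le by simp
      also have "\<dots> \<le> ?w w" unfolding q_def q0_def using elim by (intro mult_left_mono add_mono order_refl C0) auto
      finally show ?case .
    qed
  qed auto
  have L1: "(\<lambda>k. \<integral>w. Y e w * (Gk (r k) w * \<psi> (Fk (r k) w)) \<partial>P) \<longlonglongrightarrow> (\<integral>w. Y e w * (G w * \<psi> (F w)) \<partial>P)"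
    by (rule L[OF _ _ eventually_mono[OF conv]]) (use b1[OF C(1)] in \<open>auto intro!: tendsto_intros lim\<psi>[OF c\<psi>]\<close>)
  have L2: "(\<lambda>k. \<integral>w. inner (Bk (r k) w) e * \<psi> (Fk (r k) w) \<partial>P) \<longlonglongrightarrow> (\<integral>w. inner (B w) e * \<psi> (F w) \<partial>P)"
    by (rule L[OF _ _ eventually_mono[OF conv]]) (use b2[OF C(1)] in \<open>auto intro!: tendsto_intros lim\<psi>[OF c\<psi>]\<close>)
  have L3: "(\<lambda>k. \<integral>w. Gk (r k) w * (\<psi>' (Fk (r k) w) * inner (Ak (r k) w) e) \<partial>P)
      \<longlonglongrightarrow> (\<integral>w. G w * (\<psi>' (F w) * inner (A w) e) \<partial>P)"
    by (rule L[OF _ _ eventually_mono[OF conv]]) (use b3[OF C(2)] in \<open>auto intro!: tendsto_intros lim\<psi>[OF \<psi>(2)]\<close>)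
  have "(\<integral>w. Y e w * (Gk k w * \<psi> (Fk k w)) \<partial>P)
      = (\<integral>w. inner (Bk k w) e * \<psi> (Fk k w) \<partial>P) + (\<integral>w. Gk k w * (\<psi>' (Fk k w) * inner (Ak k w) e) \<partial>P)" for k
  proof -
    have bs: "integrable P (\<lambda>w. (norm (U w))\<^sup>2)"
      if [measurable]: "U \<in> borel_measurable P" and b: "\<exists>K. \<forall>w. norm (U w) \<le> K"
      for U :: "'a \<Rightarrow> 'x::{real_normed_vector, second_countable_topology}"
      by (rule square_integrable_of_approximation[of U "\<lambda>_. U"]) (use b in auto)
    have s[simp]: "integrable P (\<lambda>w. (Gk k w)\<^sup>2)" "integrable P (\<lambda>w. (norm (Ak k w))\<^sup>2)" "integrable P (\<lambda>w. (norm (Bk k w))\<^sup>2)"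
      using bs[of "Gk k"] bs[of "Ak k"] bs[of "Bk k"] cylindrical_measurable_bounded(3,4)[OF cG]
        cylindrical_measurable_bounded(4)[OF cF] by simp_all
    have "integrable P (\<lambda>w. inner (Bk k w) e * \<psi> (Fk k w))"
      by (rule int[OF _ _ s]) (use b2[OF C(1)] in auto)
    moreover have "integrable P (\<lambda>w. Gk k w * (\<psi>' (Fk k w) * inner (Ak k w) e))"
      by (rule int[OF _ _ s]) (use b3[OF C(2)] in auto)
    ultimately show ?thesis by (simp add: ibp_cylindrical[OF cF cG \<psi> C])
  qed
  then have "(\<lambda>k. \<integral>w. Y e w * (Gk (r k) w * \<psi> (Fk (r k) w)) \<partial>P)
     \<longlonglongrightarrow> (\<integral>w. inner (B w) e * \<psi> (F w) \<partial>P) + (\<integral>w. G w * (\<psi>' (F w) * inner (A w) e) \<partial>P)"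
    using tendsto_add[OF L2 L3] by simp
  with L1 show "(\<integral>w. Y e w * (G w * \<psi> (F w)) \<partial>P)
      = (\<integral>w. inner (B w) e * \<psi> (F w) \<partial>P) + (\<integral>w. G w * (\<psi>' (F w) * inner (A w) e) \<partial>P)"
    by (rule LIMSEQ_unique)
qed

end

section \<open>Hilbert space and measurability tools\<close>

lemma AE_zero_of_pi_system:
  fixes f :: "'a \<Rightarrow> real"
  assumes f[measurable]: "integrable M f" and E: "Int_stable E" "E \<subseteq> Pow (space M)" "sets M = sigma_sets (space M) E"
    and total: "(\<integral>x. f x \<partial>M) = 0" and basic: "\<And>A. A \<in> E \<Longrightarrow> (\<integral>x. indicator A x * f x \<partial>M) = 0"
  shows "AE x in M. f x = 0"
proof -
  have z: "(\<integral>x\<in>A. f x \<partial>M) = 0" if "A \<in> sigma_sets (space M) E" for A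
    using E(1,2) that
  proof (induction rule: sigma_sets_induct_disjoint)
    case (basic A)
    then show ?case using assms(6) by (simp add: set_lebesgue_integral_def)
  next
    case empty
    then show ?case by (simp add: set_lebesgue_integral_def)
  next
    case (compl A)
    then have [measurable]: "A \<in> sets M" using E(3) by simp
    have i: "integrable M (\<lambda>x. indicator A x *\<^sub>R f x)" by (rule integrable_mult_indicator) (use f in auto)
    have "(\<integral>x\<in>space M - A. f x \<partial>M) = (\<integral>x. f x - indicator A x *\<^sub>R f x \<partial>M)"
      unfolding set_lebesgue_integral_def by (rule Bochner_Integration.integral_cong) (auto split: split_indicator)
    also have "\<dots> = 0" using f i compl total by (simp add: set_lebesgue_integral_def)
    finally show ?case .
  next
    case (union A)
    then have m: "\<And>i. A i \<in> sets M" using E(3) by auto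
    have "(\<integral>x\<in>(\<Union>i. A i). f x \<partial>M) = (\<Sum>i. \<integral>x\<in>A i. f x \<partial>M)"
    proof (rule lebesgue_integral_countable_add[OF m])
      show "A i \<inter> A j = {}" if "i \<noteq> j" for i j using union(1) that by (auto simp: disjoint_family_on_def)
      show "set_integrable M (\<Union>i. A i) f" unfolding set_integrable_def
        by (rule integrable_mult_indicator) (use m f in auto)
    qed
    then show ?case using union by simp
  qed
  show ?thesis
    using density_unique_real[OF f, of "\<lambda>_. 0"] z E(3) by (simp add: set_lebesgue_integral_def)
qed

text \<open>
  The representing vector minimizes \<open>\<parallel>x\<parallel>\<^sup>2 - 2 L x\<close>. Minimizing sequences are Cauchy by the
  parallelogram identity.
\<close>

lemma riesz_representation:
  fixes L :: "'h::{real_inner, banach} \<Rightarrow> real"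
  assumes L: "bounded_linear L"
  shows "\<exists>a. \<forall>g. L g = inner a g"
proof -
  interpret bounded_linear L by (rule L)
  obtain K where K: "\<And>x. norm (L x) \<le> norm x * K" using bounded by blast
  define J where "J x = (norm x)\<^sup>2 - 2 * L x" for x
  have below: "- K\<^sup>2 \<le> J x" for x
  proof -
    have "0 \<le> (norm x - K)\<^sup>2" by simp
    moreover have "L x \<le> norm x * K" using K[of x] by simp
    ultimately show ?thesis by (simp add: J_def power2_diff)
  qed
  define m where "m = (INF x. J x)"
  have bdd: "bdd_below (range J)" using below by (auto intro!: bdd_belowI)
  have m: "m \<le> J x" for x unfolding m_def by (rule cINF_lower[OF bdd]) simp
  have "\<exists>x. J x < m + 1 / Suc n" for n
  proof (rule ccontr)
    assume "\<not> ?thesis"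
    then have "m + 1 / Suc n \<le> (INF x. J x)" by (intro cINF_greatest) (auto simp: not_less)
    then show False by (simp add: m_def)
  qed
  then obtain x where x: "\<And>n. J (x n) < m + 1 / Suc n" by metis
  have par: "(norm (y - z))\<^sup>2 = 2 * J y + 2 * J z - 4 * J ((1/2) *\<^sub>R (y + z))" for y z
    unfolding J_def power2_norm_eq_inner
    by (simp add: scaleR add inner_add_left inner_add_right inner_diff_left inner_diff_right inner_commute algebra_simps)
  have gap: "(norm (x i - x j))\<^sup>2 \<le> 2 / Suc i + 2 / Suc j" for i j
    unfolding par using x[of i] x[of j] m[of "(1/2) *\<^sub>R (x i + x j)"] by simp
  have "Cauchy x"
  proof (rule CauchyI)
    fix \<epsilon> :: real assume \<epsilon>: "0 < \<epsilon>"
    obtain N :: nat where N: "4 / \<epsilon>\<^sup>2 < real N" using reals_Archimedean2 by blast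
    have "norm (x i - x j) < \<epsilon>" if "N \<le> i" "N \<le> j" for i j
    proof -
      have Np: "0 < real N" using N \<epsilon> by (smt (verit) divide_pos_pos zero_less_power)
      have "2 / Suc i \<le> 2 / N" "2 / Suc j \<le> 2 / N" using that Np by (auto intro!: divide_left_mono)
      then have "(norm (x i - x j))\<^sup>2 \<le> 4 / N" using gap[of i j] by simp
      also have "\<dots> < \<epsilon>\<^sup>2" using N \<epsilon> Np by (simp add: field_simps)
      finally show ?thesis using \<epsilon> by (simp add: power2_less_imp_less)
    qed
    then show "\<exists>M. \<forall>m\<ge>M. \<forall>n\<ge>M. norm (x m - x n) < \<epsilon>" by blast
  qed
  then obtain a where a: "x \<longlonglongrightarrow> a" using Cauchy_convergent convergent_def by blast
  have "(\<lambda>n. J (x n)) \<longlonglongrightarrow> J a" unfolding J_def by (intro tendsto_intros tendsto a)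
  moreover have "(\<lambda>n. m + 1 / Suc n) \<longlonglongrightarrow> m + 0" by (intro tendsto_add tendsto_const LIMSEQ_inverse_real_of_nat[unfolded inverse_eq_divide])
  ultimately have "J a \<le> m + 0" by (rule LIMSEQ_le) (use x in \<open>auto intro: less_imp_le\<close>)
  then have Ja: "J a \<le> m" by simp
  have "L g = inner a g" for g
  proof -
    define c where "c = inner a g - L g"
    define q where "q = (norm g)\<^sup>2"
    have q: "0 \<le> q" by (simp add: q_def)
    have quad: "0 \<le> 2 * s * c + s\<^sup>2 * q" for s
    proof -
      have "J a \<le> J (a + s *\<^sub>R g)" using Ja m[of "a + s *\<^sub>R g"] by simp
      then show ?thesis unfolding J_def power2_norm_eq_inner c_def q_def
        by (simp add: scaleR add inner_add_left inner_add_right inner_commute algebra_simps power2_eq_square)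
    qed
    \<comment> \<open>At this point the quadratic polynomial in \<open>s\<close> would be negative unless \<open>c = 0\<close>.\<close>
    have "0 \<le> 2 * (- c / (q + 1)) * c + (- c / (q + 1))\<^sup>2 * q" by (rule quad)
    also have "\<dots> = - (c\<^sup>2 * (q + 2) / (q + 1)\<^sup>2)"
      using q by (simp add: power2_eq_square divide_simps) (simp add: algebra_simps)
    finally have "c\<^sup>2 * (q + 2) / (q + 1)\<^sup>2 \<le> 0" by simp
    then have "c\<^sup>2 \<le> 0" using q by (simp add: divide_le_0_iff mult_le_0_iff)
    then show ?thesis by (simp add: c_def)
  qed
  then show ?thesis by blast
qed

text \<open>By Baire's theorem one of the closed sets of uniformly bounded arguments contains a ball.\<close>

lemma uniform_boundedness_inner:
  fixes e :: "'i \<Rightarrow> 'h::{real_inner, banach}"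
  assumes pw: "\<And>g. \<exists>B. \<forall>t\<in>I. \<bar>inner (e t) g\<bar> \<le> B"
  shows "\<exists>C. \<forall>t\<in>I. norm (e t) \<le> C"
proof -
  define A where "A n = {g. \<forall>t\<in>I. \<bar>inner (e t) g\<bar> \<le> real n}" for n :: nat
  have cl: "closed (A n)" for n
  proof -
    have "A n = (\<Inter>t\<in>I. {g. \<bar>inner (e t) g\<bar> \<le> real n})" by (auto simp: A_def)
    then show ?thesis by (auto intro!: closed_INT closed_Collect_le continuous_intros)
  qed
  have cover: "\<Union>(range A) = UNIV"
  proof (intro equalityI subsetI UNIV_I)
    fix g
    obtain B where B: "\<forall>t\<in>I. \<bar>inner (e t) g\<bar> \<le> B" using pw by blast
    obtain n :: nat where "B \<le> n" using real_arch_simple by blast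
    then have "g \<in> A n" using B by (auto simp: A_def intro: order_trans)
    then show "g \<in> \<Union>(range A)" by blast
  qed
  have "\<exists>n. interior (A n) \<noteq> {}"
  proof (rule ccontr)
    assume "\<not> ?thesis"
    then have "Met_TC.mtopology interior_of \<Union>(range A) = {}"
      by (intro Met_TC.metric_Baire_category_alt) (use cl complete_UNIV in auto)
    then show False using cover by simp
  qed
  then obtain n x r where r: "0 < r" "ball x r \<subseteq> A n" by (metis equals0I mem_interior)
  have "norm (e t) \<le> 4 * n / r" if t: "t \<in> I" for t
  proof (cases "e t = 0")
    case False
    define y where "y = (r / (2 * norm (e t))) *\<^sub>R e t"
    have "x + y \<in> ball x r" "x \<in> ball x r" using r False by (auto simp: y_def dist_norm)
    then have "x + y \<in> A n" "x \<in> A n" using r(2) by blast+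
    then have "\<bar>inner (e t) (x + y)\<bar> \<le> n" "\<bar>inner (e t) x\<bar> \<le> n" using t by (auto simp: A_def)
    then have "inner (e t) y \<le> 2 * n" by (simp add: inner_add_right)
    moreover have "inner (e t) y = r * norm (e t) / 2"
      using False by (simp add: y_def dot_square_norm power2_eq_square)
    ultimately show ?thesis using r(1) by (simp add: field_simps)
  qed (use r in simp)
  then show ?thesis by blast
qed

lemma inner_zero_on_dense:
  fixes x :: "'h::real_inner"
  assumes "closure (span D) = UNIV" "\<And>d. d \<in> D \<Longrightarrow> inner x d = 0"
  shows "x = 0"
proof -
  have "span D \<subseteq> {g. inner x g = 0}"
    by (rule span_minimal) (use assms(2) in \<open>auto simp: subspace_def inner_add_right\<close>)
  then have "closure (span D) \<subseteq> {g. inner x g = 0}"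
    by (rule closure_minimal) (intro closed_Collect_eq continuous_intros)
  then have "x \<in> {g. inner x g = 0}" using assms(1) by blast
  then show ?thesis by simp
qed

lemma weakly_measurable_of_dense:
  fixes e :: "'b \<Rightarrow> 'h::real_inner"
  assumes D: "closure (span D) = UNIV" and m: "\<And>d. d \<in> D \<Longrightarrow> (\<lambda>t. inner (e t) d) \<in> borel_measurable N"
  shows "(\<lambda>t. inner (e t) g) \<in> borel_measurable N"
proof -
  have "span D \<subseteq> {g. (\<lambda>t. inner (e t) g) \<in> borel_measurable N}"
    by (rule span_minimal) (use m in \<open>auto simp: subspace_def inner_add_right\<close>)
  moreover obtain s where s: "\<And>n. s n \<in> span D" "s \<longlonglongrightarrow> g"
    using D closure_sequential[of g "span D"] by auto
  ultimately have "(\<lambda>t. inner (e t) (s n)) \<in> borel_measurable N" for n by blast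
  then show ?thesis
    by (rule borel_measurable_LIMSEQ_real[where u = "\<lambda>n t. inner (e t) (s n)", rotated])
       (intro tendsto_inner tendsto_const s(2))
qed

lemma dense_sequence:
  obtains d :: "nat \<Rightarrow> 'h::{metric_space, second_countable_topology}"
  where "\<And>x r. 0 < r \<Longrightarrow> \<exists>k. dist x (d k) < r"
proof -
  obtain D :: "'h set" where D: "countable D" "\<And>X. open X \<Longrightarrow> X \<noteq> {} \<Longrightarrow> \<exists>d\<in>D. d \<in> X"
    by (rule countable_dense_setE) blast
  have "D \<noteq> {}" using D(2)[of UNIV] by auto
  have "\<exists>k. dist x (from_nat_into D k) < r" if "0 < r" for x r
  proof -
    have "ball x r \<noteq> {}" using that by simp
    from D(2)[OF open_ball this] obtain y where "y \<in> D" "y \<in> ball x r" by blast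
    then show ?thesis using from_nat_into_surj[OF D(1)] by (metis mem_ball)
  qed
  then show thesis by (rule that)
qed

text \<open>
  Weak measurability implies measurability of the distance to a fixed point, because in a separable
  space the norm is determined by countably many scalar products.
\<close>

lemma measurable_norm_ball:
  fixes e :: "'b \<Rightarrow> 'h::{real_inner, second_countable_topology}"
  assumes [measurable]: "\<And>g. (\<lambda>t. inner (e t) g) \<in> borel_measurable N" and r: "0 \<le> r"
  shows "{t \<in> space N. norm (e t - x) \<le> r} \<in> sets N"
proof -
  obtain d :: "nat \<Rightarrow> 'h" where d: "\<And>x r. 0 < r \<Longrightarrow> \<exists>k. dist x (d k) < r" by (rule dense_sequence) blast
  have iff: "norm y \<le> r \<longleftrightarrow> (\<forall>k. inner y (d k) \<le> r * norm (d k))" for y :: 'h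
  proof
    assume "norm y \<le> r"
    then show "\<forall>k. inner y (d k) \<le> r * norm (d k)"
      by (meson mult_right_mono norm_cauchy_schwarz norm_ge_zero order_trans)
  next
    assume *: "\<forall>k. inner y (d k) \<le> r * norm (d k)"
    have "\<exists>k. dist y (d k) < 1 / Suc n" for n by (rule d) simp
    then obtain k where k: "\<And>n. dist y (d (k n)) < 1 / Suc n" by metis
    have "(\<lambda>n. d (k n)) \<longlonglongrightarrow> y"
    proof (rule metric_tendsto_imp_tendsto[of "\<lambda>n. 1 / Suc n" 0])
      show "(\<lambda>n. 1 / real (Suc n)) \<longlonglongrightarrow> 0" using LIMSEQ_inverse_real_of_nat by (simp add: inverse_eq_divide)
      show "\<forall>\<^sub>F n in sequentially. dist (d (k n)) y \<le> dist (1 / real (Suc n)) 0"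
        using k by (intro always_eventually allI) (simp add: dist_commute less_imp_le)
    qed
    then have "(\<lambda>n. inner y (d (k n))) \<longlonglongrightarrow> inner y y" "(\<lambda>n. r * norm (d (k n))) \<longlonglongrightarrow> r * norm y"
      by (auto intro!: tendsto_intros)
    then have "inner y y \<le> r * norm y" by (rule LIMSEQ_le) (use * in auto)
    then show "norm y \<le> r" using r by (cases "y = 0") (auto simp: dot_square_norm power2_eq_square)
  qed
  have "{t \<in> space N. norm (e t - x) \<le> r} = {t \<in> space N. \<forall>k. inner (e t) (d k) - inner x (d k) \<le> r * norm (d k)}"
    by (simp add: iff inner_diff_left)
  also have "\<dots> \<in> sets N" by measurable
  finally show ?thesis .
qed

text \<open>Each point is sent to the first element of a dense sequence that is close enough.\<close>

lemma countable_valued_approximation: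
  fixes e :: "'b \<Rightarrow> 'h::{real_normed_vector, second_countable_topology}"
  assumes ball: "\<And>r x. 0 \<le> r \<Longrightarrow> {t \<in> space N. norm (e t - x) \<le> r} \<in> sets N"
  shows "\<exists>(d :: nat \<Rightarrow> 'h) k. (\<forall>n::nat. k n \<in> measurable N (count_space UNIV)) \<and> (\<forall>n t. norm (e t - d (k n t)) \<le> (1/2) ^ n)"
proof -
  obtain d :: "nat \<Rightarrow> 'h" where d: "\<And>x r. 0 < r \<Longrightarrow> \<exists>k. dist x (d k) < r" by (rule dense_sequence) blast
  define k where "k n t = (LEAST k. norm (e t - d k) \<le> (1/2) ^ n)" for n :: nat and t
  have "norm (e t - d (k n t)) \<le> (1/2) ^ n" for n t
  proof -
    have "\<exists>k. norm (e t - d k) \<le> (1/2) ^ n" using d[of "(1/2) ^ n" "e t"] by (auto simp: dist_norm intro: less_imp_le)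
    then show ?thesis unfolding k_def by (rule LeastI_ex)
  qed
  moreover have [measurable]: "Measurable.pred N (\<lambda>t. norm (e t - d k) \<le> (1/2) ^ n)" for k and n :: nat
    unfolding pred_def by (rule ball) simp
  have "k n \<in> measurable N (count_space UNIV)" for n unfolding k_def[abs_def] by measurable
  ultimately show ?thesis by blast
qed

context isonormal_hilbert
begin

text \<open>
  For each \<open>t\<close> the variable \<open>Y (e t)\<close> is fixed only up to a null set, so joint measurability needs a
  choice. If \<open>e\<close> is approximated by functions with countably many values at distance at most \<open>2\<^sup>-\<^sup>n\<close>, the
  variances of the errors are summable, so that the approximations converge almost surely for every
  \<open>t\<close>.
\<close>

lemma measurable_version:
  assumes m: "\<And>g. (\<lambda>t. inner (e t) g) \<in> borel_measurable N"
  shows "\<exists>Z. (\<lambda>(w, t). Z t w) \<in> borel_measurable (P \<Otimes>\<^sub>M N) \<and> (\<forall>t\<in>space N. AE w in P. Z t w = Y (e t) w)"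
proof -
  obtain d k where [measurable]: "\<And>n::nat. k n \<in> measurable N (count_space (UNIV :: nat set))"
    and k: "\<And>n t. norm (e t - d (k n t)) \<le> (1/2) ^ n"
    using countable_valued_approximation[OF measurable_norm_ball[OF m]] by blast
  define Z where "Z t w = lim (\<lambda>n. Y (d (k n t)) w)" for t w
  have [measurable]: "(\<lambda>p. Y (d (k n (snd p))) (fst p)) \<in> borel_measurable (P \<Otimes>\<^sub>M N)" for n
    by (rule measurable_compose_countable[where f = "\<lambda>j p. Y (d j) (fst p)"]) measurable
  have "(\<lambda>p. Z (snd p) (fst p)) \<in> borel_measurable (P \<Otimes>\<^sub>M N)" unfolding Z_def by measurable
  moreover have "AE w in P. Z t w = Y (e t) w" for t
  proof -
    have le: "(\<integral>\<^sup>+w. ennreal ((Y (d (k n t)) w - Y (e t) w)\<^sup>2) \<partial>P) \<le> ennreal ((1/2) ^ n)" for n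
    proof -
      have "AE w in P. Y (d (k n t) + (-1) *\<^sub>R e t) w = Y (d (k n t)) w + (-1) * Y (e t) w" by (rule Y_add_scaleR)
      then have "(\<integral>\<^sup>+w. ennreal ((Y (d (k n t)) w - Y (e t) w)\<^sup>2) \<partial>P) = (\<integral>\<^sup>+w. ennreal ((Y (d (k n t) + (-1) *\<^sub>R e t) w)\<^sup>2) \<partial>P)"
        by (intro nn_integral_cong_AE) auto
      also have "\<dots> = ennreal ((norm (e t - d (k n t)))\<^sup>2)"
        by (subst nn_integral_eq_integral) (auto simp: expectation_Y_square norm_minus_commute)
      also have "\<dots> \<le> ennreal ((1/2) ^ n)"
      proof (rule ennreal_leI)
        have "(norm (e t - d (k n t)))\<^sup>2 \<le> ((1/2) ^ n)\<^sup>2" by (intro power_mono k) simp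
        also have "\<dots> \<le> (1/2) ^ n * 1" unfolding power2_eq_square by (intro mult_left_mono power_le_one) auto
        finally show "(norm (e t - d (k n t)))\<^sup>2 \<le> (1/2) ^ n" by simp
      qed
      finally show ?thesis .
    qed
    obtain S :: "'a \<Rightarrow> real" where "AE w in P. (\<lambda>n. (Y (d (k n t)) w - Y (e t) w)\<^sup>2) \<longlonglongrightarrow> 0"
      by (rule geometric_L1_dominated[of "\<lambda>n w. (Y (d (k n t)) w - Y (e t) w)\<^sup>2" P]) (use le in auto)
    then show ?thesis
    proof eventually_elim
      case (elim w)
      have "(\<lambda>n. Y (d (k n t)) w) \<longlonglongrightarrow> Y (e t) w" by (rule tendsto_of_square_bound[OF elim]) simp
      then show ?case unfolding Z_def by (rule limI)
    qed
  qed
  ultimately show ?thesis by (intro exI[of _ Z]) (simp add: split_beta')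
qed

text \<open>
  Through \<open>b\<close>, averaging \<open>Y (e t)\<close> over an event becomes the scalar product \<open>\<langle>e t, b\<rangle>\<close>, which the operator
  \<open>\<Gamma>\<close> can evaluate.
\<close>

lemma representer_of_weight:
  assumes B[measurable]: "B \<in> sets P"
  shows "\<exists>b. \<forall>g. (\<integral>w. indicator B w * Y g w \<partial>P) = inner b g"
proof (rule riesz_representation)
  have i[simp]: "integrable P (\<lambda>w. indicator B w * Y g w)" for g
    by (rule integrable_mult_square_integrable) (auto simp: power2_eq_square simp flip: indicator_inter_arith intro!: integrable_const_bound[where B = 1])
  show "bounded_linear (\<lambda>g. \<integral>w. indicator B w * Y g w \<partial>P)"
  proof (rule bounded_linear_intro[where K = 1])
    show "(\<integral>w. indicator B w * Y (x + y) w \<partial>P) = (\<integral>w. indicator B w * Y x w \<partial>P) + (\<integral>w. indicator B w * Y y w \<partial>P)" for x y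
    proof -
      have "(\<integral>w. indicator B w * Y (x + y) w \<partial>P) = (\<integral>w. indicator B w * Y x w + indicator B w * Y y w \<partial>P)"
        by (rule integral_cong_AE) (use Y_add_scaleR[of x 1 y] in \<open>auto simp: distrib_left\<close>)
      then show ?thesis by simp
    qed
    show "(\<integral>w. indicator B w * Y (r *\<^sub>R x) w \<partial>P) = r *\<^sub>R (\<integral>w. indicator B w * Y x w \<partial>P)" for r x
    proof -
      have "AE w in P. Y (r *\<^sub>R x) w = r * Y x w"
        using Y_add_scaleR[of 0 r x] Y_zero by eventually_elim simp
      then have "(\<integral>w. indicator B w * Y (r *\<^sub>R x) w \<partial>P) = (\<integral>w. r * (indicator B w * Y x w) \<partial>P)"
        by (intro integral_cong_AE) auto
      then show ?thesis by simp
    qed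
    show "norm (\<integral>w. indicator B w * Y x w \<partial>P) \<le> norm x * 1" for x
    proof -
      let ?U = "\<lambda>w. indicator B w * Y x w"
      have sq: "integrable P (\<lambda>w. (?U w)\<^sup>2)"
        by (rule Bochner_Integration.integrable_bound[where f = "\<lambda>w. (Y x w)\<^sup>2"]) (auto split: split_indicator)
      have "0 \<le> variance ?U" by (rule variance_positive)
      then have "(expectation ?U)\<^sup>2 \<le> expectation (\<lambda>w. (?U w)\<^sup>2)" using sq by (simp add: variance_eq)
      also have "\<dots> \<le> expectation (\<lambda>w. (Y x w)\<^sup>2)"
        by (rule integral_mono) (use sq in \<open>auto split: split_indicator\<close>)
      also have "\<dots> = (norm x)\<^sup>2" by (rule expectation_Y_square)
      finally show ?thesis by (simp add: abs_le_square_iff[symmetric])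
    qed
  qed
qed

end

section \<open>Evaluation vectors in the two representations\<close>

lemma gaussian_family_member:
  assumes "centered_gaussian_family M I X" "t \<in> I"
  shows "centered_gaussian M (X t)"
proof -
  have "finite {t} \<and> {t} \<subseteq> I" using assms(2) by simp
  from assms(1)[unfolded centered_gaussian_family_def, rule_format, OF this, of "\<lambda>_. 1"]
  show ?thesis by simp
qed

lemma (in pair_sigma_finite) integrable_square_pair:
  fixes f :: "'a \<times> 'b \<Rightarrow> real" and v :: "'b \<Rightarrow> real"
  assumes [measurable]: "f \<in> borel_measurable (M1 \<Otimes>\<^sub>M M2)" and v: "integrable M2 v"
    and le: "AE t in M2. (\<integral>\<^sup>+w. ennreal ((f (w, t))\<^sup>2) \<partial>M1) \<le> ennreal (v t)"
  shows "integrable (M1 \<Otimes>\<^sub>M M2) (\<lambda>p. (f p)\<^sup>2)"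
proof -
  have "(\<integral>\<^sup>+p. ennreal ((f p)\<^sup>2) \<partial>(M1 \<Otimes>\<^sub>M M2)) = (\<integral>\<^sup>+t. \<integral>\<^sup>+w. ennreal ((f (w, t))\<^sup>2) \<partial>M1 \<partial>M2)"
    by (rule nn_integral_snd[symmetric]) measurable
  also have "\<dots> \<le> (\<integral>\<^sup>+t. ennreal (v t) \<partial>M2)" by (intro nn_integral_mono_AE le)
  also have "\<dots> \<le> (\<integral>\<^sup>+t. ennreal (norm (v t)) \<partial>M2)" by (intro nn_integral_mono ennreal_leI) simp
  also have "\<dots> < \<infinity>" using v by (simp add: integrable_iff_bounded)
  finally show ?thesis by (intro integrableI_nonneg) auto
qed

locale gaussian_process_setting =
  fixes M :: "'a measure" and T :: real and X :: "real \<Rightarrow> 'a \<Rightarrow> real" and \<mu> :: "real measure"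
  assumes setting: "gaussian_setting M T X \<mu>"
begin

lemma prob_space_M: "prob_space M" and finite_mu: "finite_measure \<mu>"
  and sets_mu: "sets \<mu> = sets (restrict_space borel {0..T})"
  and joint_measurable: "(\<lambda>(w, t). X t w) \<in> borel_measurable (M \<Otimes>\<^sub>M \<mu>)"
  and gaussian_X: "t \<in> {0..T} \<Longrightarrow> centered_gaussian M (X t)"
proof -
  note s = setting[unfolded gaussian_setting_def]
  show "prob_space M" using s by (elim conjE)
  show "finite_measure \<mu>" using s by (elim conjE)
  show "sets \<mu> = sets (restrict_space borel {0..T})" using s by (elim conjE)
  show "(\<lambda>(w, t). X t w) \<in> borel_measurable (M \<Otimes>\<^sub>M \<mu>)" using s by (elim conjE)
  have "centered_gaussian_family M {0..T} X" using s by (elim conjE)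
  then show "t \<in> {0..T} \<Longrightarrow> centered_gaussian M (X t)" by (rule gaussian_family_member)
qed

lemma space_mu: "space \<mu> = {0..T}"
  using sets_eq_imp_space_eq[OF sets_mu] by (simp add: space_restrict_space)

sublocale M: prob_space M by (rule prob_space_M)
sublocale mu: finite_measure \<mu> by (rule finite_mu)
sublocale M_mu: pair_sigma_finite M \<mu> ..

lemma measurable_X[measurable]: "t \<in> {0..T} \<Longrightarrow> X t \<in> borel_measurable M"
  using gaussian_X by (simp add: centered_gaussian_def)

lemma joint_measurable_pair[measurable]: "(\<lambda>p. X (snd p) (fst p)) \<in> borel_measurable (M \<Otimes>\<^sub>M \<mu>)"
  using joint_measurable by (simp add: split_beta')

lemma joint_measurable_comp[measurable (raw)]:
  "f \<in> measurable N M \<Longrightarrow> g \<in> measurable N \<mu> \<Longrightarrow> (\<lambda>x. X (g x) (f x)) \<in> borel_measurable N"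
  using measurable_compose[OF measurable_Pair[of f N M g \<mu>] joint_measurable_pair] by simp

lemma measurable_covariance: "s \<in> {0..T} \<Longrightarrow> covariance M X s \<in> borel_measurable \<mu>"
  unfolding covariance_def[abs_def] by measurable

lemma measurable_covariance_joint: "(\<lambda>(t, s). covariance M X s t) \<in> borel_measurable (\<mu> \<Otimes>\<^sub>M \<mu>)"
  unfolding covariance_def[abs_def] by measurable

lemma measurable_variance: "(\<lambda>t. covariance M X t t) \<in> borel_measurable \<mu>"
  unfolding covariance_def by measurable

lemma integrable_X_square: "t \<in> {0..T} \<Longrightarrow> integrable M (\<lambda>w. (X t w)\<^sup>2)"
  by (rule centered_gaussian_square_integrable[OF prob_space_M gaussian_X])

end

text \<open>
  This is what the risk identity uses of either representation. The last condition says that \<open>\<Gamma>\<close> is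
  injective, so that \<open>\<Gamma>\<^sup>-\<^sup>1 u\<close> is unique.
\<close>

definition evaluation_vectors ::
  "'a measure \<Rightarrow> real \<Rightarrow> (real \<Rightarrow> 'a \<Rightarrow> real) \<Rightarrow> real measure \<Rightarrow>
   ('h::real_inner \<Rightarrow> 'a \<Rightarrow> real) \<Rightarrow> ('h \<Rightarrow> real \<Rightarrow> real) \<Rightarrow> (real \<Rightarrow> 'h) \<Rightarrow> bool" where
  "evaluation_vectors M T X \<mu> W \<Gamma> e \<longleftrightarrow>
     (\<forall>t\<in>{0..T}. \<forall>g. \<Gamma> g t = inner (e t) g) \<and>
     (\<forall>g. (\<lambda>t. inner (e t) g) \<in> borel_measurable \<mu>) \<and>
     (AE t in \<mu>. AE w in M. W (e t) w = X t w) \<and>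
     integrable \<mu> (\<lambda>t. covariance M X t t) \<and>
     (\<forall>v. (\<forall>t\<in>{0..T}. inner (e t) v = 0) \<longrightarrow> v = 0)"

lemma leb_upto_integral:
  "(\<integral>s. f s \<partial>leb_upto t) = (\<integral>s. indicator {0..t} s * f s \<partial>lborel)" for f :: "real \<Rightarrow> real"
  unfolding leb_upto_def by (subst integral_restrict_space) auto

lemma is_CM_deriv_integrable:
  assumes "is_CM_deriv T h h'"
  shows "integrable (leb_upto T) h'" "integrable lborel (\<lambda>s. indicator {0..T} s * h' s)"
proof -
  have "finite_measure (leb_upto T)"
    unfolding leb_upto_def by (intro finite_measureI) (simp add: emeasure_restrict_space space_restrict_space emeasure_lborel_Icc_eq)
  then interpret finite_measure "leb_upto T" .
  have [measurable]: "h' \<in> borel_measurable (leb_upto T)" and "integrable (leb_upto T) (\<lambda>s. (h' s)\<^sup>2)"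
    using assms by (auto simp: is_CM_deriv_def L2_fun_def)
  then show i: "integrable (leb_upto T) h'"
    using integrable_mult_square_integrable[of h' "leb_upto T" "\<lambda>_. 1"] by simp
  then show "integrable lborel (\<lambda>s. indicator {0..T} s * h' s)"
    unfolding leb_upto_def by (subst (asm) integrable_restrict_space) auto
qed

lemma is_CM_deriv_CM_deriv: "h \<in> CM T \<Longrightarrow> is_CM_deriv T h (CM_deriv T h)"
  unfolding CM_def CM_deriv_def mem_Collect_eq by (erule someI_ex)

lemma chi_in_CM:
  assumes "0 \<le> t" "t \<le> T" shows "is_CM_deriv T (chi t) (indicator {0..t})"
proof -
  have "(\<integral>r. indicator {0..t} r \<partial>leb_upto s) = min s t" if "0 \<le> s" for s
  proof -
    have "(\<integral>r. indicator {0..t} r \<partial>leb_upto s) = (\<integral>r. indicator {0..min s t} r \<partial>lborel :: real)"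
      unfolding leb_upto_integral by (rule Bochner_Integration.integral_cong) (auto split: split_indicator)
    then show ?thesis using assms that by simp
  qed
  moreover have "integrable (leb_upto T) (\<lambda>x. (indicator {0..t} x :: real)\<^sup>2)"
  proof -
    have "integrable lborel (indicator {0..min T t} :: real \<Rightarrow> real)"
      by (rule integrable_real_indicator) (auto simp: emeasure_lborel_Icc_eq)
    then show ?thesis unfolding leb_upto_def
      by (subst integrable_restrict_space) (auto simp: power2_eq_square simp flip: indicator_inter_arith)
  qed
  moreover have "(indicator {0..t} :: real \<Rightarrow> real) \<in> borel_measurable (leb_upto T)"
    unfolding leb_upto_def by (rule measurable_restrict_space1) simp
  ultimately show ?thesis unfolding is_CM_deriv_def L2_fun_def chi_def by auto
qed

text \<open>Two densities with the same primitive have the same integrals over all half-lines.\<close>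

lemma AE_eq_of_primitive_eq:
  assumes c: "is_CM_deriv T h c1" "is_CM_deriv T h c2" and T: "0 \<le> T"
  shows "AE s in lborel. indicator {0..T} s * c1 s = indicator {0..T} s * c2 s"
proof -
  let ?f = "\<lambda>s. indicator {0..T} s * c1 s - indicator {0..T} s * c2 s"
  have cut: "(\<integral>s. indicator {..a} s * ?f s \<partial>lborel) = 0" for a
  proof (cases "a < 0")
    case True
    then have "(\<integral>s. indicator {..a} s * ?f s \<partial>lborel) = (\<integral>s. 0 \<partial>(lborel :: real measure))"
      by (intro Bochner_Integration.integral_cong) (auto split: split_indicator)
    then show ?thesis by simp
  next
    case False
    define b where "b = min a T"
    have b: "0 \<le> b" "b \<le> T" using False T by (auto simp: b_def)
    have e: "indicator {..a} s * (indicator {0..T} s * c s) = indicator {0..b} s * c s" for s and c :: "real \<Rightarrow> real"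
      by (auto simp: b_def split: split_indicator)
    have i: "integrable lborel (\<lambda>s. indicator {0..b} s * c s)" if "is_CM_deriv T h c" for c
      unfolding e[symmetric]
      using integrable_mult_indicator[OF _ is_CM_deriv_integrable(2)[OF that], of "{..a}"] by simp
    have "(\<integral>s. indicator {..a} s * ?f s \<partial>lborel) = (\<integral>s. indicator {0..b} s * c1 s \<partial>lborel) - (\<integral>s. indicator {0..b} s * c2 s \<partial>lborel)"
      unfolding right_diff_distrib e using i[OF c(1)] i[OF c(2)] by simp
    also have "\<dots> = h b - h b" using c b unfolding is_CM_deriv_def leb_upto_integral by auto
    finally show ?thesis by simp
  qed
  have i: "integrable lborel ?f" using is_CM_deriv_integrable(2)[OF c(1)] is_CM_deriv_integrable(2)[OF c(2)] by simp
  have "AE s in lborel. ?f s = 0"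
  proof (rule AE_zero_of_pi_system[OF i, where E = "range atMost"])
    show "Int_stable (range (atMost :: real \<Rightarrow> _))" by (auto simp: Int_stable_def)
    show "sets lborel = sigma_sets (space lborel) (range (atMost :: real \<Rightarrow> _))"
      by (subst sets_lborel, subst borel_eq_atMost) simp
    have "?f s = indicator {..T} s * ?f s" for s by (auto split: split_indicator)
    then show "(\<integral>s. ?f s \<partial>lborel) = 0" using cut[of T] by presburger
    show "(\<integral>s. indicator A s * ?f s \<partial>lborel) = 0" if "A \<in> range atMost" for A using that cut by auto
  qed auto
  then show ?thesis by eventually_elim simp
qed

text \<open>The reproducing property of \<open>chi t\<close>: its density is the indicator of \<open>[0,t]\<close>.\<close>

lemma CM_inner_chi:
  assumes t: "0 \<le> t" "t \<le> T" and k: "k \<in> CM T"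
  shows "CM_inner T (chi t) k = k t"
proof -
  have chi: "chi t \<in> CM T" using chi_in_CM[OF t] by (auto simp: CM_def)
  note c = is_CM_deriv_CM_deriv[OF chi] and k' = is_CM_deriv_CM_deriv[OF k]
  let ?c = "CM_deriv T (chi t)" and ?k = "CM_deriv T k"
  have AE: "AE s in lborel. indicator {0..T} s * ?c s = indicator {0..T} s * indicator {0..t} s"
    by (rule AE_eq_of_primitive_eq[OF c chi_in_CM[OF t]]) (use t in simp)
  have [measurable]: "(\<lambda>s. indicator {0..T} s * ?c s) \<in> borel_measurable lborel"
      "(\<lambda>s. indicator {0..T} s * ?k s) \<in> borel_measurable lborel"
    using is_CM_deriv_integrable(2)[OF c] is_CM_deriv_integrable(2)[OF k'] by auto
  have sq: "indicator {0..T} s * (a * b) = (indicator {0..T} s * a) * (indicator {0..T} s * b)" for s a b :: real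
    by (auto split: split_indicator)
  have "CM_inner T (chi t) k = (\<integral>s. (indicator {0..T} s * ?c s) * (indicator {0..T} s * ?k s) \<partial>lborel)"
    unfolding CM_inner_def leb_upto_integral sq ..
  also have "\<dots> = (\<integral>s. indicator {0..t} s * (indicator {0..T} s * ?k s) \<partial>lborel)"
    by (rule integral_cong_AE) (use AE in \<open>auto split: split_indicator\<close>)
  also have "\<dots> = (\<integral>s. ?k s \<partial>leb_upto t)"
    unfolding leb_upto_integral by (rule Bochner_Integration.integral_cong) (use t in \<open>auto split: split_indicator\<close>)
  also have "\<dots> = k t" using k' t by (auto simp: is_CM_deriv_def)
  finally show ?thesis .
qed

lemma CM_bounded:
  assumes "k \<in> CM T" shows "\<exists>B. \<forall>t\<in>{0..T}. \<bar>k t\<bar> \<le> B"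
proof -
  note k' = is_CM_deriv_CM_deriv[OF assms]
  let ?k = "CM_deriv T k"
  have i: "integrable lborel (\<lambda>s. \<bar>indicator {0..T} s * ?k s\<bar>)" using is_CM_deriv_integrable(2)[OF k'] by auto
  have "\<bar>k t\<bar> \<le> (\<integral>s. \<bar>indicator {0..T} s * ?k s\<bar> \<partial>lborel)" if t: "t \<in> {0..T}" for t
  proof -
    have "k t = (\<integral>s. indicator {0..t} s * (indicator {0..T} s * ?k s) \<partial>lborel)"
    proof -
      have "k t = (\<integral>s. indicator {0..t} s * ?k s \<partial>lborel)" using k' t by (auto simp: is_CM_deriv_def leb_upto_integral)
      also have "\<dots> = (\<integral>s. indicator {0..t} s * (indicator {0..T} s * ?k s) \<partial>lborel)"
        by (rule Bochner_Integration.integral_cong) (use t in \<open>auto split: split_indicator\<close>)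
      finally show ?thesis .
    qed
    also have "\<bar>\<dots>\<bar> \<le> (\<integral>s. \<bar>indicator {0..t} s * (indicator {0..T} s * ?k s)\<bar> \<partial>lborel)"
      using integral_norm_bound[of lborel "\<lambda>s. indicator {0..t} s * (indicator {0..T} s * ?k s)"] by simp
    also have "\<dots> \<le> (\<integral>s. \<bar>indicator {0..T} s * ?k s\<bar> \<partial>lborel)"
      by (rule integral_mono'[OF i]) (auto split: split_indicator)
    finally show ?thesis .
  qed
  then show ?thesis by blast
qed

text \<open>
  The reproducing property turns \<open>\<langle>chi t, \<Gamma> g\<rangle>\<close> into \<open>(\<Gamma> g)(t)\<close>. Functions in \<open>CM T\<close> are bounded, so by
  uniform boundedness the variance \<open>\<parallel>e t\<parallel>\<^sup>2\<close> is bounded on \<open>[0,T]\<close> and hence integrable.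
\<close>

lemma (in gaussian_process_setting) evaluation_vectors_paley_wiener:
  fixes W :: "'h::{real_inner, banach, second_countable_topology} \<Rightarrow> 'a \<Rightarrow> real"
  assumes "paley_wiener M T X W \<Gamma>"
  shows "\<exists>e. evaluation_vectors M T X \<mu> W \<Gamma> e"
proof -
  obtain e where cov: "\<forall>s\<in>{0..T}. \<forall>t\<in>{0..T}. inner (e s) (e t) = covariance M X s t"
    and dense: "closure (span (e ` {0..T})) = UNIV" and We: "\<forall>t\<in>{0..T}. AE w in M. W (e t) w = X t w"
    and G: "\<forall>g. \<Gamma> g \<in> CM T \<and> (\<forall>t\<in>{0..T}. inner (e t) g = CM_inner T (chi t) (\<Gamma> g))"
    using assms unfolding paley_wiener_def by (elim exE conjE) (rule that)
  note cov = cov[rule_format] and We = We[rule_format]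
    and G = G[rule_format, THEN conjunct1] G[rule_format, THEN conjunct2, rule_format]
  have ev: "\<Gamma> g t = inner (e t) g" if "t \<in> {0..T}" for g t
    using G(2)[OF that, of g] CM_inner_chi[of t T "\<Gamma> g"] G(1)[of g] that by simp
  have m: "(\<lambda>t. inner (e t) g) \<in> borel_measurable \<mu>" for g
  proof (rule weakly_measurable_of_dense[OF dense])
    fix d assume "d \<in> e ` {0..T}"
    then obtain s where s: "s \<in> {0..T}" "d = e s" by blast
    have "(\<lambda>t. inner (e t) d) \<in> borel_measurable \<mu> \<longleftrightarrow> covariance M X s \<in> borel_measurable \<mu>"
      by (rule measurable_cong) (use cov[OF s(1)] s(2) in \<open>simp add: space_mu inner_commute\<close>)
    then show "(\<lambda>t. inner (e t) d) \<in> borel_measurable \<mu>" using measurable_covariance[OF s(1)] by simp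
  qed
  have "\<exists>C. \<forall>t\<in>{0..T}. norm (e t) \<le> C"
    by (rule uniform_boundedness_inner) (use CM_bounded[OF G(1)] ev in simp)
  then obtain C where C: "\<And>t. t \<in> {0..T} \<Longrightarrow> norm (e t) \<le> C" by blast
  have "integrable \<mu> (\<lambda>t. covariance M X t t)"
  proof (rule mu.integrable_const_bound[where B = "C\<^sup>2"])
    have "\<bar>covariance M X t t\<bar> \<le> C\<^sup>2" if "t \<in> {0..T}" for t
    proof -
      have "0 \<le> covariance M X t t" using cov[OF that that] by (metis inner_ge_zero)
      then show ?thesis using cov[OF that that] C[OF that] power_mono[of "norm (e t)" C 2] by (simp add: dot_square_norm)
    qed
    then show "AE t in \<mu>. norm (covariance M X t t) \<le> C\<^sup>2" by (intro AE_I2) (simp add: space_mu)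
  qed (rule measurable_variance)
  moreover have "v = 0" if "\<forall>t\<in>{0..T}. inner (e t) v = 0" for v
    by (rule inner_zero_on_dense[OF dense]) (use that in \<open>auto simp: inner_commute\<close>)
  moreover have "AE t in \<mu>. AE w in M. W (e t) w = X t w"
    by (rule AE_I2) (use We in \<open>simp add: space_mu\<close>)
  ultimately show ?thesis
    unfolding evaluation_vectors_def using ev m by (intro exI[of _ e] conjI ballI allI impI) simp_all
qed

text \<open>
  The relation \<open>X\<^sub>t = W(e\<^sub>t)\<close> is only given after integration against functions of \<open>t\<close>. Let \<open>Z\<close> be a
  measurable version of \<open>W(e\<^sub>t)\<close>, let \<open>B\<close> be an event and \<open>\<phi>\<close> the indicator of a subset of \<open>[0,T]\<close>. With \<open>b\<close>
  representing the average over \<open>B\<close>, the integrals of \<open>\<phi> Z\<close> and of \<open>\<phi> X\<close> over \<open>B \<times> [0,T]\<close> are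
  \<open>\<integral> \<phi> \<Gamma> b d\<mu> = \<langle>\<iota> \<phi>, b\<rangle>\<close> and \<open>E[1\<^sub>B W(\<iota> \<phi>)]\<close>, which agree. As rectangles generate the product
  \<open>\<sigma>\<close>-algebra, \<open>X = Z\<close> almost everywhere.
\<close>

lemma (in gaussian_process_setting) evaluation_vectors_karhunen_loeve:
  fixes W :: "'h::{real_inner, banach, second_countable_topology} \<Rightarrow> 'a \<Rightarrow> real"
  assumes KL: "karhunen_loeve M T X \<mu> W \<Gamma>" and iso: "isonormal M W"
  shows "\<exists>e. evaluation_vectors M T X \<mu> W \<Gamma> e"
proof -
  let ?N = "M \<Otimes>\<^sub>M \<mu>"
  interpret W: isonormal_hilbert M W
    using iso by (simp add: isonormal_hilbert_def isonormal_process_def isonormal_process_axioms_def prob_space_M)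
  from KL obtain \<iota> where
      var: "integrable \<mu> (\<lambda>t. covariance M X t t)"
    and dense: "closure (\<iota> ` L2_fun \<mu>) = UNIV"
    and W\<iota>: "\<And>h. h \<in> L2_fun \<mu> \<Longrightarrow> AE w in M. W (\<iota> h) w = (\<integral>s. X s w * h s \<partial>\<mu>)"
    and G\<iota>: "\<And>g t. g \<in> L2_fun \<mu> \<Longrightarrow> t \<in> {0..T} \<Longrightarrow> \<Gamma> (\<iota> g) t = cov_op M X \<mu> g t"
    and lin: "\<And>t. t \<in> {0..T} \<Longrightarrow> bounded_linear (\<lambda>g. \<Gamma> g t)"
    and pair: "\<And>h g. h \<in> L2_fun \<mu> \<Longrightarrow> inner (\<iota> h) g = (\<integral>t. h t * \<Gamma> g t \<partial>\<mu>)"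
    unfolding karhunen_loeve_def by blast
  have "\<forall>t\<in>{0..T}. \<exists>a. \<forall>g. \<Gamma> g t = inner a g" using riesz_representation[OF lin] by blast
  then obtain e where ev: "\<And>t g. t \<in> {0..T} \<Longrightarrow> \<Gamma> g t = inner (e t) g" by metis
  have dense': "closure (span (\<iota> ` L2_fun \<mu>)) = UNIV"
    using closure_mono[OF span_superset, of "\<iota> ` L2_fun \<mu>"] dense by auto
  have m[measurable]: "(\<lambda>t. inner (e t) g) \<in> borel_measurable \<mu>" for g
  proof (rule weakly_measurable_of_dense[OF dense'])
    fix d assume "d \<in> \<iota> ` L2_fun \<mu>"
    then obtain g where g: "g \<in> L2_fun \<mu>" "d = \<iota> g" by blast
    then have [measurable]: "g \<in> borel_measurable \<mu>" by (simp add: L2_fun_def)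
    note [measurable] = measurable_covariance_joint
    have "(\<lambda>t. inner (e t) d) \<in> borel_measurable \<mu> \<longleftrightarrow> cov_op M X \<mu> g \<in> borel_measurable \<mu>"
      by (rule measurable_cong) (use g ev G\<iota> in \<open>simp add: space_mu\<close>)
    moreover have "cov_op M X \<mu> g \<in> borel_measurable \<mu>" unfolding cov_op_def[abs_def] by measurable
    ultimately show "(\<lambda>t. inner (e t) d) \<in> borel_measurable \<mu>" by simp
  qed
  obtain Z where Zm: "(\<lambda>(w, t). Z t w) \<in> borel_measurable ?N"
    and Z: "\<And>t. t \<in> {0..T} \<Longrightarrow> AE w in M. Z t w = W (e t) w"
    using W.measurable_version[of e \<mu>, OF m] by (auto simp: space_mu)
  have [measurable]: "(\<lambda>p. Z (snd p) (fst p)) \<in> borel_measurable ?N"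
    using Zm by (simp add: split_beta')
  have Zt[measurable]: "Z t \<in> borel_measurable M" if "t \<in> {0..T}" for t
    using measurable_compose[OF measurable_Pair2'[of t \<mu> M] \<open>(\<lambda>p. Z (snd p) (fst p)) \<in> _\<close>] that by (simp add: space_mu)
  interpret N: finite_measure "M \<Otimes>\<^sub>M \<mu>"
    by (rule finite_measure_pair_measure) unfold_locales
  have sqint: "integrable ?N f"
    if [measurable]: "f \<in> borel_measurable ?N" and v: "integrable \<mu> v"
      and le: "\<And>t. t \<in> {0..T} \<Longrightarrow> (\<integral>\<^sup>+w. ennreal ((f (w, t))\<^sup>2) \<partial>M) \<le> ennreal (v t)" for f :: "_ \<Rightarrow> real" and v
  proof -
    have "integrable ?N (\<lambda>p. (f p)\<^sup>2)"
      by (rule M_mu.integrable_square_pair[OF _ v]) (use le in \<open>auto simp: space_mu\<close>)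
    then show ?thesis
      using integrable_mult_square_integrable[of f ?N "\<lambda>_. 1"] by simp
  qed
  have X2: "(\<integral>\<^sup>+w. ennreal ((X t w)\<^sup>2) \<partial>M) = ennreal (covariance M X t t)" if "t \<in> {0..T}" for t
    using integrable_X_square[OF that] by (subst nn_integral_eq_integral) (auto simp: covariance_def power2_eq_square)
  have Z2: "(\<integral>\<^sup>+w. ennreal ((Z t w)\<^sup>2) \<partial>M) = ennreal ((norm (e t))\<^sup>2)" if "t \<in> {0..T}" for t
  proof -
    have "(\<integral>\<^sup>+w. ennreal ((Z t w)\<^sup>2) \<partial>M) = (\<integral>\<^sup>+w. ennreal ((W (e t) w)\<^sup>2) \<partial>M)"
      using Z[OF that] by (intro nn_integral_cong_AE) auto
    then show ?thesis by (subst (asm) nn_integral_eq_integral) (auto simp: W.expectation_Y_square)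
  qed
  have iX: "integrable ?N (\<lambda>p. X (snd p) (fst p))"
    by (rule sqint[OF _ var]) (use X2 in auto)
  \<comment> \<open>A priori \<open>\<parallel>e t\<parallel>\<close> is not known to be integrable, so \<open>Z\<close> is first truncated to the sets where \<open>e\<close> is bounded.\<close>
  define I where "I n = {t \<in> space \<mu>. norm (e t) \<le> real n}" for n :: nat
  have Im[measurable]: "I n \<in> sets \<mu>" for n
    using measurable_norm_ball[OF m, of "real n" 0] by (simp add: I_def)
  have iZ: "integrable ?N (\<lambda>p. indicator (I n) (snd p) * Z (snd p) (fst p))" for n
  proof (rule sqint[of _ "\<lambda>_. (real n)\<^sup>2"])
    fix t assume t: "t \<in> {0..T}"
    show "(\<integral>\<^sup>+w. ennreal ((indicator (I n) (snd (w, t)) * Z (snd (w, t)) (fst (w, t)))\<^sup>2) \<partial>M) \<le> ennreal ((real n)\<^sup>2)"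
      using Z2[OF t] by (cases "t \<in> I n") (auto simp: I_def intro!: ennreal_leI power_mono)
  qed auto
  define f where "f n p = indicator (I n) (snd p) * (X (snd p) (fst p) - Z (snd p) (fst p))" for n p
  have rect: "(\<integral>p. indicator (B \<times> J) p * f n p \<partial>?N) = 0"
    if B[measurable]: "B \<in> sets M" and J[measurable]: "J \<in> sets \<mu>" for B J n
  proof -
    obtain b where b: "\<And>g. (\<integral>w. indicator B w * W g w \<partial>M) = inner b g" using W.representer_of_weight[OF B] by blast
    define \<phi> where "\<phi> t = (indicator (I n) t * indicator J t :: real)" for t
    have [measurable]: "\<phi> \<in> borel_measurable \<mu>" unfolding \<phi>_def[abs_def] by measurable
    have \<phi>: "\<phi> \<in> L2_fun \<mu>" unfolding L2_fun_def
      by (auto intro!: mu.integrable_const_bound[where B = 1] simp: \<phi>_def split: split_indicator)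
    let ?fX = "\<lambda>w t. indicator B w * \<phi> t * X t w" and ?fZ = "\<lambda>w t. indicator B w * \<phi> t * Z t w"
    have i1: "integrable ?N (\<lambda>p. ?fX (fst p) (snd p))"
      by (rule Bochner_Integration.integrable_bound[OF iX]) (auto simp: \<phi>_def split: split_indicator)
    have i2: "integrable ?N (\<lambda>p. ?fZ (fst p) (snd p))"
      by (rule Bochner_Integration.integrable_bound[OF iZ[of n]]) (auto simp: \<phi>_def split: split_indicator)
    have "(\<integral>p. ?fX (fst p) (snd p) \<partial>?N) = (\<integral>w. \<integral>t. ?fX w t \<partial>\<mu> \<partial>M)"
      using M_mu.integral_fst[of ?fX] i1 by (simp add: split_beta')
    also have "\<dots> = (\<integral>w. indicator B w * (\<integral>t. X t w * \<phi> t \<partial>\<mu>) \<partial>M)"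
      by (simp add: mult.assoc mult.commute[of "\<phi> _"])
    also have "\<dots> = (\<integral>w. indicator B w * W (\<iota> \<phi>) w \<partial>M)"
      by (rule integral_cong_AE) (use W\<iota>[OF \<phi>] in auto)
    also have "\<dots> = (\<integral>t. \<phi> t * \<Gamma> b t \<partial>\<mu>)" using b pair[OF \<phi>, of b] by (simp add: inner_commute)
    also have "\<dots> = (\<integral>t. \<integral>w. ?fZ w t \<partial>M \<partial>\<mu>)"
    proof (rule Bochner_Integration.integral_cong[OF refl])
      fix t assume "t \<in> space \<mu>"
      then have t: "t \<in> {0..T}" by (simp add: space_mu)
      have "(\<integral>w. ?fZ w t \<partial>M) = (\<integral>w. \<phi> t * (indicator B w * W (e t) w) \<partial>M)"
        by (rule integral_cong_AE) (use Z[OF t] Zt[OF t] in auto)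
      also have "\<dots> = \<phi> t * \<Gamma> b t" using t by (simp add: b ev inner_commute)
      finally show "\<phi> t * \<Gamma> b t = (\<integral>w. ?fZ w t \<partial>M)" by simp
    qed
    also have "\<dots> = (\<integral>p. ?fZ (fst p) (snd p) \<partial>?N)"
      using M_mu.integral_snd[of ?fZ] i2 by (simp add: split_beta')
    finally have "(\<integral>p. ?fX (fst p) (snd p) - ?fZ (fst p) (snd p) \<partial>?N) = 0" using i1 i2 by simp
    moreover have "indicator (B \<times> J) p * f n p
        = ?fX (fst p) (snd p) - ?fZ (fst p) (snd p)" for p
      by (auto simp: f_def \<phi>_def mem_Times_iff split: split_indicator)
    ultimately show ?thesis by simp
  qed
  have "AE p in ?N. f n p = 0" for n
  proof (rule AE_zero_of_pi_system[OF _ Int_stable_pair_measure_generator[of M \<mu>]])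
    show "integrable ?N (f n)"
      unfolding f_def right_diff_distrib
      by (intro Bochner_Integration.integrable_diff iZ Bochner_Integration.integrable_bound[OF iX]) (auto split: split_indicator)
    show "{a \<times> b |a b. a \<in> sets M \<and> b \<in> sets \<mu>} \<subseteq> Pow (space ?N)"
      by (auto simp: space_pair_measure dest: sets.sets_into_space)
    show "sets ?N = sigma_sets (space ?N) {a \<times> b |a b. a \<in> sets M \<and> b \<in> sets \<mu>}"
      by (simp add: sets_pair_measure space_pair_measure)
    have "(\<integral>p. f n p \<partial>?N)
       = (\<integral>p. indicator (space M \<times> space \<mu>) p * f n p \<partial>?N)"
      by (rule Bochner_Integration.integral_cong) (auto simp: space_pair_measure)
    then show "(\<integral>p. f n p \<partial>?N) = 0"
      using rect[of "space M" "space \<mu>" n] by simp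
  qed (use rect in auto)
  then have "AE p in ?N. \<forall>n. f n p = 0"
    by (subst AE_all_countable) blast
  then have "AE p in ?N. Z (snd p) (fst p) = X (snd p) (fst p)"
  proof (rule AE_mp, intro AE_I2 impI)
    fix p assume p: "p \<in> space ?N" and *: "\<forall>n. f n p = 0"
    obtain n :: nat where "norm (e (snd p)) \<le> n" using real_arch_simple by blast
    then have "snd p \<in> I n" using p by (auto simp: I_def space_pair_measure)
    then show "Z (snd p) (fst p) = X (snd p) (fst p)" using *[rule_format, of n] by (simp add: f_def)
  qed
  then have "AE w in M. AE t in \<mu>. Z t w = X t w" using M_mu.AE_pair by fastforce
  then have "AE t in \<mu>. AE w in M. Z t w = X t w"
    by (subst (asm) M_mu.AE_commute) (auto intro!: borel_measurable_eq)
  then have "AE t in \<mu>. AE w in M. W (e t) w = X t w"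
    using AE_space[of \<mu>]
  proof eventually_elim
    case (elim t)
    then have t: "t \<in> {0..T}" by (simp add: space_mu)
    from Z[OF t] elim(1) show "AE w in M. W (e t) w = X t w" by eventually_elim simp
  qed
  moreover have "v = 0" if v: "\<forall>t\<in>{0..T}. inner (e t) v = 0" for v
  proof (rule inner_zero_on_dense[OF dense'])
    fix d assume "d \<in> \<iota> ` L2_fun \<mu>"
    then obtain h where h: "h \<in> L2_fun \<mu>" "d = \<iota> h" by blast
    have "(\<integral>t. h t * \<Gamma> v t \<partial>\<mu>) = (\<integral>t. 0 \<partial>\<mu>)"
      by (rule Bochner_Integration.integral_cong) (use v ev in \<open>auto simp: space_mu\<close>)
    then show "inner v d = 0" using pair[OF h(1), of v] h(2) by (simp add: inner_commute)
  qed
  ultimately show ?thesis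
    unfolding evaluation_vectors_def using ev m var by (intro exI[of _ e] conjI ballI allI impI) simp_all
qed

section \<open>The risk identity\<close>

text \<open>
  A continuously differentiable extension of \<open>1 / (x + \<epsilon>)\<close> from \<open>[0,\<infinity>)\<close> to the real line with derivative
  \<open>- 1 / (\<bar>x\<bar> + \<epsilon>)\<^sup>2\<close>. The extension is needed because the cylindrical approximations of a positive
  variable may take negative values.
\<close>

definition regularized_inverse :: "real \<Rightarrow> real \<Rightarrow> real" where
  "regularized_inverse \<epsilon> x = 1 / \<epsilon> - x / (\<epsilon> * (\<bar>x\<bar> + \<epsilon>))"

lemma regularized_inverse_nonneg:
  assumes "0 < \<epsilon>" "0 \<le> x" shows "regularized_inverse \<epsilon> x = 1 / (x + \<epsilon>)"
proof -
  have "0 < x + \<epsilon>" "0 < \<epsilon> * \<epsilon> + \<epsilon> * x" using assms by (auto intro!: add_pos_nonneg)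
  then show ?thesis using assms by (simp add: regularized_inverse_def field_simps)
qed

lemma regularized_inverse_nonpos:
  assumes "0 < \<epsilon>" "x \<le> 0" shows "regularized_inverse \<epsilon> x = 2 / \<epsilon> - 1 / (\<epsilon> - x)"
proof -
  have "0 < \<epsilon> - x" "\<bar>x\<bar> = - x" using assms by auto
  then show ?thesis using assms by (simp add: regularized_inverse_def field_simps)
qed

lemma regularized_inverse_bounded:
  assumes "0 < \<epsilon>" shows "\<bar>regularized_inverse \<epsilon> x\<bar> \<le> 2 / \<epsilon>"
proof -
  have "\<bar>x / (\<epsilon> * (\<bar>x\<bar> + \<epsilon>))\<bar> = (\<bar>x\<bar> / (\<bar>x\<bar> + \<epsilon>)) * (1 / \<epsilon>)" using assms by (simp add: abs_mult)
  also have "\<dots> \<le> 1 * (1 / \<epsilon>)" using assms by (intro mult_right_mono) (auto simp: divide_simps)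
  finally have "\<bar>x / (\<epsilon> * (\<bar>x\<bar> + \<epsilon>))\<bar> \<le> 1 / \<epsilon>" by simp
  moreover have "0 < 1 / \<epsilon>" "2 / \<epsilon> = 1 / \<epsilon> + 1 / \<epsilon>" using assms by auto
  ultimately show ?thesis unfolding regularized_inverse_def by linarith
qed

lemma regularized_inverse_derivative:
  assumes \<epsilon>: "0 < \<epsilon>"
  shows "(regularized_inverse \<epsilon> has_real_derivative - (1 / (\<bar>x\<bar> + \<epsilon>)\<^sup>2)) (at x)"
proof (cases x "0::real" rule: linorder_cases)
  case greater
  have "((\<lambda>x. 1 / (x + \<epsilon>)) has_real_derivative - (1 / (\<bar>x\<bar> + \<epsilon>)\<^sup>2)) (at x)"
    using greater \<epsilon> by (auto intro!: derivative_eq_intros simp: power2_eq_square)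
  then show ?thesis
    by (rule has_field_derivative_transform_within_open[where S = "{0<..}"])
       (use greater \<epsilon> in \<open>auto simp: regularized_inverse_nonneg\<close>)
next
  case less
  have "((\<lambda>x. 2 / \<epsilon> - 1 / (\<epsilon> - x)) has_real_derivative - (1 / (\<bar>x\<bar> + \<epsilon>)\<^sup>2)) (at x)"
    using less \<epsilon> by (auto intro!: derivative_eq_intros simp: power2_eq_square)
  then show ?thesis
    by (rule has_field_derivative_transform_within_open[where S = "{..<0}"])
       (use less \<epsilon> in \<open>auto simp: regularized_inverse_nonpos\<close>)
next
  case equal
  have "((\<lambda>h::real. - (1 / (\<epsilon> * (\<bar>h\<bar> + \<epsilon>)))) \<longlongrightarrow> - (1 / (\<epsilon> * (\<bar>0\<bar> + \<epsilon>)))) (at 0)"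
    using \<epsilon> by (intro tendsto_intros) auto
  then have "((\<lambda>h. (regularized_inverse \<epsilon> (0 + h) - regularized_inverse \<epsilon> 0) / h) \<longlongrightarrow> - (1 / (\<epsilon> * (\<bar>0\<bar> + \<epsilon>)))) (at 0)"
    by (rule Lim_transform_eventually)
       (auto simp: regularized_inverse_def eventually_at_filter)
  then show ?thesis using equal by (simp add: DERIV_def power2_eq_square)
qed

lemma regularized_inverse_derivative_bounded:
  fixes x :: real
  assumes "0 < \<epsilon>" shows "\<bar>- (1 / (\<bar>x\<bar> + \<epsilon>)\<^sup>2)\<bar> \<le> 1 / \<epsilon>\<^sup>2"
  using assms by (auto intro!: divide_left_mono power_mono simp: abs_divide)

text \<open>
  Here \<open>e\<close> is only weakly measurable. Replacing \<open>A\<close> by approximations with values in a countable set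
  reduces the claim to fixed second arguments.
\<close>

lemma measurable_inner_pair:
  fixes e :: "'b \<Rightarrow> 'h::{real_inner, second_countable_topology}" and A :: "'a \<Rightarrow> 'h"
  assumes [measurable]: "\<And>g. (\<lambda>t. inner (e t) g) \<in> borel_measurable N" "A \<in> borel_measurable P"
  shows "(\<lambda>p. inner (e (snd p)) (A (fst p))) \<in> borel_measurable (P \<Otimes>\<^sub>M N)"
proof -
  have "{x \<in> space P. norm (A x - d) \<le> r} \<in> sets P" for d r by measurable
  from countable_valued_approximation[OF this] obtain d k where
      [measurable]: "\<And>n::nat. k n \<in> measurable P (count_space (UNIV :: nat set))"
    and k: "\<And>n x. norm (A x - d (k n x)) \<le> (1/2) ^ n" by blast
  have m: "(\<lambda>p. inner (e (snd p)) (d (k n (fst p)))) \<in> borel_measurable (P \<Otimes>\<^sub>M N)" for n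
    by (rule measurable_compose_countable[where f = "\<lambda>j p. inner (e (snd p)) (d j)"]) measurable
  have lim: "(\<lambda>n. d (k n x)) \<longlonglongrightarrow> A x" for x
  proof -
    have "(\<lambda>n. d (k n x) - A x) \<longlonglongrightarrow> 0"
      by (rule Lim_null_comparison[where g = "\<lambda>n. (1/2) ^ n"])
         (use k in \<open>auto simp: norm_minus_commute intro!: always_eventually LIMSEQ_realpow_zero\<close>)
    then show ?thesis by (simp add: LIM_zero_iff)
  qed
  show ?thesis
    by (rule borel_measurable_LIMSEQ_real[where u = "\<lambda>n p. inner (e (snd p)) (d (k n (fst p)))", OF _ m])
       (intro tendsto_inner tendsto_const lim)
qed

lemma integrable_divide_of_lower_bound:
  fixes f g :: "'a \<Rightarrow> real"
  assumes f: "integrable M f" and [measurable]: "g \<in> borel_measurable M" and c: "0 < c" "\<And>x. c \<le> g x"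
  shows "integrable M (\<lambda>x. f x / g x)"
proof (rule Bochner_Integration.integrable_bound)
  have [measurable]: "f \<in> borel_measurable M" using f by auto
  show "(\<lambda>x. f x / g x) \<in> borel_measurable M" by measurable
  show "integrable M (\<lambda>x. f x / c)" using f by simp
  have "\<bar>f x\<bar> / \<bar>g x\<bar> \<le> \<bar>f x\<bar> / \<bar>c\<bar>" for x
    using c(1) c(2)[of x] by (intro divide_left_mono) auto
  then show "AE x in M. norm (f x / g x) \<le> norm (f x / c)" by (simp add: abs_divide)
qed

context pair_sigma_finite
begin

text \<open>
  The limit \<open>\<epsilon> \<rightarrow> 0\<close>. The hypothesis \<open>ibp\<close> is the integration by parts formula with \<open>1 / (F + \<epsilon>)\<close> in place
  of \<open>1 / F\<close>.
\<close>

lemma quadratic_identity_limit: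
  fixes a D DD :: "'a \<times> 'b \<Rightarrow> real" and F L :: "'a \<Rightarrow> real"
  assumes [measurable]: "F \<in> borel_measurable M1" "a \<in> borel_measurable (M1 \<Otimes>\<^sub>M M2)" "D \<in> borel_measurable (M1 \<Otimes>\<^sub>M M2)"
    and pos: "\<And>w. 0 < F w"
    and a2: "integrable (M1 \<Otimes>\<^sub>M M2) (\<lambda>p. (a p)\<^sup>2)" and D2: "integrable (M1 \<Otimes>\<^sub>M M2) (\<lambda>p. (D p)\<^sup>2)"
    and DD: "integrable (M1 \<Otimes>\<^sub>M M2) DD" and L: "\<And>w. L w = (\<integral>t. DD (w, t) \<partial>M2)"
    and ibp: "\<And>\<epsilon>. 0 < \<epsilon> \<Longrightarrow> AE t in M2. (\<integral>w. a (w, t) * (D (w, t) / (F w + \<epsilon>)) \<partial>M1)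
      = (\<integral>w. DD (w, t) / (F w + \<epsilon>) \<partial>M1) - (\<integral>w. (D (w, t) / (F w + \<epsilon>))\<^sup>2 \<partial>M1)"
  shows "(\<integral>\<^sup>+p. ennreal ((a p + D p / F (fst p))\<^sup>2) \<partial>(M1 \<Otimes>\<^sub>M M2)) + (\<integral>\<^sup>+p. ennreal ((D p / F (fst p))\<^sup>2) \<partial>(M1 \<Otimes>\<^sub>M M2))
       + 2 * (\<integral>\<^sup>+w. ennreal (- (L w / F w)) \<partial>M1)
     = ennreal (\<integral>p. (a p)\<^sup>2 \<partial>(M1 \<Otimes>\<^sub>M M2)) + 2 * (\<integral>\<^sup>+w. ennreal (L w / F w) \<partial>M1)"
proof -
  let ?N = "M1 \<Otimes>\<^sub>M M2"
  let ?sq = "\<lambda>f. \<integral>\<^sup>+p. ennreal ((f p)\<^sup>2) \<partial>?N" and ?R = "\<integral>p. (a p)\<^sup>2 \<partial>?N"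
  have iL: "integrable M1 L" using integrable_fst'[OF DD] by (simp add: L[abs_def])
  then have [measurable]: "L \<in> borel_measurable M1" by auto
  define \<epsilon> where "\<epsilon> n = 1 / real (Suc n)" for n
  have \<epsilon>: "0 < \<epsilon> n" for n by (simp add: \<epsilon>_def)
  have \<epsilon>mono: "\<epsilon> n \<le> \<epsilon> m" if "m \<le> n" for m n using that by (auto simp: \<epsilon>_def intro!: divide_left_mono)
  have \<epsilon>0: "\<epsilon> \<longlonglongrightarrow> 0" unfolding \<epsilon>_def using LIMSEQ_inverse_real_of_nat by (simp add: inverse_eq_divide)
  define b where "b n p = D p / (F (fst p) + \<epsilon> n)" for n p
  have [measurable]: "b n \<in> borel_measurable ?N" for n unfolding b_def[abs_def] by measurable
  have Fn: "0 < F w + \<epsilon> n" for w n using pos[of w] \<epsilon>[of n] by linarith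
  have inv_mono: "1 / (F w + \<epsilon> m) \<le> 1 / (F w + \<epsilon> n)" if "m \<le> n" for w m n
    using \<epsilon>mono[OF that] Fn by (intro divide_left_mono) auto
  have inv_lim: "(\<lambda>n. x / (F w + \<epsilon> n)) \<longlonglongrightarrow> x / F w" for x w
  proof -
    have "(\<lambda>n. x / (F w + \<epsilon> n)) \<longlonglongrightarrow> x / (F w + 0)" using pos[of w] by (intro tendsto_intros \<epsilon>0) auto
    then show ?thesis by simp
  qed
  have b2: "integrable ?N (\<lambda>p. (b n p)\<^sup>2)" for n
    unfolding b_def power_divide
    by (rule integrable_divide_of_lower_bound[OF D2, of _ "(\<epsilon> n)\<^sup>2"])
       (use pos \<epsilon>[of n] in \<open>auto intro!: power_mono simp: less_imp_le\<close>)
  have ab: "integrable ?N (\<lambda>p. a p * b n p)" for n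
    by (rule integrable_mult_square_integrable) (use a2 b2 in auto)
  have iD\<epsilon>: "integrable ?N (\<lambda>p. DD p / (F (fst p) + \<epsilon> n))" for n
    by (rule integrable_divide_of_lower_bound[OF DD, of _ "\<epsilon> n"]) (use pos \<epsilon>[of n] in \<open>auto simp: less_imp_le\<close>)
  have iL\<epsilon>: "integrable M1 (\<lambda>w. L w / (F w + \<epsilon> n))" for n
    using integrable_fst'[OF iD\<epsilon>[of n]] by (simp add: L)
  have DL: "(\<integral>p. DD p / (F (fst p) + \<epsilon> n) \<partial>?N) = (\<integral>w. L w / (F w + \<epsilon> n) \<partial>M1)" for n
    using integral_fst'[OF iD\<epsilon>[of n]] by (simp add: L)
  have sq: "(a p + b n p)\<^sup>2 = (a p)\<^sup>2 + 2 * (a p * b n p) + (b n p)\<^sup>2" for p n by (simp add: power2_eq_square algebra_simps)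
  have iab: "integrable ?N (\<lambda>p. (a p + b n p)\<^sup>2)" for n unfolding sq using a2 ab b2 by simp
  have real_id: "(\<integral>p. (a p + b n p)\<^sup>2 \<partial>?N) + (\<integral>p. (b n p)\<^sup>2 \<partial>?N) = ?R + 2 * (\<integral>w. L w / (F w + \<epsilon> n) \<partial>M1)" for n
  proof -
    have snd: "integrable M2 (\<lambda>t. \<integral>w. f (w, t) \<partial>M1)" "(\<integral>p. f p \<partial>?N) = (\<integral>t. \<integral>w. f (w, t) \<partial>M1 \<partial>M2)"
      if "integrable ?N f" for f :: "_ \<Rightarrow> real"
      using integrable_snd[of "\<lambda>w t. f (w, t)"] integral_snd[of "\<lambda>w t. f (w, t)"] that
      by (simp_all add: split_beta')
    note s = snd[OF ab[of n]] snd[OF b2[of n]] snd[OF iD\<epsilon>[of n]]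
    have "(\<integral>p. a p * b n p \<partial>?N) = (\<integral>t. (\<integral>w. DD (w, t) / (F w + \<epsilon> n) \<partial>M1) - (\<integral>w. (b n (w, t))\<^sup>2 \<partial>M1) \<partial>M2)"
      unfolding s(2) by (rule integral_cong_AE) (use ibp[OF \<epsilon>[of n]] s(1,3,5) in \<open>auto simp: b_def\<close>)
    then have "(\<integral>p. a p * b n p \<partial>?N) = (\<integral>w. L w / (F w + \<epsilon> n) \<partial>M1) - (\<integral>p. (b n p)\<^sup>2 \<partial>?N)"
      using s(3,5) unfolding DL[symmetric] s(4,6) by simp
    then show ?thesis unfolding sq using a2 ab b2 by simp
  qed
  define p q where "p n = (\<integral>\<^sup>+w. ennreal (L w / (F w + \<epsilon> n)) \<partial>M1)"
    and "q n = (\<integral>\<^sup>+w. ennreal (- (L w / (F w + \<epsilon> n))) \<partial>M1)" for n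
  have enn_id: "?sq (\<lambda>p. a p + b n p) + ?sq (b n) + 2 * q n
      = ennreal ?R + 2 * p n" for n
  proof -
    have fin: "p n \<noteq> \<infinity>" "q n \<noteq> \<infinity>"
      using iL\<epsilon>[of n] unfolding real_integrable_def p_def q_def by (auto simp: infinity_ennreal_def)
    then have pq: "p n = ennreal (enn2real (p n))" "q n = ennreal (enn2real (q n))" by (auto simp: less_top)
    have "(\<integral>w. L w / (F w + \<epsilon> n) \<partial>M1) = enn2real (p n) - enn2real (q n)"
      unfolding p_def q_def by (rule real_lebesgue_integral_def[OF iL\<epsilon>])
    then have "(\<integral>p. (a p + b n p)\<^sup>2 \<partial>?N) + (\<integral>p. (b n p)\<^sup>2 \<partial>?N) + 2 * enn2real (q n) = ?R + 2 * enn2real (p n)"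
      using real_id[of n] by simp
    then have "ennreal ((\<integral>p. (a p + b n p)\<^sup>2 \<partial>?N) + (\<integral>p. (b n p)\<^sup>2 \<partial>?N) + 2 * enn2real (q n)) = ennreal (?R + 2 * enn2real (p n))"
      by simp
    then have "ennreal (\<integral>p. (a p + b n p)\<^sup>2 \<partial>?N) + ennreal (\<integral>p. (b n p)\<^sup>2 \<partial>?N) + 2 * q n
       = ennreal ?R + 2 * p n"
      by (subst pq(1), subst pq(2)) (simp add: ennreal_plus ennreal_mult flip: ennreal_numeral)
    then show ?thesis using iab b2 by (simp add: nn_integral_eq_integral)
  qed
  have mono_lim: "(\<lambda>n. \<integral>\<^sup>+w. ennreal (g w / (F w + \<epsilon> n)) \<partial>M1) \<longlonglongrightarrow> (\<integral>\<^sup>+w. ennreal (g w / F w) \<partial>M1)"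
    if [measurable]: "g \<in> borel_measurable M1" for g :: "'a \<Rightarrow> real"
  proof (rule nn_integral_LIMSEQ)
    show "incseq (\<lambda>n w. ennreal (g w / (F w + \<epsilon> n)))"
    proof (intro incseq_SucI le_funI)
      fix n w
      show "ennreal (g w / (F w + \<epsilon> n)) \<le> ennreal (g w / (F w + \<epsilon> (Suc n)))"
      proof (cases "0 \<le> g w")
        case True
        then show ?thesis using mult_left_mono[OF inv_mono[of n "Suc n" w], of "g w"] by (intro ennreal_leI) simp
      next
        case False
        then have "g w / (F w + \<epsilon> n) \<le> 0" using Fn[of w n] by (simp add: divide_le_0_iff)
        then show ?thesis by (simp add: ennreal_neg)
      qed
    qed
    show "(\<lambda>n. ennreal (g w / (F w + \<epsilon> n))) \<longlonglongrightarrow> ennreal (g w / F w)" for w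
      by (intro tendsto_ennrealI inv_lim)
  qed simp
  have plim: "p \<longlonglongrightarrow> (\<integral>\<^sup>+w. ennreal (L w / F w) \<partial>M1)"
    and qlim: "q \<longlonglongrightarrow> (\<integral>\<^sup>+w. ennreal (- (L w / F w)) \<partial>M1)"
    using mono_lim[of L] mono_lim[of "\<lambda>w. - L w"] by (simp_all add: p_def[abs_def] q_def[abs_def])
  let ?b = "\<lambda>p. D p / F (fst p)"
  have b_le: "(b m p)\<^sup>2 \<le> (b n p)\<^sup>2" if "m \<le> n" for m n p
    using mult_left_mono[OF power_mono[OF inv_mono[OF that, of "fst p"], of 2], of "(D p)\<^sup>2"] Fn[of "fst p" m]
    by (simp add: b_def power_divide)
  have blim: "(\<lambda>n. b n p) \<longlonglongrightarrow> ?b p" for p unfolding b_def by (rule inv_lim)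
  have b_le_lim: "(b n p)\<^sup>2 \<le> (?b p)\<^sup>2" for n p
  proof (rule LIMSEQ_le_const)
    show "(\<lambda>m. (b m p)\<^sup>2) \<longlonglongrightarrow> (?b p)\<^sup>2" by (intro tendsto_power blim)
    show "\<exists>N. \<forall>m\<ge>N. (b n p)\<^sup>2 \<le> (b m p)\<^sup>2" using b_le by blast
  qed
  have b2lim: "(\<lambda>n. ?sq (b n)) \<longlonglongrightarrow> ?sq ?b"
  proof (rule nn_integral_LIMSEQ)
    show "incseq (\<lambda>n p. ennreal ((b n p)\<^sup>2))" by (intro incseq_SucI le_funI ennreal_leI b_le) simp
    show "(\<lambda>n. ennreal ((b n p)\<^sup>2)) \<longlonglongrightarrow> ennreal ((?b p)\<^sup>2)" for p
      by (intro tendsto_ennrealI tendsto_power blim)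
  qed simp
  have two: "(\<lambda>n. 2 * f n) \<longlonglongrightarrow> 2 * l" if "f \<longlonglongrightarrow> l" for f :: "nat \<Rightarrow> ennreal" and l
    using tendsto_add[OF that that] by (simp flip: mult_2)
  have rhs: "(\<lambda>n. ennreal ?R + 2 * p n) \<longlonglongrightarrow> ennreal ?R + 2 * (\<integral>\<^sup>+w. ennreal (L w / F w) \<partial>M1)"
    by (intro tendsto_add tendsto_const two plim)
  show ?thesis
  proof (cases "?sq ?b = \<infinity>")
    case True
    have "?sq ?b \<le> ennreal ?R + 2 * (\<integral>\<^sup>+w. ennreal (L w / F w) \<partial>M1)"
    proof (rule LIMSEQ_le[OF b2lim rhs], intro exI allI impI)
      fix n
      have "?sq (b n) \<le> ?sq (\<lambda>p. a p + b n p) + ?sq (b n) + 2 * q n"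
        by (simp add: add_increasing add_increasing2)
      then show "?sq (b n) \<le> ennreal ?R + 2 * p n" by (simp only: enn_id)
    qed
    with True show ?thesis by (simp add: top_unique)
  next
    case False
    have "(\<lambda>n. ?sq (\<lambda>p. a p + b n p)) \<longlonglongrightarrow> ?sq (\<lambda>p. a p + ?b p)"
    proof (rule nn_integral_dominated_convergence[where w = "\<lambda>p. ennreal (2 * (a p)\<^sup>2 + 2 * (?b p)\<^sup>2)"])
      have "ennreal ((a p + b n p)\<^sup>2) \<le> ennreal (2 * (a p)\<^sup>2 + 2 * (?b p)\<^sup>2)" for p n
        using square_norm_add_le[of "a p" "b n p"] b_le_lim[of n p] by (intro ennreal_leI) simp
      then show "AE p in ?N. ennreal ((a p + b n p)\<^sup>2) \<le> ennreal (2 * (a p)\<^sup>2 + 2 * (?b p)\<^sup>2)" for n by simp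
      have "integrable ?N (\<lambda>p. (?b p)\<^sup>2)" using False by (intro integrableI_nonneg) (auto simp: less_top)
      then have "integrable ?N (\<lambda>p. 2 * (a p)\<^sup>2 + 2 * (?b p)\<^sup>2)" using a2 by simp
      then show "(\<integral>\<^sup>+p. ennreal (2 * (a p)\<^sup>2 + 2 * (?b p)\<^sup>2) \<partial>?N) < \<infinity>"
        by (subst nn_integral_eq_integral) auto
      show "AE p in ?N. (\<lambda>n. ennreal ((a p + b n p)\<^sup>2)) \<longlonglongrightarrow> ennreal ((a p + ?b p)\<^sup>2)"
        by (intro AE_I2 tendsto_ennrealI tendsto_power tendsto_add tendsto_const blim)
    qed auto
    then have "(\<lambda>n. ?sq (\<lambda>p. a p + b n p) + ?sq (b n) + 2 * q n)
      \<longlonglongrightarrow> ?sq (\<lambda>p. a p + ?b p) + ?sq ?b + 2 * (\<integral>\<^sup>+w. ennreal (- (L w / F w)) \<partial>M1)"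
      by (intro tendsto_add b2lim two qlim)
    from LIMSEQ_unique[OF this[unfolded enn_id] rhs] show ?thesis .
  qed
qed

end

theorem proposition5p2:
  fixes M Pu :: "'a measure" and T :: real and X :: "real \<Rightarrow> 'a \<Rightarrow> real"
    and \<mu> :: "real measure"
    and W Xu :: "'h::{real_inner, banach, second_countable_topology} \<Rightarrow> 'a \<Rightarrow> real"
    and \<Gamma> :: "'h \<Rightarrow> real \<Rightarrow> real" and h :: "nat \<Rightarrow> 'h"
    and u :: "real \<Rightarrow> real" and F :: "'a \<Rightarrow> real"
    and DF DlogF DDF :: "real \<Rightarrow> 'a \<Rightarrow> real" and LF :: "'a \<Rightarrow> real"
  assumes "gaussian_setting M T X \<mu>"
    and "isonormal M W"
    and "paley_wiener M T X W \<Gamma> \<or> karhunen_loeve M T X \<mu> W \<Gamma>"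
    and "closure (span (range h)) = UNIV"
    and "is_drift T \<Gamma> u"
    and "Pu = drift_measure M T W \<Gamma> u"
    and "Xu = shifted T W \<Gamma> u"
    and "AE \<omega> in M. F \<omega> > 0"
    and "F \<in> Dom_nabla Pu Xu h"
    and "DF = mderiv Pu Xu h \<Gamma> F"
    and "DlogF = mderiv_log Pu Xu h \<Gamma> F"
    and "\<forall>t\<in>{0..T}. DF t \<in> Dom_nabla Pu Xu h"
    and "is_second_mderiv Pu Xu h \<Gamma> \<mu> F DDF"
    and "LF = laplacian \<mu> DDF"
  shows
    \<comment> \<open>the identity whenever the expectation of \<open>\<Delta>F / F\<close> exists; the other two are then finite\<close>
    "(integrable Pu (\<lambda>\<omega>. LF \<omega> / F \<omega>) \<longrightarrow>
       integrable (Pu \<Otimes>\<^sub>M \<mu>) (\<lambda>(\<omega>, t). (X t \<omega> + DlogF t \<omega> - u t)\<^sup>2) \<and>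
       integrable (Pu \<Otimes>\<^sub>M \<mu>) (\<lambda>(\<omega>, t). (DlogF t \<omega>)\<^sup>2) \<and>
       (\<integral>\<omega>. L2_norm_sq \<mu> (\<lambda>t. X t \<omega> + DlogF t \<omega> - u t) \<partial>Pu)
         = risk Pu X \<mu> u
           - (\<integral>\<omega>. L2_norm_sq \<mu> (\<lambda>t. DlogF t \<omega>) \<partial>Pu)
           + 2 * (\<integral>\<omega>. LF \<omega> / F \<omega> \<partial>Pu))
     \<and> \<comment> \<open>without integrability assumption: the identity in \<open>[0,\<infinity>]\<close>, negative terms moved to the left\<close>
     (\<integral>\<^sup>+\<omega>. (\<integral>\<^sup>+t. ennreal ((X t \<omega> + DlogF t \<omega> - u t)\<^sup>2) \<partial>\<mu>) \<partial>Pu)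
         + (\<integral>\<^sup>+\<omega>. (\<integral>\<^sup>+t. ennreal ((DlogF t \<omega>)\<^sup>2) \<partial>\<mu>) \<partial>Pu)
         + 2 * (\<integral>\<^sup>+\<omega>. ennreal (- (LF \<omega> / F \<omega>)) \<partial>Pu)
       = ennreal (risk Pu X \<mu> u) + 2 * (\<integral>\<^sup>+\<omega>. ennreal (LF \<omega> / F \<omega>) \<partial>Pu)"
proof -
  interpret gaussian_process_setting M T X \<mu> by unfold_locales (rule assms(1))
  interpret W: isonormal_process M W
    using assms(2) by (simp add: isonormal_process_def isonormal_process_axioms_def prob_space_M)
  obtain e where "evaluation_vectors M T X \<mu> W \<Gamma> e"
    using assms(3) evaluation_vectors_paley_wiener evaluation_vectors_karhunen_loeve[OF _ assms(2)] by blast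
  note e_facts = this[unfolded evaluation_vectors_def]
  have ev: "\<And>t g. t \<in> {0..T} \<Longrightarrow> \<Gamma> g t = inner (e t) g" using e_facts by blast
  have em[measurable]: "\<And>g. (\<lambda>t. inner (e t) g) \<in> borel_measurable \<mu>" using e_facts by blast
  have We: "AE t in \<mu>. AE w in M. W (e t) w = X t w" using e_facts by blast
  have var: "integrable \<mu> (\<lambda>t. covariance M X t t)" using e_facts by blast
  have inj: "v = 0" if "\<And>t. t \<in> {0..T} \<Longrightarrow> inner (e t) v = 0" for v using e_facts that by blast
  define v where "v = Gamma_inv T \<Gamma> u"
  obtain v' where v': "\<forall>t\<in>{0..T}. \<Gamma> v' t = u t" using assms(5) by (auto simp: is_drift_def)
  have "v = v'" unfolding v_def Gamma_inv_def
  proof (rule the_equality)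
    fix z assume z: "\<forall>t\<in>{0..T}. \<Gamma> z t = u t"
    have "z - v' = 0" by (rule inj) (use z v' ev in \<open>simp add: inner_diff_right\<close>)
    then show "z = v'" by simp
  qed (rule v')
  then have u: "u t = inner (e t) v" if "t \<in> {0..T}" for t using v' ev that by metis
  have Pu: "Pu = density M (\<lambda>w. ennreal (exp (W v w - (1/2) * (norm v)\<^sup>2)))"
    using assms(6) by (simp add: drift_measure_def v_def)
  have Xu: "Xu = (\<lambda>g w. W g w - inner g v)"
    using assms(7) by (simp add: shifted_def[abs_def] v_def fun_eq_iff)
  interpret Q: isonormal_hilbert Pu Xu
    unfolding Pu Xu isonormal_hilbert_def by (rule W.isonormal_tilted)
  have setsPu[measurable_cong]: "sets Pu = sets M" by (simp add: Pu)
  have AEPu: "AE w in Pu. R w" if "AE w in M. R w" for R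
    unfolding Pu by (subst AE_density) (use that in auto)
  interpret N: pair_sigma_finite Pu \<mu> ..
  let ?N = "Pu \<Otimes>\<^sub>M \<mu>"
  have setsN[measurable_cong]: "sets ?N = sets (M \<Otimes>\<^sub>M \<mu>)" by (intro sets_pair_measure_cong setsPu refl)
  \<comment> \<open>The almost sure identities below hold for almost every \<open>t\<close>, with null sets depending on \<open>t\<close>.\<close>
  have XuX: "AE t in \<mu>. AE w in Pu. Xu (e t) w = X t w - inner (e t) v"
    using We
  proof eventually_elim
    case (elim t)
    from AEPu[OF elim] show ?case by eventually_elim (simp add: Xu)
  qed
  have norm_e: "AE t in \<mu>. (norm (e t))\<^sup>2 = covariance M X t t"
    using We AE_space[of \<mu>]
  proof eventually_elim
    case (elim t)
    then have t: "t \<in> {0..T}" by (simp add: space_mu)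
    have "covariance M X t t = (\<integral>w. (W (e t) w)\<^sup>2 \<partial>M)"
      unfolding covariance_def power2_eq_square by (rule integral_cong_AE) (use elim t in auto)
    then show ?case by (simp add: W.expectation_Y_square)
  qed
  define A where "A = nabla Pu Xu h F"
  have A: "is_nabla Pu Xu h F A"
    using assms(9) unfolding A_def nabla_def Dom_nabla_def mem_Collect_eq by (rule someI_ex)
  have Fm[measurable]: "F \<in> borel_measurable Pu" and Am[measurable]: "A \<in> borel_measurable Pu"
    and A2: "integrable Pu (\<lambda>w. (norm (A w))\<^sup>2)"
    using Q.is_nabla_square_integrable[OF A] by auto
  have DF: "DF t w = inner (e t) (A w)" if "t \<in> {0..T}" for t w
    using that by (simp add: assms(10) mderiv_def A_def ev)
  define B where "B t = nabla Pu Xu h (DF t)" for t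
  have B: "is_nabla Pu Xu h (DF t) (B t)" if "t \<in> {0..T}" for t
  proof -
    have "\<exists>G. is_nabla Pu Xu h (DF t) G" using assms(12) that by (simp add: Dom_nabla_def)
    then show ?thesis unfolding B_def nabla_def by (rule someI_ex)
  qed
  have DDint: "integrable ?N (\<lambda>p. DDF (snd p) (fst p))"
    using assms(13) by (simp add: is_second_mderiv_def split_beta')
  have "AE t in \<mu>. AE w in Pu. DDF t w = mderiv Pu Xu h \<Gamma> (mderiv Pu Xu h \<Gamma> F t) t w"
    using assms(13) by (simp add: is_second_mderiv_def)
  then have DDB: "AE t in \<mu>. AE w in Pu. DDF t w = inner (e t) (B t w)"
    using AE_space[of \<mu>]
  proof eventually_elim
    case (elim t)
    then have t: "t \<in> {0..T}" by (simp add: space_mu)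
    from elim(1) show ?case
      by eventually_elim (simp add: mderiv_def[of Pu Xu h \<Gamma> "mderiv Pu Xu h \<Gamma> F t"] B_def assms(10) ev[OF t])
  qed
  have posPu: "AE w in Pu. 0 < F w" by (rule AEPu) (rule assms(8))
  \<comment> \<open>A version of \<open>F\<close> that is positive everywhere.\<close>
  define F' where "F' w = (if 0 < F w then F w else 1)" for w
  have F'pos: "0 < F' w" for w by (simp add: F'_def)
  have [measurable]: "F' \<in> borel_measurable Pu" unfolding F'_def[abs_def] by measurable
  have F'F: "AE w in Pu. F' w = F w" using posPu by eventually_elim (simp add: F'_def)
  define a where "a p = X (snd p) (fst p) - inner (e (snd p)) v" for p
  define D where "D p = inner (e (snd p)) (A (fst p))" for p
  have am[measurable]: "a \<in> borel_measurable ?N" unfolding a_def[abs_def] by measurable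
  have Dm[measurable]: "D \<in> borel_measurable ?N" unfolding D_def[abs_def]
    by (rule measurable_inner_pair) measurable
  have a2: "integrable ?N (\<lambda>p. (a p)\<^sup>2)"
  proof (rule N.integrable_square_pair[OF am var])
    show "AE t in \<mu>. (\<integral>\<^sup>+w. ennreal ((a (w, t))\<^sup>2) \<partial>Pu) \<le> ennreal (covariance M X t t)"
      using XuX norm_e
    proof eventually_elim
      case (elim t)
      have "(\<integral>\<^sup>+w. ennreal ((a (w, t))\<^sup>2) \<partial>Pu) = (\<integral>\<^sup>+w. ennreal ((Xu (e t) w)\<^sup>2) \<partial>Pu)"
        by (rule nn_integral_cong_AE) (use elim(1) in \<open>auto simp: a_def\<close>)
      also have "\<dots> = ennreal ((norm (e t))\<^sup>2)"
        by (subst nn_integral_eq_integral) (auto simp: Q.expectation_Y_square)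
      finally show ?case using elim(2) by simp
    qed
  qed
  have D2: "integrable ?N (\<lambda>p. (D p)\<^sup>2)"
  proof (rule N.integrable_square_pair[OF Dm])
    let ?K = "\<integral>w. (norm (A w))\<^sup>2 \<partial>Pu"
    show "integrable \<mu> (\<lambda>t. covariance M X t t * ?K)" using var by simp
    show "AE t in \<mu>. (\<integral>\<^sup>+w. ennreal ((D (w, t))\<^sup>2) \<partial>Pu) \<le> ennreal (covariance M X t t * ?K)"
      using norm_e
    proof eventually_elim
      case (elim t)
      have "(\<integral>\<^sup>+w. ennreal ((D (w, t))\<^sup>2) \<partial>Pu) \<le> (\<integral>\<^sup>+w. ennreal ((norm (e t))\<^sup>2 * (norm (A w))\<^sup>2) \<partial>Pu)"
        using Cauchy_Schwarz_ineq[of "e t" "A w" for w]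
        by (intro nn_integral_mono ennreal_leI) (simp add: D_def power2_norm_eq_inner)
      also have "\<dots> = ennreal ((norm (e t))\<^sup>2 * ?K)"
        using A2 by (subst nn_integral_eq_integral) auto
      finally show ?case using elim by simp
    qed
  qed
  have [measurable]: "(\<lambda>p. DDF (snd p) (fst p)) \<in> borel_measurable ?N" using DDint by auto
  \<comment> \<open>Integration by parts for fixed \<open>t\<close> in the direction \<open>e t\<close>, with the variables \<open>F\<close> and \<open>D\<^sub>t F\<close>.\<close>
  have ibp: "AE t in \<mu>. (\<integral>w. a (w, t) * (D (w, t) / (F' w + \<epsilon>)) \<partial>Pu)
        = (\<integral>w. DDF t w / (F' w + \<epsilon>) \<partial>Pu) - (\<integral>w. (D (w, t) / (F' w + \<epsilon>))\<^sup>2 \<partial>Pu)"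
    if \<epsilon>: "0 < \<epsilon>" for \<epsilon>
  proof -
    let ?\<psi> = "regularized_inverse \<epsilon>" and ?\<psi>' = "\<lambda>x. - (1 / (\<bar>x\<bar> + \<epsilon>)\<^sup>2)"
    let ?C = "2 / \<epsilon> + 1 / \<epsilon>\<^sup>2"
    have b\<psi>: "\<bar>?\<psi> x\<bar> \<le> ?C" for x using regularized_inverse_bounded[OF \<epsilon>, of x] \<epsilon> by (simp add: add_increasing2)
    have b\<psi>': "\<bar>?\<psi>' x\<bar> \<le> ?C" for x
      using regularized_inverse_derivative_bounded[OF \<epsilon>, of x] \<epsilon> by (meson add_increasing divide_nonneg_pos order_less_imp_le zero_le_numeral)
    have c\<psi>': "continuous_on UNIV ?\<psi>'" using \<epsilon> by (intro continuous_intros) (auto simp: add_nonneg_eq_0_iff)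
    have \<psi>F: "AE w in Pu. ?\<psi> (F w) = 1 / (F' w + \<epsilon>) \<and> ?\<psi>' (F w) = - (1 / (F' w + \<epsilon>)\<^sup>2)"
      using posPu by eventually_elim (simp add: F'_def regularized_inverse_nonneg[OF \<epsilon>])
    show ?thesis
      using XuX DDB AE_space[of \<mu>]
    proof eventually_elim
      case (elim t)
      then have t: "t \<in> {0..T}" by (simp add: space_mu)
      have slice: "(\<lambda>w. f (w, t)) \<in> borel_measurable Pu" if "f \<in> borel_measurable ?N" for f :: "_ \<Rightarrow> real"
        using measurable_compose[OF measurable_Pair2'[of t \<mu> Pu] that] elim(3) by simp
      note [measurable] = slice[OF am] slice[OF Dm] slice[OF \<open>(\<lambda>p. DDF (snd p) (fst p)) \<in> borel_measurable ?N\<close>, simplified]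
      note I = Q.ibp_is_nabla[OF A B[OF t] regularized_inverse_derivative[OF \<epsilon>] c\<psi>' b\<psi> b\<psi>', of "e t"]
      note [measurable] = I(1-3)[THEN borel_measurable_integrable]
      have "(\<integral>w. a (w, t) * (D (w, t) / (F' w + \<epsilon>)) \<partial>Pu) = (\<integral>w. Xu (e t) w * (DF t w * ?\<psi> (F w)) \<partial>Pu)"
      proof (rule integral_cong_AE)
        show "AE w in Pu. a (w, t) * (D (w, t) / (F' w + \<epsilon>)) = Xu (e t) w * (DF t w * ?\<psi> (F w))"
          using \<psi>F elim(1) by eventually_elim (simp add: a_def D_def DF[OF t])
      qed measurable
      moreover have "(\<integral>w. DDF t w / (F' w + \<epsilon>) \<partial>Pu) = (\<integral>w. inner (B t w) (e t) * ?\<psi> (F w) \<partial>Pu)"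
      proof (rule integral_cong_AE)
        show "AE w in Pu. DDF t w / (F' w + \<epsilon>) = inner (B t w) (e t) * ?\<psi> (F w)"
          using \<psi>F elim(2) by eventually_elim (simp add: inner_commute)
      qed measurable
      moreover have "(\<integral>w. - ((D (w, t) / (F' w + \<epsilon>))\<^sup>2) \<partial>Pu) = (\<integral>w. DF t w * (?\<psi>' (F w) * inner (A w) (e t)) \<partial>Pu)"
      proof (rule integral_cong_AE)
        show "AE w in Pu. - ((D (w, t) / (F' w + \<epsilon>))\<^sup>2) = DF t w * (?\<psi>' (F w) * inner (A w) (e t))"
          using \<psi>F by eventually_elim (simp add: D_def DF[OF t] inner_commute power_divide power2_eq_square)
      qed measurable
      ultimately show ?case using I(4) by simp
    qed
  qed
  have LF: "LF w = (\<integral>t. DDF (snd (w, t)) (fst (w, t)) \<partial>\<mu>)" for w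
    by (simp add: assms(14) laplacian_def)
  have limit: "(\<integral>\<^sup>+p. ennreal ((a p + D p / F' (fst p))\<^sup>2) \<partial>?N) + (\<integral>\<^sup>+p. ennreal ((D p / F' (fst p))\<^sup>2) \<partial>?N)
       + 2 * (\<integral>\<^sup>+w. ennreal (- (LF w / F' w)) \<partial>Pu)
     = ennreal (\<integral>p. (a p)\<^sup>2 \<partial>?N) + 2 * (\<integral>\<^sup>+w. ennreal (LF w / F' w) \<partial>Pu)"
    by (rule N.quadratic_identity_limit[OF _ am Dm F'pos a2 D2 DDint LF]) (use ibp in auto)
  have F'FN: "AE p in ?N. F' (fst p) = F (fst p)"
    by (rule N.AE_pair_measure) (use F'F in auto)
  define s1 where "s1 p = (a p + D p / F (fst p))\<^sup>2" for p
  define s2 where "s2 p = (D p / F (fst p))\<^sup>2" for p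
  have [measurable]: "s1 \<in> borel_measurable ?N" "s2 \<in> borel_measurable ?N"
    unfolding s1_def[abs_def] s2_def[abs_def] by measurable
  have "(\<integral>\<^sup>+p. ennreal ((a p + D p / F' (fst p))\<^sup>2) \<partial>?N) = (\<integral>\<^sup>+p. ennreal (s1 p) \<partial>?N)"
    "(\<integral>\<^sup>+p. ennreal ((D p / F' (fst p))\<^sup>2) \<partial>?N) = (\<integral>\<^sup>+p. ennreal (s2 p) \<partial>?N)"
    "(\<integral>\<^sup>+w. ennreal (- (LF w / F' w)) \<partial>Pu) = (\<integral>\<^sup>+w. ennreal (- (LF w / F w)) \<partial>Pu)"
    "(\<integral>\<^sup>+w. ennreal (LF w / F' w) \<partial>Pu) = (\<integral>\<^sup>+w. ennreal (LF w / F w) \<partial>Pu)"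
    using F'F F'FN by (auto intro!: nn_integral_cong_AE simp: s1_def s2_def)
  note identity = limit[unfolded this]
  have stmt: "(X t w + DlogF t w - u t)\<^sup>2 = s1 (w, t)" "(DlogF t w)\<^sup>2 = s2 (w, t)" "(X t w - u t)\<^sup>2 = (a (w, t))\<^sup>2"
    if "t \<in> space \<mu>" for t w
    using that DF[of t w]
    by (simp_all add: space_mu assms(10,11) mderiv_log_def D_def s1_def s2_def a_def u algebra_simps)
  have risk: "risk Pu X \<mu> u = (\<integral>p. (a p)\<^sup>2 \<partial>?N)"
    unfolding risk_def L2_norm_sq_def N.integral_fst'[OF a2, symmetric]
    by (intro Bochner_Integration.integral_cong refl stmt(3))
  have nn1: "(\<integral>\<^sup>+w. (\<integral>\<^sup>+t. ennreal ((X t w + DlogF t w - u t)\<^sup>2) \<partial>\<mu>) \<partial>Pu) = (\<integral>\<^sup>+p. ennreal (s1 p) \<partial>?N)"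
    by (subst mu.nn_integral_fst[symmetric]) (auto intro!: nn_integral_cong simp: stmt(1))
  have nn2: "(\<integral>\<^sup>+w. (\<integral>\<^sup>+t. ennreal ((DlogF t w)\<^sup>2) \<partial>\<mu>) \<partial>Pu) = (\<integral>\<^sup>+p. ennreal (s2 p) \<partial>?N)"
    by (subst mu.nn_integral_fst[symmetric]) (auto intro!: nn_integral_cong simp: stmt(2))
  show ?thesis
  proof (intro conjI impI)
    assume L: "integrable Pu (\<lambda>w. LF w / F w)"
    define p q where "p = (\<integral>\<^sup>+w. ennreal (LF w / F w) \<partial>Pu)" and "q = (\<integral>\<^sup>+w. ennreal (- (LF w / F w)) \<partial>Pu)"
    have fin: "p \<noteq> \<infinity>" "q \<noteq> \<infinity>"
      using L unfolding real_integrable_def p_def q_def by (auto simp: infinity_ennreal_def)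
    then obtain p' q' where pq: "p = ennreal p'" "q = ennreal q'" "0 \<le> p'" "0 \<le> q'"
      by (cases p; cases q) auto
    have Leq: "(\<integral>w. LF w / F w \<partial>Pu) = p' - q'"
      using real_lebesgue_integral_def[OF L] pq by (simp add: p_def[symmetric] q_def[symmetric])
    note id = identity[folded p_def q_def]
    have "(\<integral>\<^sup>+p. ennreal (s1 p) \<partial>?N) + (\<integral>\<^sup>+p. ennreal (s2 p) \<partial>?N) + 2 * q < \<infinity>"
      unfolding id using pq by (simp add: ennreal_mult_less_top)
    then have "(\<integral>\<^sup>+p. ennreal (s1 p) \<partial>?N) < \<infinity>" "(\<integral>\<^sup>+p. ennreal (s2 p) \<partial>?N) < \<infinity>" by auto
    then have i1: "integrable ?N s1" and i2: "integrable ?N s2"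
      by (auto intro!: integrableI_nonneg simp: s1_def s2_def)
    show "integrable ?N (\<lambda>(w, t). (X t w + DlogF t w - u t)\<^sup>2)"
      using i1 by (subst Bochner_Integration.integrable_cong[OF refl, of _ _ s1]) (auto simp: space_pair_measure stmt(1))
    show "integrable ?N (\<lambda>(w, t). (DlogF t w)\<^sup>2)"
      using i2 by (subst Bochner_Integration.integrable_cong[OF refl, of _ _ s2]) (auto simp: space_pair_measure stmt(2))
    have r1: "(\<integral>w. L2_norm_sq \<mu> (\<lambda>t. X t w + DlogF t w - u t) \<partial>Pu) = (\<integral>p. s1 p \<partial>?N)"
      unfolding L2_norm_sq_def N.integral_fst'[OF i1, symmetric]
      by (intro Bochner_Integration.integral_cong refl stmt(1))
    have r2: "(\<integral>w. L2_norm_sq \<mu> (\<lambda>t. DlogF t w) \<partial>Pu) = (\<integral>p. s2 p \<partial>?N)"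
      unfolding L2_norm_sq_def N.integral_fst'[OF i2, symmetric]
      by (intro Bochner_Integration.integral_cong refl stmt(2))
    have n0: "0 \<le> (\<integral>p. s1 p \<partial>?N)" "0 \<le> (\<integral>p. s2 p \<partial>?N)" "0 \<le> (\<integral>p. (a p)\<^sup>2 \<partial>?N)"
      by (simp_all add: s1_def s2_def)
    have e12: "(\<integral>\<^sup>+p. ennreal (s1 p) \<partial>?N) = ennreal (\<integral>p. s1 p \<partial>?N)"
        "(\<integral>\<^sup>+p. ennreal (s2 p) \<partial>?N) = ennreal (\<integral>p. s2 p \<partial>?N)"
      by (rule nn_integral_eq_integral[OF i1], simp add: s1_def)
         (rule nn_integral_eq_integral[OF i2], simp add: s2_def)
    have "ennreal (\<integral>p. s1 p \<partial>?N) + ennreal (\<integral>p. s2 p \<partial>?N) + 2 * ennreal q' = ennreal (\<integral>p. (a p)\<^sup>2 \<partial>?N) + 2 * ennreal p'"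
      using id unfolding pq(1,2) e12 .
    then have "ennreal ((\<integral>p. s1 p \<partial>?N) + (\<integral>p. s2 p \<partial>?N) + 2 * q') = ennreal ((\<integral>p. (a p)\<^sup>2 \<partial>?N) + 2 * p')"
      using n0 pq(3,4) by (simp add: ennreal_plus ennreal_mult)
    then have "(\<integral>p. s1 p \<partial>?N) + (\<integral>p. s2 p \<partial>?N) + 2 * q' = (\<integral>p. (a p)\<^sup>2 \<partial>?N) + 2 * p'"
      using n0 pq(3,4) by (subst (asm) ennreal_inj) auto
    then show "(\<integral>w. L2_norm_sq \<mu> (\<lambda>t. X t w + DlogF t w - u t) \<partial>Pu)
         = risk Pu X \<mu> u - (\<integral>w. L2_norm_sq \<mu> (\<lambda>t. DlogF t w) \<partial>Pu) + 2 * (\<integral>w. LF w / F w \<partial>Pu)"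
      unfolding r1 r2 risk Leq by (simp add: algebra_simps)
  qed (unfold nn1 nn2 risk, rule identity)
qed

end
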